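(* Let $C \subseteq \{N, H, R, L, Fa, Fu\}$. For a distributive $\nabla$-algebra $\mathcal{A}=(\mathsf{A},\nabla,\to)$ let $\mathfrak{S}(\mathcal{A})=(\mathcal{F}_p(\mathsf{A}), \subseteq, R_{\mathcal{A}})$. Here $\mathcal{F}_p(\mathsf{A})$ is the set of prime filters of $\mathsf{A}$ with the topology generated by the basis $\{P \in \mathcal{F}_p(\mathsf{A}) \mid a \in P,\ b \notin P\}$ ($a,b \in A$), and $(P,Q) \in R_{\mathcal{A}}$ iff $\nabla[P] \subseteq Q$. For a $\nabla$-algebra morphism $f:\mathcal{A}\to\mathcal{B}$ let $\mathfrak{S}(f)=f^{-1}:\mathcal{F}_p(\mathsf{B})\to\mathcal{F}_p(\mathsf{A})$. For a $\nabla$-space $\mathscr{X}=(X,\leq,R)$ let $\mathfrak{A}(\mathscr{X})=(CU(X,\leq),\nabla_R,\to_R)$. Here $CU(X,\leq)$ is the lattice of clopen upsets, $\nabla_R(U)=\{x\in X \mid \exists y\in U,\ (y,x)\in R\}$ and $U\to_R V=\{x\in X\mid R[x]\cap U\subseteq V\}$ with $R[x]=\{y\mid (x,y)\in R\}$. For a $\nabla$-space map $f$ let $\mathfrak{A}(f)=f^{-1}$. Then $\mathfrak{S}$ and $\mathfrak{A}$, together with the natural isomorphisms $\alpha:\mathcal{A}\to\mathfrak{A}\mathfrak{S}(\mathcal{A})$, $\alpha(a)=\{P\in\mathcal{F}_p(\mathsf{A})\mid a\in P\}$, and $\beta:(X,\leq,R)\to\mathfrak{S}\mathfrak{A}(X,\leq,R)$,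 $\beta(x)=\{U\in CU(X,\leq)\mid x\in U\}$, establish an equivalence between the categories $\mathbf{Alg}_{\nabla}(D,C)$ and $[\mathbf{Space}_{\nabla}(C)]^{op}$. The same holds for $\mathbf{Alg}^H_{\nabla}(D,C)$ and $[\mathbf{Space}^H_{\nabla}(C)]^{op}$.
   Context: \textbf{$\nabla$-algebras.} A $\nabla$-algebra is a triple $(\mathsf{A},\nabla,\to)$ where $\mathsf{A}$ is a bounded lattice, $\nabla$ is a unary operation and $\to$ a binary operation on $A$, such that for all $a,b,c$: $\nabla c\wedge a\le b$ iff $c\le a\to b$. Write $\Box a=1\to a$. Properties: - (D) distributive: $\mathsf{A}$ is distributive. - (H) Heyting: $\mathsf{A}$ is a Heyting algebra. An explicitly Heyting $\nabla$-algebra is $(\mathsf{A},\nabla,\to,\supset)$ with $\supset$ the Heyting implication added to the signature. - (N) normal: $\nabla 1=1$ and $\nabla(a\wedge b)=\nabla a\wedge\nabla b$. - (R) right: $a\le\nabla a$. - (L) left: $\nabla a\le a$. - (Fa) faithful: $\nabla$ is surjective. - (Fu) full: $\Box$ is surjective, equivalently $\nabla$ is injective. A $\nabla$-algebra morphism is a bounded lattice homomorphism preserving $\nabla$ and $\to$. A Heyting $\nabla$-algebra morphism (between explicitly Heyting ones) additionally preserves $\supset$. $\mathbf{Alg}_\nabla(D,C)$ is the category of distributive $\nabla$-algebras with the properties in $C$ and $\nabla$-algebra morphisms. $\mathbf{Alg}^H_\nabla(D,C)$ is the category of explicitly Heyting $\nabla$-algebras with the properties in $C$ and Heyting $\nabla$-algebra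 morphisms. \textbf{Spaces.} A Priestley space is a compact space with a partial order $\le$ such that whenever $x\not\le y$ there is a clopen upset containing $x$ but not $y$. An Esakia space is a Priestley space in which $\downarrow U$ is clopen for every clopen $U$. A Priestley map is a continuous order-preserving map. An Esakia map is a Priestley map between Esakia spaces with $f[\uparrow x]=\uparrow f(x)$. A $\nabla$-space is $(X,\le,R)$ with $(X,\le)$ a Priestley space and $R\subseteq X^2$ such that: - $x'\le x$, $(x,y)\in R$ and $y\le y'$ imply $(x',y')\in R$; - $R[x]$ is closed for every $x$; - $\lozenge_R(U)=\{x\mid\exists y\in U,\ (x,y)\in R\}$ is clopen for every clopen $U$; - $\nabla_R(V)$ is a clopen upset for every clopen upset $V$. Conditions on a $\nabla$-space: - (N): there is an order-preserving $\pi:X\to X$ with $(x,y)\in R$ iff $x\le\pi(y)$. - (R): $\le\,\subseteq R$. - (L): $R\subseteq\,\le$. - (Fa): for every $x$ there is $y$ with $(y,x)\in R$ such that $(y,z)\in R$ implies $x\le z$. - (Fu): for every $x$ there is $y$ with $(x,y)\in R$ such that $(z,y)\in R$ implies $z\le x$. - (H): $(X,\le)$ is an Esakia space. A $\nabla$-space map $f:(X,\le_X,R_X)\to(Y,\le_Y,R_Y)$ is a continuous order-preserving map such that: - $(k,l)\in R_X$ implies $(f(k),f(l))\in R_Y$; - if $(f(k),l')\in R_Y$ then there is $l$ with $(k,l)\in R_X$ and $f(l)=l'$; - if $(l',f(k))\in R_Y$ then there is $l$ with $(l,k)\in R_X$ and $l'\le_Y f(l)$. A Heyting $\nabla$-space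 map is a $\nabla$-space map that is also an Esakia map. $\mathbf{Space}_\nabla(C)$ is the category of $\nabla$-spaces satisfying the conditions in $C$ with $\nabla$-space maps. $\mathbf{Space}^H_\nabla(C)$ is the category of Heyting $\nabla$-spaces satisfying $C$ with Heyting $\nabla$-space maps. *)

theory Defs
  imports "HOL-Algebra.Lattice" "HOL-Analysis.Abstract_Topology"
begin

section \<open>Algebras\<close>

record 'a nabla_algebra = "'a gorder" +
  nabla :: "'a \<Rightarrow> 'a"
  arrow :: "'a \<Rightarrow> 'a \<Rightarrow> 'a"

record 'a heyting_nabla_algebra = "'a nabla_algebra" +
  himp :: "'a \<Rightarrow> 'a \<Rightarrow> 'a"

locale nabla_algebra = bounded_lattice A for A (structure) +
  assumes nabla_closed: "a \<in> carrier A \<Longrightarrow> nabla A a \<in> carrier A"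
    and arrow_closed: "\<lbrakk>a \<in> carrier A; b \<in> carrier A\<rbrakk> \<Longrightarrow> arrow A a b \<in> carrier A"
    and residuation: "\<lbrakk>a \<in> carrier A; b \<in> carrier A; c \<in> carrier A\<rbrakk> \<Longrightarrow>
      nabla A c \<sqinter> a \<sqsubseteq> b \<longleftrightarrow> c \<sqsubseteq> arrow A a b"

definition box :: "('a, 'm) nabla_algebra_scheme \<Rightarrow> 'a \<Rightarrow> 'a" where
  "box A a = arrow A \<top>\<^bsub>A\<^esub> a"

definition distributive :: "('a, 'm) gorder_scheme \<Rightarrow> bool" where
  "distributive A \<longleftrightarrow> (\<forall>a\<in>carrier A. \<forall>b\<in>carrier A. \<forall>c\<in>carrier A.
     a \<sqinter>\<^bsub>A\<^esub> (b \<squnion>\<^bsub>A\<^esub> c) = (a \<sqinter>\<^bsub>A\<^esub> b) \<squnion>\<^bsub>A\<^esub> (a \<sqinter>\<^bsub>A\<^esub> c))"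

definition is_heyting_implication :: "('a, 'm) gorder_scheme \<Rightarrow> ('a \<Rightarrow> 'a \<Rightarrow> 'a) \<Rightarrow> bool" where
  "is_heyting_implication A i \<longleftrightarrow> (\<forall>a\<in>carrier A. \<forall>b\<in>carrier A. i a b \<in> carrier A \<and>
     (\<forall>c\<in>carrier A. c \<sqinter>\<^bsub>A\<^esub> a \<sqsubseteq>\<^bsub>A\<^esub> b \<longleftrightarrow> c \<sqsubseteq>\<^bsub>A\<^esub> i a b))"

text \<open>The six names N, H, R, L, Fa, Fu; a set \<open>C\<close> of them is a value of type
  \<open>nabla_property set\<close>.\<close>

datatype nabla_property = Normal | Heyting | Right | Left | Faithful | Full

fun algebra_has :: "('a, 'm) nabla_algebra_scheme \<Rightarrow> nabla_property \<Rightarrow> bool" where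
  "algebra_has A Normal \<longleftrightarrow> nabla A \<top>\<^bsub>A\<^esub> = \<top>\<^bsub>A\<^esub> \<and>
     (\<forall>a\<in>carrier A. \<forall>b\<in>carrier A. nabla A (a \<sqinter>\<^bsub>A\<^esub> b) = nabla A a \<sqinter>\<^bsub>A\<^esub> nabla A b)"
| "algebra_has A Heyting \<longleftrightarrow> (\<exists>i. is_heyting_implication A i)"
| "algebra_has A Right \<longleftrightarrow> (\<forall>a\<in>carrier A. a \<sqsubseteq>\<^bsub>A\<^esub> nabla A a)"
| "algebra_has A Left \<longleftrightarrow> (\<forall>a\<in>carrier A. nabla A a \<sqsubseteq>\<^bsub>A\<^esub> a)"
| "algebra_has A Faithful \<longleftrightarrow> nabla A ` carrier A = carrier A"
| "algebra_has A Full \<longleftrightarrow> box A ` carrier A = carrier A"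

definition Alg :: "nabla_property set \<Rightarrow> 'a nabla_algebra set" where
  "Alg C = {A. nabla_algebra A \<and> distributive A \<and> (\<forall>p\<in>C. algebra_has A p)}"

definition AlgH :: "nabla_property set \<Rightarrow> 'a heyting_nabla_algebra set" where
  "AlgH C = {A. nabla_algebra A \<and> distributive A \<and> is_heyting_implication A (himp A) \<and>
     (\<forall>p\<in>C. algebra_has A p)}"

text \<open>In all categories below a morphism is a function that is extensional on the carrier of its
  source, so that equality of morphisms is HOL equality. The identity on \<open>X\<close> is
  \<open>\<lambda>x\<in>X. x\<close> and composition is \<^const>\<open>compose\<close>; the associativity and unit laws
  are \<open>compose_assoc\<close>, \<open>Id_compose\<close> and \<open>compose_Id\<close>. Source and target may have
  different carrier types, since each duality functor turns a structure over \<open>'a\<close> into one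
  over \<open>'a set\<close>.\<close>

definition Hom_Alg ::
  "('a, 'm) nabla_algebra_scheme \<Rightarrow> ('b, 'n) nabla_algebra_scheme \<Rightarrow> ('a \<Rightarrow> 'b) set" where
  "Hom_Alg A B = {f \<in> carrier A \<rightarrow>\<^sub>E carrier B.
     f \<top>\<^bsub>A\<^esub> = \<top>\<^bsub>B\<^esub> \<and> f \<bottom>\<^bsub>A\<^esub> = \<bottom>\<^bsub>B\<^esub> \<and>
     (\<forall>a\<in>carrier A. \<forall>b\<in>carrier A. f (a \<sqinter>\<^bsub>A\<^esub> b) = f a \<sqinter>\<^bsub>B\<^esub> f b) \<and>
     (\<forall>a\<in>carrier A. \<forall>b\<in>carrier A. f (a \<squnion>\<^bsub>A\<^esub> b) = f a \<squnion>\<^bsub>B\<^esub> f b) \<and>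
     (\<forall>a\<in>carrier A. f (nabla A a) = nabla B (f a)) \<and>
     (\<forall>a\<in>carrier A. \<forall>b\<in>carrier A. f (arrow A a b) = arrow B (f a) (f b))}"

definition Hom_AlgH ::
  "('a, 'm) heyting_nabla_algebra_scheme \<Rightarrow> ('b, 'n) heyting_nabla_algebra_scheme \<Rightarrow> ('a \<Rightarrow> 'b) set"
  where
  "Hom_AlgH A B = {f \<in> Hom_Alg A B.
     \<forall>a\<in>carrier A. \<forall>b\<in>carrier A. f (himp A a b) = himp B (f a) (f b)}"


section \<open>Spaces\<close>

definition clopenin :: "'x topology \<Rightarrow> 'x set \<Rightarrow> bool" where
  "clopenin T U \<longleftrightarrow> openin T U \<and> closedin T U"

definition upset :: "'x rel \<Rightarrow> 'x set \<Rightarrow> bool" where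
  "upset r U \<longleftrightarrow> (\<forall>x y. x \<in> U \<and> (x, y) \<in> r \<longrightarrow> y \<in> U)"

definition priestley_space :: "'x topology \<Rightarrow> 'x rel \<Rightarrow> bool" where
  "priestley_space T r \<longleftrightarrow> compact_space T \<and> partial_order_on (topspace T) r \<and>
     (\<forall>x\<in>topspace T. \<forall>y\<in>topspace T. (x, y) \<notin> r \<longrightarrow>
        (\<exists>U. clopenin T U \<and> upset r U \<and> x \<in> U \<and> y \<notin> U))"

definition esakia_space :: "'x topology \<Rightarrow> 'x rel \<Rightarrow> bool" where
  "esakia_space T r \<longleftrightarrow> priestley_space T r \<and>
     (\<forall>U. clopenin T U \<longrightarrow> clopenin T {x. \<exists>y\<in>U. (x, y) \<in> r})"

record 'x nabla_space =
  Topo :: "'x topology"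
  Leq :: "'x rel"
  Rel :: "'x rel"

abbreviation points :: "('x, 'm) nabla_space_scheme \<Rightarrow> 'x set" where
  "points X \<equiv> topspace (Topo X)"

definition rel_nabla :: "('x, 'm) nabla_space_scheme \<Rightarrow> 'x set \<Rightarrow> 'x set" where
  "rel_nabla X U = {x \<in> points X. \<exists>y\<in>U. (y, x) \<in> Rel X}"

definition rel_diamond :: "('x, 'm) nabla_space_scheme \<Rightarrow> 'x set \<Rightarrow> 'x set" where
  "rel_diamond X U = {x \<in> points X. \<exists>y\<in>U. (x, y) \<in> Rel X}"

definition rel_arrow :: "('x, 'm) nabla_space_scheme \<Rightarrow> 'x set \<Rightarrow> 'x set \<Rightarrow> 'x set" where
  "rel_arrow X U V = {x \<in> points X. Rel X `` {x} \<inter> U \<subseteq> V}"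

definition clopen_upsets :: "('x, 'm) nabla_space_scheme \<Rightarrow> 'x set set" where
  "clopen_upsets X = {U. clopenin (Topo X) U \<and> upset (Leq X) U}"

definition nabla_space :: "('x, 'm) nabla_space_scheme \<Rightarrow> bool" where
  "nabla_space X \<longleftrightarrow> priestley_space (Topo X) (Leq X) \<and>
     Rel X \<subseteq> points X \<times> points X \<and>
     (\<forall>x' x y y'. (x', x) \<in> Leq X \<and> (x, y) \<in> Rel X \<and> (y, y') \<in> Leq X \<longrightarrow> (x', y') \<in> Rel X) \<and>
     (\<forall>x\<in>points X. closedin (Topo X) (Rel X `` {x})) \<and>
     (\<forall>U. clopenin (Topo X) U \<longrightarrow> clopenin (Topo X) (rel_diamond X U)) \<and>
     (\<forall>V\<in>clopen_upsets X. rel_nabla X V \<in> clopen_upsets X)"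

fun space_has :: "('x, 'm) nabla_space_scheme \<Rightarrow> nabla_property \<Rightarrow> bool" where
  "space_has X Normal \<longleftrightarrow> (\<exists>\<pi>\<in>points X \<rightarrow> points X.
     (\<forall>x y. (x, y) \<in> Leq X \<longrightarrow> (\<pi> x, \<pi> y) \<in> Leq X) \<and>
     (\<forall>x\<in>points X. \<forall>y\<in>points X. (x, y) \<in> Rel X \<longleftrightarrow> (x, \<pi> y) \<in> Leq X))"
| "space_has X Heyting \<longleftrightarrow> esakia_space (Topo X) (Leq X)"
| "space_has X Right \<longleftrightarrow> Leq X \<subseteq> Rel X"
| "space_has X Left \<longleftrightarrow> Rel X \<subseteq> Leq X"
| "space_has X Faithful \<longleftrightarrow> (\<forall>x\<in>points X. \<exists>y\<in>points X. (y, x) \<in> Rel X \<and>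
     (\<forall>z\<in>points X. (y, z) \<in> Rel X \<longrightarrow> (x, z) \<in> Leq X))"
| "space_has X Full \<longleftrightarrow> (\<forall>x\<in>points X. \<exists>y\<in>points X. (x, y) \<in> Rel X \<and>
     (\<forall>z\<in>points X. (z, y) \<in> Rel X \<longrightarrow> (z, x) \<in> Leq X))"

definition Space :: "nabla_property set \<Rightarrow> 'x nabla_space set" where
  "Space C = {X. nabla_space X \<and> (\<forall>p\<in>C. space_has X p)}"

definition SpaceH :: "nabla_property set \<Rightarrow> 'x nabla_space set" where
  "SpaceH C = {X. nabla_space X \<and> space_has X Heyting \<and> (\<forall>p\<in>C. space_has X p)}"

definition Hom_Space :: "'x nabla_space \<Rightarrow> 'y nabla_space \<Rightarrow> ('x \<Rightarrow> 'y) set" where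
  "Hom_Space X Y = {f \<in> points X \<rightarrow>\<^sub>E points Y.
     continuous_map (Topo X) (Topo Y) f \<and>
     (\<forall>x y. (x, y) \<in> Leq X \<longrightarrow> (f x, f y) \<in> Leq Y) \<and>
     (\<forall>k l. (k, l) \<in> Rel X \<longrightarrow> (f k, f l) \<in> Rel Y) \<and>
     (\<forall>k\<in>points X. \<forall>l'\<in>points Y. (f k, l') \<in> Rel Y \<longrightarrow>
        (\<exists>l\<in>points X. (k, l) \<in> Rel X \<and> f l = l')) \<and>
     (\<forall>k\<in>points X. \<forall>l'\<in>points Y. (l', f k) \<in> Rel Y \<longrightarrow>
        (\<exists>l\<in>points X. (l, k) \<in> Rel X \<and> (l', f l) \<in> Leq Y))}"

definition Hom_SpaceH :: "'x nabla_space \<Rightarrow> 'y nabla_space \<Rightarrow> ('x \<Rightarrow> 'y) set" where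
  "Hom_SpaceH X Y = {f \<in> Hom_Space X Y.
     \<forall>x\<in>points X. f ` (Leq X `` {x}) = Leq Y `` {f x}}"


section \<open>The duality functors and the unit maps\<close>

definition lattice_filter :: "('a, 'm) gorder_scheme \<Rightarrow> 'a set \<Rightarrow> bool" where
  "lattice_filter A P \<longleftrightarrow> P \<subseteq> carrier A \<and> P \<noteq> {} \<and>
     (\<forall>a\<in>P. \<forall>b\<in>carrier A. a \<sqsubseteq>\<^bsub>A\<^esub> b \<longrightarrow> b \<in> P) \<and>
     (\<forall>a\<in>P. \<forall>b\<in>P. a \<sqinter>\<^bsub>A\<^esub> b \<in> P)"

definition prime_filters :: "('a, 'm) gorder_scheme \<Rightarrow> 'a set set" where
  "prime_filters A = {P. lattice_filter A P \<and> P \<noteq> carrier A \<and>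
     (\<forall>a\<in>carrier A. \<forall>b\<in>carrier A. a \<squnion>\<^bsub>A\<^esub> b \<in> P \<longrightarrow> a \<in> P \<or> b \<in> P)}"

definition S_obj :: "('a, 'm) nabla_algebra_scheme \<Rightarrow> 'a set nabla_space" where
  "S_obj A = \<lparr>
     Topo = topology_generated_by
       {{P \<in> prime_filters A. a \<in> P \<and> b \<notin> P} | a b. a \<in> carrier A \<and> b \<in> carrier A},
     Leq = {(P, Q). P \<in> prime_filters A \<and> Q \<in> prime_filters A \<and> P \<subseteq> Q},
     Rel = {(P, Q). P \<in> prime_filters A \<and> Q \<in> prime_filters A \<and> nabla A ` P \<subseteq> Q} \<rparr>"

definition S_map ::
  "('a, 'm) nabla_algebra_scheme \<Rightarrow> ('b, 'n) nabla_algebra_scheme \<Rightarrow> ('a \<Rightarrow> 'b) \<Rightarrow> 'b set \<Rightarrow> 'a set"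
  where
  "S_map A B f = (\<lambda>P\<in>prime_filters B. {a \<in> carrier A. f a \<in> P})"

definition A_obj :: "'x nabla_space \<Rightarrow> 'x set nabla_algebra" where
  "A_obj X = \<lparr> carrier = clopen_upsets X, eq = (=), le = (\<subseteq>),
     nabla = rel_nabla X, arrow = rel_arrow X \<rparr>"

text \<open>On Heyting spaces the added operation is the Heyting implication of the lattice of clopen
  upsets: the complement of the downset generated by \<open>U - V\<close>.\<close>

definition AH_obj :: "'x nabla_space \<Rightarrow> 'x set heyting_nabla_algebra" where
  "AH_obj X = \<lparr> carrier = clopen_upsets X, eq = (=), le = (\<subseteq>),
     nabla = rel_nabla X, arrow = rel_arrow X,
     himp = (\<lambda>U V. {x \<in> points X. Leq X `` {x} \<inter> U \<subseteq> V}) \<rparr>"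

definition A_map :: "'x nabla_space \<Rightarrow> 'y nabla_space \<Rightarrow> ('x \<Rightarrow> 'y) \<Rightarrow> 'y set \<Rightarrow> 'x set" where
  "A_map X Y f = (\<lambda>U\<in>clopen_upsets Y. {x \<in> points X. f x \<in> U})"

definition alpha :: "('a, 'm) nabla_algebra_scheme \<Rightarrow> 'a \<Rightarrow> 'a set set" where
  "alpha A = (\<lambda>a\<in>carrier A. {P \<in> prime_filters A. a \<in> P})"

definition beta :: "'x nabla_space \<Rightarrow> 'x \<Rightarrow> 'x set set" where
  "beta X = (\<lambda>x\<in>points X. {U \<in> clopen_upsets X. x \<in> U})"

text \<open>\<open>f\<close> is an isomorphism between objects with underlying sets \<open>X\<close> and
  \<open>Y\<close>, where \<open>HXY\<close> and \<open>HYX\<close> are the hom-sets in the two directions.\<close>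

definition isomorphism ::
  "('a \<Rightarrow> 'b) set \<Rightarrow> ('b \<Rightarrow> 'a) set \<Rightarrow> 'a set \<Rightarrow> 'b set \<Rightarrow> ('a \<Rightarrow> 'b) \<Rightarrow> bool" where
  "isomorphism HXY HYX X Y f \<longleftrightarrow> f \<in> HXY \<and>
     (\<exists>g\<in>HYX. compose X g f = (\<lambda>x\<in>X. x) \<and> compose Y f g = (\<lambda>y\<in>Y. y))"

end

theory Submission
  imports Defs "HOL-Analysis.T1_Spaces"
begin

text \<open>The duality extends Priestley duality. In a distributive lattice disjoint filters and ideals
  are separated by prime filters, and this supplies every point needed on the algebraic side:
  the basic clopen set given by \<open>a\<close> satisfies \<open>\<nabla>\<^sub>R(\<alpha>(a)) = \<alpha>(\<nabla>a)\<close> and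
  \<open>\<alpha>(a) \<rightarrow>\<^sub>R \<alpha>(b) = \<alpha>(a \<rightarrow> b)\<close>, and the back conditions on dual maps hold. On the topological side
  compactness shows that every prime filter of clopen upsets comes from a point and that the closed
  upset \<open>R[x]\<close> is an intersection of clopen upsets, so \<open>R\<close> is recovered from \<open>\<nabla>\<^sub>R\<close>.

  A Heyting implication is an \<open>\<rightarrow>\<close> that is residual to the identity \<open>\<nabla>\<close>, and dually an Esakia
  space is a space in which \<open>R = \<le>\<close> is admissible. The Heyting statements therefore follow by
  applying the plain ones twice, to the given structure and to this reduct.\<close>

section \<open>Prime filters of distributive \<open>\<nabla>\<close>-algebras\<close>

text \<open>As a left adjoint \<open>nabla\<close> preserves joins, but in general not meets. The
  preimage of a prime filter under \<open>nabla\<close> need not be a filter, so neighbours of a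
  point cannot be written down and come from Zorn's lemma. For successors, the two-place form of
  residuation lets a filter and an ideal be prescribed at once; this matches the equality
  \<open>f l = l'\<close> in the second condition on maps. For predecessors, the ideal is taken up
  by the complement of the preimage and only a filter can be prescribed; this matches the inequality
  in the third condition. Filters and ideals enter merely as directed sets, since images under
  \<open>nabla\<close>, \<open>box\<close> and morphisms are directed but seldom closed upwards or
  downwards. Joining two plain results into a Heyting one requires that both speak of literally the
  same functions. Hence maps and their inverses are given explicitly throughout.\<close>

lemma gorder_operations_cong:
  assumes "carrier L = carrier M" "le L = le M"
  shows "meet L = meet M" "join L = join M" "top L = top M" "bottom L = bottom M"
  using assms
  by (simp_all add: fun_eq_iff meet_def join_def inf_def sup_def top_def bottom_def greatest_def
      least_def Lower_def Upper_def)

locale distributive_nabla_algebra = nabla_algebra A for A (structure) +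
  assumes distributive: "distributive A"
begin

lemma meet_join_distrib:
  "\<lbrakk>a \<in> carrier A; b \<in> carrier A; c \<in> carrier A\<rbrakk> \<Longrightarrow> a \<sqinter> (b \<squnion> c) = (a \<sqinter> b) \<squnion> (a \<sqinter> c)"
  using distributive by (simp add: distributive_def)

lemma meet_mono:
  "\<lbrakk>a \<sqsubseteq> a'; b \<sqsubseteq> b'; a \<in> carrier A; a' \<in> carrier A; b \<in> carrier A; b' \<in> carrier A\<rbrakk>
    \<Longrightarrow> a \<sqinter> b \<sqsubseteq> a' \<sqinter> b'"
  by (meson le_trans meet_closed meet_le meet_left meet_right)

lemma le_meet_iff:
  "\<lbrakk>a \<in> carrier A; b \<in> carrier A; c \<in> carrier A\<rbrakk> \<Longrightarrow> c \<sqsubseteq> a \<sqinter> b \<longleftrightarrow> c \<sqsubseteq> a \<and> c \<sqsubseteq> b"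
  by (meson le_trans meet_closed meet_le meet_left meet_right)

lemma join_le_iff:
  "\<lbrakk>a \<in> carrier A; b \<in> carrier A; c \<in> carrier A\<rbrakk> \<Longrightarrow> a \<squnion> b \<sqsubseteq> c \<longleftrightarrow> a \<sqsubseteq> c \<and> b \<sqsubseteq> c"
  by (meson le_trans join_closed join_le join_left join_right)

lemma filterD:
  assumes "lattice_filter A P"
  shows "P \<subseteq> carrier A" "P \<noteq> {}" "\<top> \<in> P"
    "\<And>a b. \<lbrakk>a \<in> P; a \<sqsubseteq> b; b \<in> carrier A\<rbrakk> \<Longrightarrow> b \<in> P"
    "\<And>a b. \<lbrakk>a \<in> P; b \<in> P\<rbrakk> \<Longrightarrow> a \<sqinter> b \<in> P"
proof -
  show 1: "P \<subseteq> carrier A" "P \<noteq> {}" using assms by (auto simp: lattice_filter_def)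
  then obtain x where "x \<in> P" "x \<in> carrier A" by blast
  then show "\<top> \<in> P" using assms top_closed top_higher unfolding lattice_filter_def by blast
qed (use assms in \<open>auto simp: lattice_filter_def\<close>)

text \<open>This is the filter generated by \<open>M\<close> and \<open>a\<close>. A filter maximal
  among those avoiding an ideal is tested against it: if \<open>a\<close> lies outside
  \<open>M\<close>, the generated filter must meet the ideal.\<close>

lemma filter_extension:
  assumes "lattice_filter A M" "a \<in> carrier A"
  shows "lattice_filter A {x \<in> carrier A. \<exists>m\<in>M. m \<sqinter> a \<sqsubseteq> x}" (is "lattice_filter A ?N")
    and "M \<subseteq> {x \<in> carrier A. \<exists>m\<in>M. m \<sqinter> a \<sqsubseteq> x}"
    and "a \<in> {x \<in> carrier A. \<exists>m\<in>M. m \<sqinter> a \<sqsubseteq> x}"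
proof -
  note M = filterD[OF assms(1)]
  show "M \<subseteq> ?N" using M(1) assms(2) meet_left by blast
  have "\<top> \<sqinter> a \<sqsubseteq> a" using assms(2) by (simp add: meet_right)
  then show "a \<in> ?N" using M(3) assms(2) by blast
  have "x \<sqinter> y \<in> ?N" if xy: "x \<in> ?N" "y \<in> ?N" for x y
  proof -
    obtain m n where mn: "m \<in> M" "m \<sqinter> a \<sqsubseteq> x" "n \<in> M" "n \<sqinter> a \<sqsubseteq> y" using xy by auto
    have c: "m \<in> carrier A" "n \<in> carrier A" "x \<in> carrier A" "y \<in> carrier A"
      using mn xy M(1) by auto
    have "(m \<sqinter> n) \<sqinter> a \<sqsubseteq> m \<sqinter> a" "(m \<sqinter> n) \<sqinter> a \<sqsubseteq> n \<sqinter> a"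
      using c assms(2) by (simp_all add: meet_mono meet_left meet_right)
    then have "(m \<sqinter> n) \<sqinter> a \<sqsubseteq> x \<sqinter> y"
      using mn c assms(2) le_trans[of "m \<sqinter> n \<sqinter> a" "m \<sqinter> a" x] le_trans[of "m \<sqinter> n \<sqinter> a" "n \<sqinter> a" y]
      by (simp add: le_meet_iff)
    then show ?thesis using mn M(5) c by auto
  qed
  moreover have "b \<in> ?N" if xb: "x \<in> ?N" "x \<sqsubseteq> b" "b \<in> carrier A" for x b
  proof -
    obtain m where m: "m \<in> M" "m \<sqinter> a \<sqsubseteq> x" using xb by blast
    moreover have "m \<in> carrier A" using M(1) m by blast
    ultimately have "m \<sqinter> a \<sqsubseteq> b" using xb assms(2) le_trans[of "m \<sqinter> a" x b] by simp
    then show ?thesis using m xb by blast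
  qed
  ultimately show "lattice_filter A ?N"
    using \<open>a \<in> ?N\<close> unfolding lattice_filter_def by blast
qed

text \<open>Zorn's lemma yields a filter maximal among those avoiding the ideal; distributivity makes
  it prime.\<close>

lemma prime_filter_separation:
  assumes F: "F \<subseteq> carrier A" "F \<noteq> {}" "\<And>x y. \<lbrakk>x \<in> F; y \<in> F\<rbrakk> \<Longrightarrow> \<exists>z\<in>F. z \<sqsubseteq> x \<and> z \<sqsubseteq> y"
    and I: "I \<subseteq> carrier A" "I \<noteq> {}" "\<And>x y. \<lbrakk>x \<in> I; y \<in> I\<rbrakk> \<Longrightarrow> \<exists>z\<in>I. x \<sqsubseteq> z \<and> y \<sqsubseteq> z"
    and disj: "\<And>x y. \<lbrakk>x \<in> F; y \<in> I\<rbrakk> \<Longrightarrow> \<not> x \<sqsubseteq> y"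
  shows "\<exists>P\<in>prime_filters A. F \<subseteq> P \<and> P \<inter> I = {}"
proof -
  define \<A> where "\<A> = {G. lattice_filter A G \<and> F \<subseteq> G \<and> G \<inter> I = {}}"
  \<comment> \<open>\<open>F\<close> is only directed, so Zorn's lemma starts from its upward
    closure. For the same reason \<open>disj\<close> is stated with \<open>\<sqsubseteq>\<close>:
    this keeps the closure off \<open>I\<close>.\<close>
  let ?G = "{x \<in> carrier A. \<exists>f\<in>F. f \<sqsubseteq> x}"
  have "lattice_filter A ?G"
    unfolding lattice_filter_def
  proof (intro conjI ballI impI)
    show "?G \<noteq> {}" using F by blast
    show "b \<in> ?G" if ab: "a \<in> ?G" "b \<in> carrier A" "a \<sqsubseteq> b" for a b
    proof -
      obtain f where f: "f \<in> F" "f \<sqsubseteq> a" using ab by blast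
      then have "f \<sqsubseteq> b" using that F(1) le_trans[of f a b] by blast
      then show ?thesis using f that by blast
    qed
    show "a \<sqinter> b \<in> ?G" if ab: "a \<in> ?G" "b \<in> ?G" for a b
    proof -
      obtain f g where fg: "f \<in> F" "f \<sqsubseteq> a" "g \<in> F" "g \<sqsubseteq> b" using ab by auto
      obtain h where "h \<in> F" "h \<sqsubseteq> f" "h \<sqsubseteq> g" using F(3) fg by blast
      moreover have "f \<in> carrier A" "g \<in> carrier A" "h \<in> carrier A" using F(1) fg \<open>h \<in> F\<close> by auto
      ultimately have "h \<sqsubseteq> a" "h \<sqsubseteq> b" using fg ab le_trans by blast+
      then have "h \<sqsubseteq> a \<sqinter> b" using ab \<open>h \<in> carrier A\<close> by (simp add: le_meet_iff)
      with \<open>h \<in> F\<close> show ?thesis using ab by auto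
    qed
  qed auto
  moreover have "F \<subseteq> ?G" using F(1) le_refl by blast
  moreover have "?G \<inter> I = {}" using disj by auto
  ultimately have "\<A> \<noteq> {}" by (auto simp: \<A>_def)
  moreover have "\<Union>\<C> \<in> \<A>" if "\<C> \<noteq> {}" "subset.chain \<A> \<C>" for \<C>
  proof -
    have sub: "G \<in> \<A>" if "G \<in> \<C>" for G
      using that \<open>subset.chain \<A> \<C>\<close> by (auto simp: subset.chain_def)
    have "a \<sqinter> b \<in> \<Union>\<C>" if ab: "a \<in> \<Union>\<C>" "b \<in> \<Union>\<C>" for a b
    proof -
      obtain G H where GH: "a \<in> G" "G \<in> \<C>" "b \<in> H" "H \<in> \<C>" using ab by blast
      then have "G \<subseteq> H \<or> H \<subseteq> G"
        using \<open>subset.chain \<A> \<C>\<close> by (auto simp: subset_chain_def)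
      then obtain K where "K \<in> \<C>" "a \<in> K" "b \<in> K" using GH by blast
      moreover have "lattice_filter A K" using sub[OF \<open>K \<in> \<C>\<close>] by (simp add: \<A>_def)
      ultimately show ?thesis using filterD(5) by blast
    qed
    moreover have "b \<in> \<Union>\<C>" if ab: "a \<in> \<Union>\<C>" "b \<in> carrier A" "a \<sqsubseteq> b" for a b
    proof -
      obtain K where "a \<in> K" "K \<in> \<C>" using ab by blast
      moreover have "lattice_filter A K" using sub[OF \<open>K \<in> \<C>\<close>] by (simp add: \<A>_def)
      ultimately show ?thesis using filterD(4) ab by blast
    qed
    moreover have "\<Union>\<C> \<subseteq> carrier A" using sub filterD(1) unfolding \<A>_def by blast
    moreover have "\<Union>\<C> \<inter> I = {}"
      using sub by (auto simp: \<A>_def)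
    moreover have "F \<subseteq> \<Union>\<C>"
      using sub \<open>\<C> \<noteq> {}\<close> by (auto simp: \<A>_def)
    moreover from this have "\<Union>\<C> \<noteq> {}" using F(2) by blast
    ultimately show ?thesis
      unfolding \<A>_def lattice_filter_def mem_Collect_eq by (intro conjI ballI impI)
  qed
  ultimately obtain M where M: "M \<in> \<A>" "\<And>X. \<lbrakk>X \<in> \<A>; M \<subseteq> X\<rbrakk> \<Longrightarrow> X = M"
    using subset_Zorn_nonempty[of \<A>] by blast
  then have fM: "lattice_filter A M" and FM: "F \<subseteq> M" and MI: "M \<inter> I = {}"
    by (auto simp: \<A>_def)
  have meets: "\<exists>m\<in>M. \<exists>i\<in>I. m \<sqinter> a \<sqsubseteq> i" if "a \<in> carrier A" "a \<notin> M" for a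
  proof (rule ccontr)
    assume "\<not> ?thesis"
    then have "{x \<in> carrier A. \<exists>m\<in>M. m \<sqinter> a \<sqsubseteq> x} \<in> \<A>"
      using filter_extension[OF fM \<open>a \<in> carrier A\<close>] FM by (auto simp: \<A>_def)
    then show False
      using M(2) filter_extension[OF fM \<open>a \<in> carrier A\<close>] \<open>a \<notin> M\<close> by blast
  qed
  have "a \<in> M \<or> b \<in> M" if ab: "a \<in> carrier A" "b \<in> carrier A" "a \<squnion> b \<in> M" for a b
  proof (rule ccontr)
    assume "\<not> ?thesis"
    then obtain m i n j where mi: "m \<in> M" "i \<in> I" "m \<sqinter> a \<sqsubseteq> i" and nj: "n \<in> M" "j \<in> I" "n \<sqinter> b \<sqsubseteq> j"
      using meets ab by metis
    obtain k where k: "k \<in> I" "i \<sqsubseteq> k" "j \<sqsubseteq> k" using I(3) mi nj by blast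
    have c: "m \<in> carrier A" "n \<in> carrier A" "i \<in> carrier A" "j \<in> carrier A" "k \<in> carrier A"
      using mi nj k I(1) filterD(1)[OF fM] by auto
    have "(m \<sqinter> n) \<sqinter> a \<sqsubseteq> m \<sqinter> a" "(m \<sqinter> n) \<sqinter> b \<sqsubseteq> n \<sqinter> b"
      using c ab by (simp_all add: meet_mono meet_left meet_right)
    then have "(m \<sqinter> n) \<sqinter> a \<sqsubseteq> k" "(m \<sqinter> n) \<sqinter> b \<sqsubseteq> k"
      using mi(3) nj(3) k c ab le_trans[of "m \<sqinter> a" i k] le_trans[of "n \<sqinter> b" j k]
        le_trans[of "m \<sqinter> n \<sqinter> a" "m \<sqinter> a" k] le_trans[of "m \<sqinter> n \<sqinter> b" "n \<sqinter> b" k] by simp_all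
    \<comment> \<open>Distributivity turns this meet into a join of two elements below
      \<open>k\<close>, so a join in \<open>M\<close> with both parts outside forces
      \<open>k\<close> into \<open>M\<close>.\<close>
    then have "(m \<sqinter> n) \<sqinter> (a \<squnion> b) \<sqsubseteq> k"
      using c ab by (simp add: meet_join_distrib join_le_iff)
    moreover have "(m \<sqinter> n) \<sqinter> (a \<squnion> b) \<in> M"
      using mi(1) nj(1) ab(3) by (intro filterD(5)[OF fM])
    ultimately have "k \<in> M" using filterD(4)[OF fM] c(5) by blast
    then show False using k MI by blast
  qed
  moreover have "M \<noteq> carrier A" using MI I by blast
  ultimately have "M \<in> prime_filters A" using fM by (auto simp: prime_filters_def)
  then show ?thesis using FM MI by blast
qed

lemma prime_filterI:
  assumes "P \<subseteq> carrier A" "\<top> \<in> P" "\<bottom> \<notin> P"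
    "\<And>a b. \<lbrakk>a \<in> P; b \<in> carrier A; a \<sqsubseteq> b\<rbrakk> \<Longrightarrow> b \<in> P"
    "\<And>a b. \<lbrakk>a \<in> P; b \<in> P\<rbrakk> \<Longrightarrow> a \<sqinter> b \<in> P"
    "\<And>a b. \<lbrakk>a \<in> carrier A; b \<in> carrier A; a \<squnion> b \<in> P\<rbrakk> \<Longrightarrow> a \<in> P \<or> b \<in> P"
  shows "P \<in> prime_filters A"
proof -
  have "P \<noteq> {}" "P \<noteq> carrier A" using assms(2,3) bottom_closed by blast+
  then show ?thesis using assms by (simp add: prime_filters_def lattice_filter_def)
qed

lemma prime_filterD:
  assumes "P \<in> prime_filters A"
  shows "P \<subseteq> carrier A" "\<top> \<in> P" "\<bottom> \<notin> P"
    "\<And>a b. \<lbrakk>a \<in> P; a \<sqsubseteq> b; b \<in> carrier A\<rbrakk> \<Longrightarrow> b \<in> P"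
    "\<And>a b. \<lbrakk>a \<in> carrier A; b \<in> carrier A\<rbrakk> \<Longrightarrow> a \<sqinter> b \<in> P \<longleftrightarrow> a \<in> P \<and> b \<in> P"
    "\<And>a b. \<lbrakk>a \<in> carrier A; b \<in> carrier A\<rbrakk> \<Longrightarrow> a \<squnion> b \<in> P \<longleftrightarrow> a \<in> P \<or> b \<in> P"
proof -
  have f: "lattice_filter A P" using assms by (simp add: prime_filters_def)
  note P = filterD[OF f]
  show "P \<subseteq> carrier A" "\<top> \<in> P" by (fact P)+
  show "\<And>a b. \<lbrakk>a \<in> P; a \<sqsubseteq> b; b \<in> carrier A\<rbrakk> \<Longrightarrow> b \<in> P" by (fact P)
  show "\<bottom> \<notin> P"
  proof
    assume "\<bottom> \<in> P"
    then have "carrier A \<subseteq> P" using P(4)[OF _ bottom_lower] by blast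
    then show False using P(1) assms by (auto simp: prime_filters_def)
  qed
  show "a \<sqinter> b \<in> P \<longleftrightarrow> a \<in> P \<and> b \<in> P" if "a \<in> carrier A" "b \<in> carrier A" for a b
    using that P(4)[of "a \<sqinter> b" a] P(4)[of "a \<sqinter> b" b] P(5)[of a b] meet_left[of a b] meet_right[of a b]
    by blast
  show "a \<squnion> b \<in> P \<longleftrightarrow> a \<in> P \<or> b \<in> P" if "a \<in> carrier A" "b \<in> carrier A" for a b
    using that P(4)[of a "a \<squnion> b"] P(4)[of b "a \<squnion> b"] join_left[of a b] join_right[of a b]
      join_closed[of a b] assms
    unfolding prime_filters_def by blast
qed

text \<open>Singletons are directed, so separation applies to \<open>{a}\<close> and
  \<open>{b}\<close>. Elements are thus determined by the prime filters containing them, which makes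
  \<open>alpha\<close> injective.\<close>

lemma prime_filter_le_iff:
  assumes "a \<in> carrier A" "b \<in> carrier A"
  shows "a \<sqsubseteq> b \<longleftrightarrow> (\<forall>P\<in>prime_filters A. a \<in> P \<longrightarrow> b \<in> P)"
proof
  assume *: "\<forall>P\<in>prime_filters A. a \<in> P \<longrightarrow> b \<in> P"
  show "a \<sqsubseteq> b"
  proof (rule ccontr)
    assume "\<not> a \<sqsubseteq> b"
    then have "\<exists>P\<in>prime_filters A. {a} \<subseteq> P \<and> P \<inter> {b} = {}"
      using assms by (intro prime_filter_separation) auto
    with * show False by blast
  qed
qed (use prime_filterD(4) assms in blast)

section \<open>The adjunction between \<open>nabla\<close> and \<open>box\<close>\<close>

lemma box_closed: "a \<in> carrier A \<Longrightarrow> box A a \<in> carrier A"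
  by (simp add: box_def arrow_closed)

text \<open>Residuation with \<open>\<top>\<close> in the middle: \<open>nabla\<close> is left
  adjoint to \<open>box\<close>. Monotonicity and preservation of \<open>\<bottom>\<close> and of
  joins follow from this alone.\<close>

lemma nabla_le_iff_le_box:
  assumes "a \<in> carrier A" "b \<in> carrier A"
  shows "nabla A a \<sqsubseteq> b \<longleftrightarrow> a \<sqsubseteq> box A b"
proof -
  have "nabla A a \<sqinter> \<top> = nabla A a"
    using assms by (metis le_iff_join nabla_closed top_closed top_higher)
  then show ?thesis using assms residuation[of \<top> b a] by (simp add: box_def)
qed

lemma nabla_mono:
  assumes "a \<sqsubseteq> b" "a \<in> carrier A" "b \<in> carrier A"
  shows "nabla A a \<sqsubseteq> nabla A b"
proof -
  have "b \<sqsubseteq> box A (nabla A b)" using assms nabla_closed by (simp flip: nabla_le_iff_le_box)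
  then have "a \<sqsubseteq> box A (nabla A b)"
    using assms le_trans[of a b "box A (nabla A b)"] by (simp add: nabla_closed box_closed)
  then show ?thesis using assms nabla_closed by (simp add: nabla_le_iff_le_box)
qed

lemma nabla_join:
  assumes "a \<in> carrier A" "b \<in> carrier A"
  shows "nabla A (a \<squnion> b) = nabla A a \<squnion> nabla A b"
proof (rule le_antisym)
  have "a \<sqsubseteq> box A (nabla A a \<squnion> nabla A b)" "b \<sqsubseteq> box A (nabla A a \<squnion> nabla A b)"
    using assms by (simp_all add: nabla_closed join_left join_right flip: nabla_le_iff_le_box)
  then show "nabla A (a \<squnion> b) \<sqsubseteq> nabla A a \<squnion> nabla A b"
    using assms by (simp add: nabla_closed nabla_le_iff_le_box join_le_iff box_closed)
qed (use assms in \<open>simp_all add: join_le_iff nabla_closed nabla_mono join_left join_right\<close>)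

lemma nabla_bottom: "nabla A \<bottom> = \<bottom>"
  by (rule bottom_eq) (simp_all add: nabla_closed nabla_le_iff_le_box bottom_lower box_closed)

lemma nabla_arrow_le:
  "\<lbrakk>a \<in> carrier A; b \<in> carrier A\<rbrakk> \<Longrightarrow> nabla A (arrow A a b) \<sqinter> a \<sqsubseteq> b"
  by (simp add: residuation arrow_closed)

text \<open>Modus ponens along the dual relation. It is the easy inclusion in the description of
  \<open>arrow\<close> and reappears in the second condition on dual maps.\<close>

lemma prime_filter_nabla_arrow:
  assumes "P \<in> prime_filters A" "Q \<in> prime_filters A" "nabla A ` P \<subseteq> Q"
    "a \<in> carrier A" "b \<in> carrier A" "arrow A a b \<in> P" "a \<in> Q"
  shows "b \<in> Q"
proof -
  have "nabla A (arrow A a b) \<sqinter> a \<in> Q"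
    using assms prime_filterD(5)[OF assms(2)] by (simp add: nabla_closed arrow_closed image_subset_iff)
  then show ?thesis using prime_filterD(4)[OF assms(2) _ nabla_arrow_le] assms by blast
qed

text \<open>Separate \<open>I\<close> from the meets of elements \<open>nabla A p\<close> with
  members of \<open>F\<close>. If such a meet \<open>nabla A p \<sqinter> a\<close> were below some
  \<open>y\<close> in \<open>I\<close>, residuation would give
  \<open>p \<sqsubseteq> arrow A a y\<close> and put that arrow into \<open>P\<close>, against the
  last hypothesis.\<close>

lemma exists_nabla_successor:
  assumes P: "P \<in> prime_filters A"
    and F: "F \<subseteq> carrier A" "F \<noteq> {}" "\<And>x y. \<lbrakk>x \<in> F; y \<in> F\<rbrakk> \<Longrightarrow> \<exists>z\<in>F. z \<sqsubseteq> x \<and> z \<sqsubseteq> y"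
    and I: "I \<subseteq> carrier A" "I \<noteq> {}" "\<And>x y. \<lbrakk>x \<in> I; y \<in> I\<rbrakk> \<Longrightarrow> \<exists>z\<in>I. x \<sqsubseteq> z \<and> y \<sqsubseteq> z"
    and arrow: "\<And>a b. \<lbrakk>a \<in> F; b \<in> I\<rbrakk> \<Longrightarrow> arrow A a b \<notin> P"
  shows "\<exists>Q\<in>prime_filters A. nabla A ` P \<subseteq> Q \<and> F \<subseteq> Q \<and> Q \<inter> I = {}"
proof -
  note PD = prime_filterD[OF P]
  \<comment> \<open>This set is directed but need not be closed under meets:
    \<open>nabla A (p \<sqinter> q)\<close> is merely below both \<open>nabla A p\<close> and
    \<open>nabla A q\<close>.\<close>
  let ?G = "{nabla A p \<sqinter> a | p a. p \<in> P \<and> a \<in> F}"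
  have "\<exists>Q\<in>prime_filters A. ?G \<subseteq> Q \<and> Q \<inter> I = {}"
  proof (rule prime_filter_separation)
    show "?G \<subseteq> carrier A" using PD(1) F(1) nabla_closed by (auto intro!: meet_closed)
    show "?G \<noteq> {}" using PD(2) F(2) by auto
    show "\<not> x \<sqsubseteq> y" if "x \<in> ?G" "y \<in> I" for x y
    proof
      assume "x \<sqsubseteq> y"
      obtain p a where pa: "x = nabla A p \<sqinter> a" "p \<in> P" "a \<in> F" using \<open>x \<in> ?G\<close> by auto
      have c: "p \<in> carrier A" "a \<in> carrier A" "y \<in> carrier A" using pa PD(1) F(1) I(1) that by auto
      have "p \<sqsubseteq> arrow A a y" using \<open>x \<sqsubseteq> y\<close> pa(1) c by (simp add: residuation)
      then have "arrow A a y \<in> P" using PD(4) pa c arrow_closed by blast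
      then show False using arrow pa that by blast
    qed
    show "\<exists>z\<in>?G. z \<sqsubseteq> x \<and> z \<sqsubseteq> y" if xy: "x \<in> ?G" "y \<in> ?G" for x y
    proof -
      obtain p a q b where pq: "x = nabla A p \<sqinter> a" "p \<in> P" "a \<in> F" "y = nabla A q \<sqinter> b" "q \<in> P" "b \<in> F"
        using xy by blast
      obtain c where c: "c \<in> F" "c \<sqsubseteq> a" "c \<sqsubseteq> b" using F(3) pq by blast
      have car: "p \<in> carrier A" "q \<in> carrier A" "a \<in> carrier A" "b \<in> carrier A" "c \<in> carrier A"
        using pq c PD(1) F(1) by auto
      have "nabla A (p \<sqinter> q) \<sqinter> c \<sqsubseteq> x" "nabla A (p \<sqinter> q) \<sqinter> c \<sqsubseteq> y"
        unfolding pq using c car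
        by (simp_all add: meet_mono nabla_mono meet_left meet_right nabla_closed)
      moreover have "p \<sqinter> q \<in> P" using pq car PD(5) by blast
      ultimately show ?thesis using c by blast
    qed
  qed (use I in auto)
  then obtain Q where Q: "Q \<in> prime_filters A" "?G \<subseteq> Q" "Q \<inter> I = {}" by blast
  have "nabla A p \<in> Q \<and> a \<in> Q" if "p \<in> P" "a \<in> F" for p a
  proof -
    have "nabla A p \<sqinter> a \<in> Q" using Q(2) that by blast
    moreover have "nabla A p \<in> carrier A" "a \<in> carrier A" using that PD(1) F(1) nabla_closed by blast+
    ultimately show ?thesis using prime_filterD(5)[OF Q(1)] by blast
  qed
  then show ?thesis using Q F(2) PD(2) by blast
qed

text \<open>A prime filter is mapped into \<open>Q\<close> exactly when it avoids all
  \<open>x\<close> with \<open>nabla A x\<close> outside \<open>Q\<close>. These \<open>x\<close>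
  are closed under joins because \<open>nabla\<close> preserves joins and \<open>Q\<close> is prime,
  so they can be separated from \<open>F\<close>.\<close>

lemma exists_nabla_predecessor:
  assumes Q: "Q \<in> prime_filters A"
    and F: "F \<subseteq> carrier A" "F \<noteq> {}" "\<And>x y. \<lbrakk>x \<in> F; y \<in> F\<rbrakk> \<Longrightarrow> \<exists>z\<in>F. z \<sqsubseteq> x \<and> z \<sqsubseteq> y"
    and nabla: "nabla A ` F \<subseteq> Q"
  shows "\<exists>P\<in>prime_filters A. nabla A ` P \<subseteq> Q \<and> F \<subseteq> P"
proof -
  note QD = prime_filterD[OF Q]
  let ?I = "{x \<in> carrier A. nabla A x \<notin> Q}"
  have "\<exists>P\<in>prime_filters A. F \<subseteq> P \<and> P \<inter> ?I = {}"
  proof (rule prime_filter_separation)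
    show "?I \<noteq> {}" using QD(3) nabla_bottom by auto
    show "\<exists>z\<in>?I. x \<sqsubseteq> z \<and> y \<sqsubseteq> z" if "x \<in> ?I" "y \<in> ?I" for x y
      using that by (intro bexI[of _ "x \<squnion> y"]) (auto simp: join_left join_right nabla_join QD(6) nabla_closed)
    show "\<not> x \<sqsubseteq> y" if "x \<in> F" "y \<in> ?I" for x y
    proof
      assume "x \<sqsubseteq> y"
      then have "nabla A x \<sqsubseteq> nabla A y" using that F(1) nabla_mono by blast
      then show False using that nabla QD(4)[of "nabla A x"] nabla_closed by blast
    qed
  qed (use F in auto)
  then obtain P where P: "P \<in> prime_filters A" "F \<subseteq> P" "P \<inter> ?I = {}" by blast
  then have "nabla A ` P \<subseteq> Q" using prime_filterD(1)[OF P(1)] by blast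
  then show ?thesis using P by blast
qed

end

section \<open>The dual space of an algebra\<close>

text \<open>Finite subcovers in the form of an induction: a property that holds locally and is
  stable under finite unions reaches an open set around all of \<open>K\<close>. Several later
  compactness arguments consist in the choice of \<open>Q\<close>.\<close>

lemma compactin_Un_induct:
  assumes "compactin T K" "Q {}" "\<And>U V. \<lbrakk>Q U; Q V\<rbrakk> \<Longrightarrow> Q (U \<union> V)"
    and "\<And>x. x \<in> K \<Longrightarrow> \<exists>U. openin T U \<and> x \<in> U \<and> Q U"
  shows "\<exists>U. openin T U \<and> K \<subseteq> U \<and> Q U"
proof -
  have "K \<subseteq> \<Union>{U. openin T U \<and> Q U}" using assms(4) by blast
  then obtain \<F> where \<F>: "finite \<F>" "\<F> \<subseteq> {U. openin T U \<and> Q U}" "K \<subseteq> \<Union>\<F>"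
    using assms(1) unfolding compactin_def by (metis (no_types, lifting) mem_Collect_eq)
  have "openin T (\<Union>\<F>) \<and> Q (\<Union>\<F>)"
    using \<F>(1,2) by (induction rule: finite_induct) (auto intro: assms(2,3))
  then show ?thesis using \<F>(3) by blast
qed

text \<open>Two coverings are nested. For a fixed point of \<open>K\<close>, finitely many members
  of the lattice are intersected to avoid \<open>M\<close>; the sets so obtained cover
  \<open>K\<close>, and finitely many of them are united. It is applied to the lattice of sets
  \<open>stone a\<close> and to the lattice of clopen upsets.\<close>

lemma compactin_separation:
  assumes K: "compactin T K" and M: "compactin T M"
    and clopen: "\<And>U. U \<in> \<L> \<Longrightarrow> clopenin T U"
    and lattice: "{} \<in> \<L>" "topspace T \<in> \<L>" "\<And>U V. \<lbrakk>U \<in> \<L>; V \<in> \<L>\<rbrakk> \<Longrightarrow> U \<inter> V \<in> \<L>"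
      "\<And>U V. \<lbrakk>U \<in> \<L>; V \<in> \<L>\<rbrakk> \<Longrightarrow> U \<union> V \<in> \<L>"
    and sep: "\<And>x y. \<lbrakk>x \<in> K; y \<in> M\<rbrakk> \<Longrightarrow> \<exists>U\<in>\<L>. x \<in> U \<and> y \<notin> U"
  shows "\<exists>U\<in>\<L>. K \<subseteq> U \<and> U \<inter> M = {}"
proof -
  have "\<exists>U. openin T U \<and> K \<subseteq> U \<and> (U \<in> \<L> \<and> U \<inter> M = {})"
  proof (rule compactin_Un_induct[OF K])
    fix x assume x: "x \<in> K"
    have "\<exists>W. openin T W \<and> M \<subseteq> W \<and> (\<exists>U\<in>\<L>. x \<in> U \<and> U \<inter> W = {})"
    proof (rule compactin_Un_induct[OF M])
      show "\<exists>U\<in>\<L>. x \<in> U \<and> U \<inter> {} = {}"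
        using lattice(2) x compactin_subset_topspace[OF K] by auto
    next
      fix V W assume "\<exists>U\<in>\<L>. x \<in> U \<and> U \<inter> V = {}" "\<exists>U\<in>\<L>. x \<in> U \<and> U \<inter> W = {}"
      then obtain U U' where "U \<in> \<L>" "x \<in> U" "U \<inter> V = {}" "U' \<in> \<L>" "x \<in> U'" "U' \<inter> W = {}"
        by blast
      then show "\<exists>U\<in>\<L>. x \<in> U \<and> U \<inter> (V \<union> W) = {}"
        by (intro bexI[of _ "U \<inter> U'"] lattice) auto
    next
      fix y assume y: "y \<in> M"
      then obtain U where U: "U \<in> \<L>" "x \<in> U" "y \<notin> U" using sep x by blast
      then have "openin T (topspace T - U)" using clopen by (auto simp: clopenin_def)
      then show "\<exists>W. openin T W \<and> y \<in> W \<and> (\<exists>U\<in>\<L>. x \<in> U \<and> U \<inter> W = {})"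
        using U y compactin_subset_topspace[OF M] by blast
    qed
    then obtain W U where "M \<subseteq> W" "U \<in> \<L>" "x \<in> U" "U \<inter> W = {}" by blast
    then show "\<exists>U. openin T U \<and> x \<in> U \<and> (U \<in> \<L> \<and> U \<inter> M = {})"
      using clopen unfolding clopenin_def by blast
  qed (auto intro: lattice)
  then show ?thesis by blast
qed

lemma clopenin_Int: "\<lbrakk>clopenin T U; clopenin T V\<rbrakk> \<Longrightarrow> clopenin T (U \<inter> V)"
  and clopenin_Un: "\<lbrakk>clopenin T U; clopenin T V\<rbrakk> \<Longrightarrow> clopenin T (U \<union> V)"
  and clopenin_Diff: "\<lbrakk>clopenin T U; clopenin T V\<rbrakk> \<Longrightarrow> clopenin T (U - V)"
  and clopenin_empty: "clopenin T {}"
  and clopenin_topspace: "clopenin T (topspace T)"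
  by (auto simp: clopenin_def openin_diff closedin_diff)

lemma clopenin_subset: "clopenin T U \<Longrightarrow> U \<subseteq> topspace T"
  by (simp add: clopenin_def openin_subset)

context distributive_nabla_algebra
begin

section \<open>Prime filters as a Priestley space\<close>

abbreviation stone :: "'a \<Rightarrow> 'a set set" where
  "stone a \<equiv> {P \<in> prime_filters A. a \<in> P}"

lemma points_S_obj: "points (S_obj A) = prime_filters A"
proof -
  let ?B = "{{P \<in> prime_filters A. a \<in> P \<and> b \<notin> P} | a b. a \<in> carrier A \<and> b \<in> carrier A}"
  have "{P \<in> prime_filters A. \<top> \<in> P \<and> \<bottom> \<notin> P} = prime_filters A"
    using prime_filterD(2,3) by blast
  then have "prime_filters A \<in> ?B" using top_closed bottom_closed by blast
  then have "\<Union>?B = prime_filters A" by blast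
  then show ?thesis by (simp add: S_obj_def)
qed

lemma Leq_S_obj: "(P, Q) \<in> Leq (S_obj A) \<longleftrightarrow> P \<in> prime_filters A \<and> Q \<in> prime_filters A \<and> P \<subseteq> Q"
  by (simp add: S_obj_def)

lemma Rel_S_obj:
  "(P, Q) \<in> Rel (S_obj A) \<longleftrightarrow> P \<in> prime_filters A \<and> Q \<in> prime_filters A \<and> nabla A ` P \<subseteq> Q"
  by (simp add: S_obj_def)

lemma stone_top: "stone \<top> = prime_filters A"
  using prime_filterD(2) by blast

lemma stone_bottom: "stone \<bottom> = {}"
  using prime_filterD(3) by blast

lemma stone_meet: "\<lbrakk>a \<in> carrier A; b \<in> carrier A\<rbrakk> \<Longrightarrow> stone (a \<sqinter> b) = stone a \<inter> stone b"
  by (auto simp: prime_filterD(5))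

lemma stone_join: "\<lbrakk>a \<in> carrier A; b \<in> carrier A\<rbrakk> \<Longrightarrow> stone (a \<squnion> b) = stone a \<union> stone b"
  by (auto simp: prime_filterD(6))

lemma openin_stone_diff:
  assumes "a \<in> carrier A" "b \<in> carrier A"
  shows "openin (Topo (S_obj A)) (stone a - stone b)"
proof -
  have "stone a - stone b = {P \<in> prime_filters A. a \<in> P \<and> b \<notin> P}" by blast
  then show ?thesis
    using assms by (auto simp: S_obj_def intro!: topology_generated_by_Basis)
qed

lemma clopenin_stone:
  assumes "a \<in> carrier A"
  shows "clopenin (Topo (S_obj A)) (stone a)"
  using openin_stone_diff[OF assms bottom_closed] openin_stone_diff[OF top_closed assms]
  by (auto simp: clopenin_def closedin_def points_S_obj stone_top stone_bottom)

text \<open>The definition uses the generators as a subbasis. They are a basis because the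
  generators for \<open>a, b\<close> and for \<open>c, d\<close> intersect in the one for
  \<open>a \<sqinter> c, b \<squnion> d\<close>.\<close>

lemma S_obj_basis:
  assumes "openin (Topo (S_obj A)) U" "P \<in> U"
  shows "\<exists>a\<in>carrier A. \<exists>b\<in>carrier A. P \<in> stone a - stone b \<and> stone a - stone b \<subseteq> U"
proof -
  have "generate_topology_on
      {{P \<in> prime_filters A. a \<in> P \<and> b \<notin> P} | a b. a \<in> carrier A \<and> b \<in> carrier A} U"
    using assms(1) by (simp add: S_obj_def openin_topology_generated_by_iff)
  then show ?thesis
    using assms(2)
  proof (induction arbitrary: P)
    case (Int U V)
    from Int.IH(1)[of P] Int.prems obtain a b
      where ab: "a \<in> carrier A" "b \<in> carrier A" "P \<in> stone a - stone b" "stone a - stone b \<subseteq> U"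
      by blast
    from Int.IH(2)[of P] Int.prems obtain c d
      where cd: "c \<in> carrier A" "d \<in> carrier A" "P \<in> stone c - stone d" "stone c - stone d \<subseteq> V"
      by blast
    have "stone (a \<sqinter> c) - stone (b \<squnion> d) = (stone a - stone b) \<inter> (stone c - stone d)"
      using stone_meet[OF ab(1) cd(1)] stone_join[OF ab(2) cd(2)] by blast
    moreover have "P \<in> (stone a - stone b) \<inter> (stone c - stone d)"
      "(stone a - stone b) \<inter> (stone c - stone d) \<subseteq> U \<inter> V"
      using ab(3,4) cd(3,4) by blast+
    ultimately have "P \<in> stone (a \<sqinter> c) - stone (b \<squnion> d) \<and> stone (a \<sqinter> c) - stone (b \<squnion> d) \<subseteq> U \<inter> V"
      by (simp only: simp_thms)
    then show ?case
      using meet_closed[OF ab(1) cd(1)] join_closed[OF ab(2) cd(2)] by (intro bexI)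
  next
    case (UN \<K>)
    then obtain V where V: "V \<in> \<K>" "P \<in> V" by blast
    show ?case using UN.IH[OF V] V(1) by (meson Sup_upper subset_trans)
  next
    case (Basis U)
    then obtain a b where "a \<in> carrier A" "b \<in> carrier A" "U = {P \<in> prime_filters A. a \<in> P \<and> b \<notin> P}"
      by blast
    then show ?case using Basis.prems by (intro bexI[of _ a] bexI[of _ b]) auto
  qed simp
qed

text \<open>The filter and the ideal generated by \<open>F\<close> and \<open>I\<close> are described semantically,
  as the elements that finitely many members of \<open>F\<close> resp. \<open>I\<close> control in every prime filter.\<close>

lemma prime_filter_compactness:
  assumes "F \<subseteq> carrier A" "I \<subseteq> carrier A"
    and no: "\<not> (\<exists>P\<in>prime_filters A. F \<subseteq> P \<and> P \<inter> I = {})"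
  shows "\<exists>F' I'. finite F' \<and> F' \<subseteq> F \<and> finite I' \<and> I' \<subseteq> I \<and>
           \<not> (\<exists>P\<in>prime_filters A. F' \<subseteq> P \<and> P \<inter> I' = {})"
proof (rule ccontr)
  assume fin: "\<not> ?thesis"
  define G where "G = {x \<in> carrier A. \<exists>F'. finite F' \<and> F' \<subseteq> F \<and> (\<forall>P\<in>prime_filters A. F' \<subseteq> P \<longrightarrow> x \<in> P)}"
  define J where "J = {x \<in> carrier A. \<exists>I'. finite I' \<and> I' \<subseteq> I \<and> (\<forall>P\<in>prime_filters A. x \<in> P \<longrightarrow> P \<inter> I' \<noteq> {})}"
  have FG: "F \<subseteq> G"
  proof
    fix x assume "x \<in> F"
    then show "x \<in> G"
      unfolding G_def using assms(1) by (auto intro!: exI[of _ "{x}"])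
  qed
  have IJ: "I \<subseteq> J"
  proof
    fix x assume "x \<in> I"
    then show "x \<in> J"
      unfolding J_def using assms(2) by (auto intro!: exI[of _ "{x}"])
  qed
  have "\<exists>P\<in>prime_filters A. G \<subseteq> P \<and> P \<inter> J = {}"
  proof (rule prime_filter_separation)
    have "\<top> \<in> G" unfolding G_def using prime_filterD(2) by (auto intro!: exI[of _ "{}"])
    then show "G \<noteq> {}" by blast
    have "\<bottom> \<in> J" unfolding J_def using prime_filterD(3) by (auto intro!: exI[of _ "{}"])
    then show "J \<noteq> {}" by blast
    fix x y
    show "\<exists>z\<in>G. z \<sqsubseteq> x \<and> z \<sqsubseteq> y" if xy: "x \<in> G" "y \<in> G"
    proof -
      obtain F1 F2 where F12: "finite F1" "F1 \<subseteq> F" "\<forall>P\<in>prime_filters A. F1 \<subseteq> P \<longrightarrow> x \<in> P"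
        "finite F2" "F2 \<subseteq> F" "\<forall>P\<in>prime_filters A. F2 \<subseteq> P \<longrightarrow> y \<in> P"
        using xy unfolding G_def by blast
      have c: "x \<in> carrier A" "y \<in> carrier A" using xy by (auto simp: G_def)
      have "x \<sqinter> y \<in> G"
        unfolding G_def using F12 c
        by (auto intro!: exI[of _ "F1 \<union> F2"] simp: prime_filterD(5))
      then show ?thesis using c meet_left[of x y] meet_right[of x y] by blast
    qed
    show "\<exists>z\<in>J. x \<sqsubseteq> z \<and> y \<sqsubseteq> z" if xy: "x \<in> J" "y \<in> J"
    proof -
      obtain I1 I2 where I12: "finite I1" "I1 \<subseteq> I" "\<forall>P\<in>prime_filters A. x \<in> P \<longrightarrow> P \<inter> I1 \<noteq> {}"
        "finite I2" "I2 \<subseteq> I" "\<forall>P\<in>prime_filters A. y \<in> P \<longrightarrow> P \<inter> I2 \<noteq> {}"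
        using xy unfolding J_def by blast
      have c: "x \<in> carrier A" "y \<in> carrier A" using xy by (auto simp: J_def)
      have "\<forall>P\<in>prime_filters A. x \<squnion> y \<in> P \<longrightarrow> P \<inter> (I1 \<union> I2) \<noteq> {}"
        using I12(3,6) c by (simp add: prime_filterD(6)) blast
      then have "x \<squnion> y \<in> J"
        unfolding J_def using I12 c by (auto intro!: exI[of _ "I1 \<union> I2"])
      then show ?thesis using c join_left[of x y] join_right[of x y] by blast
    qed
    show "\<not> x \<sqsubseteq> y" if xy: "x \<in> G" "y \<in> J"
    proof
      assume "x \<sqsubseteq> y"
      obtain F' where F': "finite F'" "F' \<subseteq> F" "\<forall>P\<in>prime_filters A. F' \<subseteq> P \<longrightarrow> x \<in> P"
        using xy(1) unfolding G_def by blast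
      obtain I' where I': "finite I'" "I' \<subseteq> I" "\<forall>P\<in>prime_filters A. y \<in> P \<longrightarrow> P \<inter> I' \<noteq> {}"
        using xy(2) unfolding J_def by blast
      have "\<forall>P\<in>prime_filters A. x \<in> P \<longrightarrow> y \<in> P"
        using \<open>x \<sqsubseteq> y\<close> xy prime_filter_le_iff[of x y] by (simp add: G_def J_def)
      then have "\<not> (\<exists>P\<in>prime_filters A. F' \<subseteq> P \<and> P \<inter> I' = {})"
        using F'(3) I'(3) by blast
      then show False using fin F'(1,2) I'(1,2) by blast
    qed
  qed (auto simp: G_def J_def)
  then show False using no FG IJ by blast
qed

lemma compact_S_obj: "compact_space (Topo (S_obj A))"
proof -
  let ?B = "stone ` carrier A \<union> (\<lambda>b. prime_filters A - stone b) ` carrier A"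
  \<comment> \<open>Alexander's subbase lemma asks for a topology of this literal form. Every open
    set of the dual space is open in \<open>T\<close>, so compactness of \<open>T\<close> passes to
    the dual space.\<close>
  define T where "T = topology (arbitrary union_of (finite intersection_of (\<lambda>x. x \<in> ?B) relative_to \<Union>?B))"
  have UB: "\<Union>?B = prime_filters A" using stone_top top_closed by blast
  have topT: "topspace T = prime_filters A" unfolding T_def using UB by simp
  have "compact_space T"
  proof (rule Alexander_subbase[OF T_def[symmetric]])
    fix \<C> assume \<C>: "\<C> \<subseteq> ?B" "\<Union>\<C> = topspace T"
    \<comment> \<open>A subbasic cover reads as a pair of sets: a prime filter lies in no member of
      the cover exactly when it contains \<open>F\<close> and avoids \<open>I\<close>. A finite
      subcover is then a finite part of this pair that is already incompatible.\<close>
    define F where "F = {b \<in> carrier A. prime_filters A - stone b \<in> \<C>}"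
    define I where "I = {a \<in> carrier A. stone a \<in> \<C>}"
    have no: "\<not> (\<exists>P\<in>prime_filters A. F \<subseteq> P \<and> P \<inter> I = {})"
    proof
      assume "\<exists>P\<in>prime_filters A. F \<subseteq> P \<and> P \<inter> I = {}"
      then obtain P where P: "P \<in> prime_filters A" "F \<subseteq> P" "P \<inter> I = {}" by blast
      then obtain U where U: "U \<in> \<C>" "P \<in> U" using \<C>(2) topT by blast
      then have "U \<in> ?B" using \<C>(1) by blast
      then show False using U P unfolding F_def I_def by blast
    qed
    obtain F' I' where FI: "finite F'" "F' \<subseteq> F" "finite I'" "I' \<subseteq> I"
      "\<not> (\<exists>P\<in>prime_filters A. F' \<subseteq> P \<and> P \<inter> I' = {})"
      using prime_filter_compactness[OF _ _ no] unfolding F_def I_def by blast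
    let ?C' = "stone ` I' \<union> (\<lambda>b. prime_filters A - stone b) ` F'"
    have "finite ?C'" using FI by simp
    moreover have "?C' \<subseteq> \<C>" using FI(2,4) unfolding F_def I_def by blast
    moreover have "\<Union>?C' = topspace T"
      unfolding topT using FI(5) by auto
    ultimately show "\<exists>C'. finite C' \<and> C' \<subseteq> \<C> \<and> \<Union>C' = topspace T" by blast
  qed
  moreover have "openin T U" if "openin (Topo (S_obj A)) U" for U
  proof -
    have sub: "openin T V" if "V \<in> ?B" for V
      unfolding T_def openin_subbase using that
      by (intro arbitrary_union_of_inc) (auto intro!: relative_to_subset_inc finite_intersection_of_inc)
    have diff: "openin T (stone a - stone b)" if "a \<in> carrier A" "b \<in> carrier A" for a b
    proof -
      have "openin T (stone a)" using imageI[OF that(1), of stone] by (intro sub UnI1)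
      moreover have "openin T (prime_filters A - stone b)"
        using imageI[OF that(2), of "\<lambda>b. prime_filters A - stone b"] by (intro sub UnI2)
      moreover have "stone a - stone b = stone a \<inter> (prime_filters A - stone b)" by blast
      ultimately show ?thesis by (simp only: openin_Int)
    qed
    have "\<exists>V. openin T V \<and> P \<in> V \<and> V \<subseteq> U" if P: "P \<in> U" for P
    proof -
      obtain a b where "a \<in> carrier A" "b \<in> carrier A" "P \<in> stone a - stone b" "stone a - stone b \<subseteq> U"
        using S_obj_basis[OF \<open>openin (Topo (S_obj A)) U\<close> P] by blast
      then show ?thesis using diff[of a b] by blast
    qed
    then show ?thesis by (subst openin_subopen) blast
  qed
  ultimately show ?thesis
    unfolding compact_space_def compactin_def topT points_S_obj by blast
qed

lemma stone_upset: "upset (Leq (S_obj A)) (stone a)"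
  by (auto simp: upset_def Leq_S_obj)

text \<open>For \<open>P\<close> in a clopen upset \<open>U\<close> and \<open>Q\<close> outside it,
  \<open>P \<subseteq> Q\<close> fails, so some \<open>stone a\<close> contains \<open>P\<close> and
  not \<open>Q\<close>. Both \<open>U\<close> and its complement are compact and the sets
  \<open>stone a\<close> form a lattice, hence one of them separates the two and equals
  \<open>U\<close>. This is the surjectivity of \<open>alpha\<close>.\<close>

lemma clopen_upsets_S_obj: "clopen_upsets (S_obj A) = stone ` carrier A"
proof
  show "stone ` carrier A \<subseteq> clopen_upsets (S_obj A)"
    by (auto simp: clopen_upsets_def clopenin_stone stone_upset)
  show "clopen_upsets (S_obj A) \<subseteq> stone ` carrier A"
  proof
    fix U assume U: "U \<in> clopen_upsets (S_obj A)"
    then have clo: "clopenin (Topo (S_obj A)) U" "clopenin (Topo (S_obj A)) (points (S_obj A) - U)"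
      by (auto simp: clopen_upsets_def clopenin_Diff clopenin_topspace)
    have "\<exists>V\<in>stone ` carrier A. U \<subseteq> V \<and> V \<inter> (points (S_obj A) - U) = {}"
    proof (rule compactin_separation)
      show "compactin (Topo (S_obj A)) U" "compactin (Topo (S_obj A)) (points (S_obj A) - U)"
        using clo compact_S_obj by (auto simp: clopenin_def intro: closedin_compact_space)
      show "clopenin (Topo (S_obj A)) V" if "V \<in> stone ` carrier A" for V
        using that clopenin_stone by blast
      show "{} \<in> stone ` carrier A"
        by (rule image_eqI[where f = stone, OF stone_bottom[symmetric] bottom_closed])
      show "points (S_obj A) \<in> stone ` carrier A"
        unfolding points_S_obj by (rule image_eqI[where f = stone, OF stone_top[symmetric] top_closed])
      show "V \<inter> W \<in> stone ` carrier A" if VW: "V \<in> stone ` carrier A" "W \<in> stone ` carrier A" for V W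
      proof -
        obtain a b where "a \<in> carrier A" "b \<in> carrier A" "V = stone a" "W = stone b" using VW by blast
        then show ?thesis
          using image_eqI[where f = stone, OF stone_meet[symmetric, of a b] meet_closed[of a b]] by simp
      qed
      show "V \<union> W \<in> stone ` carrier A" if VW: "V \<in> stone ` carrier A" "W \<in> stone ` carrier A" for V W
      proof -
        obtain a b where "a \<in> carrier A" "b \<in> carrier A" "V = stone a" "W = stone b" using VW by blast
        then show ?thesis
          using image_eqI[where f = stone, OF stone_join[symmetric, of a b] join_closed[of a b]] by simp
      qed
      show "\<exists>V\<in>stone ` carrier A. P \<in> V \<and> Q \<notin> V" if "P \<in> U" "Q \<in> points (S_obj A) - U" for P Q
      proof -
        have PQ: "P \<in> prime_filters A" "Q \<in> prime_filters A"
          using that clopenin_subset[OF clo(1)] points_S_obj by auto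
        then have "\<not> P \<subseteq> Q"
          using U that by (auto simp: clopen_upsets_def upset_def Leq_S_obj)
        then obtain a where "a \<in> P" "a \<notin> Q" by blast
        moreover from this have "a \<in> carrier A" using prime_filterD(1)[OF PQ(1)] by blast
        ultimately show ?thesis using PQ by (intro bexI[of _ "stone a"] imageI) auto
      qed
    qed
    then obtain V where "V \<in> stone ` carrier A" "U \<subseteq> V" "V \<inter> (points (S_obj A) - U) = {}" by blast
    moreover from this have "V \<subseteq> points (S_obj A)" using points_S_obj by blast
    ultimately have "U = V" by blast
    then show "U \<in> stone ` carrier A" using \<open>V \<in> stone ` carrier A\<close> by simp
  qed
qed

lemma priestley_S_obj: "priestley_space (Topo (S_obj A)) (Leq (S_obj A))"
  unfolding priestley_space_def
proof (intro conjI ballI impI)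
  show "compact_space (Topo (S_obj A))" by (rule compact_S_obj)
  show "partial_order_on (points (S_obj A)) (Leq (S_obj A))"
    by (auto simp: partial_order_on_def preorder_on_def refl_on_def trans_def antisym_def
        points_S_obj Leq_S_obj)
  fix P Q assume "P \<in> points (S_obj A)" "Q \<in> points (S_obj A)" "(P, Q) \<notin> Leq (S_obj A)"
  then have PQ: "P \<in> prime_filters A" "Q \<in> prime_filters A" "\<not> P \<subseteq> Q"
    by (auto simp: points_S_obj Leq_S_obj)
  then obtain a where "a \<in> P" "a \<notin> Q" by blast
  moreover have "a \<in> carrier A" using prime_filterD(1)[OF PQ(1)] \<open>a \<in> P\<close> by blast
  ultimately show "\<exists>U. clopenin (Topo (S_obj A)) U \<and> upset (Leq (S_obj A)) U \<and> P \<in> U \<and> Q \<notin> U"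
    using PQ clopenin_stone stone_upset by (intro exI[of _ "stone a"]) auto
qed

text \<open>Used to recognise \<open>beta\<close> as a homeomorphism: it will be a continuous
  bijection from a compact space onto such a space.\<close>

lemma Hausdorff_S_obj: "Hausdorff_space (Topo (S_obj A))"
  unfolding Hausdorff_space_def points_S_obj
proof (intro allI impI)
  have sep: "\<exists>U V. openin (Topo (S_obj A)) U \<and> openin (Topo (S_obj A)) V \<and> P \<in> U \<and> Q \<in> V \<and> disjnt U V"
    if PQ: "P \<in> prime_filters A" "Q \<in> prime_filters A" "\<not> P \<subseteq> Q" for P Q
  proof -
    obtain a where a: "a \<in> P" "a \<notin> Q" using PQ by blast
    then have "a \<in> carrier A" using prime_filterD(1)[OF PQ(1)] by blast
    then have "openin (Topo (S_obj A)) (stone a)"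
      "openin (Topo (S_obj A)) (points (S_obj A) - stone a)"
      using clopenin_stone by (auto simp: clopenin_def)
    then show ?thesis
      using a PQ points_S_obj
      by (intro exI[of _ "stone a"] exI[of _ "points (S_obj A) - stone a"]) (auto simp: disjnt_def)
  qed
  fix P Q assume "P \<in> prime_filters A \<and> Q \<in> prime_filters A \<and> P \<noteq> Q"
  then consider "P \<in> prime_filters A" "Q \<in> prime_filters A" "\<not> P \<subseteq> Q"
    | "P \<in> prime_filters A" "Q \<in> prime_filters A" "\<not> Q \<subseteq> P" by blast
  then show "\<exists>U V. openin (Topo (S_obj A)) U \<and> openin (Topo (S_obj A)) V \<and> P \<in> U \<and> Q \<in> V \<and> disjnt U V"
  proof cases
    case 2
    show ?thesis using sep[OF 2(2,1,3)] by (meson disjnt_sym)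
  qed (rule sep)
qed

section \<open>The relation between prime filters\<close>

lemma rel_nabla_stone:
  assumes "a \<in> carrier A"
  shows "rel_nabla (S_obj A) (stone a) = stone (nabla A a)"
proof
  show "rel_nabla (S_obj A) (stone a) \<subseteq> stone (nabla A a)"
    by (auto simp: rel_nabla_def points_S_obj Rel_S_obj)
  show "stone (nabla A a) \<subseteq> rel_nabla (S_obj A) (stone a)"
  proof
    fix Q assume "Q \<in> stone (nabla A a)"
    then have Q: "Q \<in> prime_filters A" "nabla A a \<in> Q" by auto
    have "\<exists>P\<in>prime_filters A. nabla A ` P \<subseteq> Q \<and> {a} \<subseteq> P"
      using Q assms by (intro exists_nabla_predecessor) auto
    then show "Q \<in> rel_nabla (S_obj A) (stone a)"
      using Q by (auto simp: rel_nabla_def points_S_obj Rel_S_obj)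
  qed
qed

text \<open>The inclusion from right to left takes \<open>F = {a}\<close> and \<open>I = {b}\<close>
  in the successor lemma. Since differences of sets \<open>stone a\<close> form a basis, clopenness
  of all diamonds reduces to this formula; complementing it describes
  \<open>rel_arrow\<close>.\<close>

lemma rel_diamond_stone_diff:
  assumes "a \<in> carrier A" "b \<in> carrier A"
  shows "rel_diamond (S_obj A) (stone a - stone b) = prime_filters A - stone (arrow A a b)"
proof
  show "rel_diamond (S_obj A) (stone a - stone b) \<subseteq> prime_filters A - stone (arrow A a b)"
    using prime_filter_nabla_arrow assms by (auto simp: rel_diamond_def points_S_obj Rel_S_obj)
  show "prime_filters A - stone (arrow A a b) \<subseteq> rel_diamond (S_obj A) (stone a - stone b)"
  proof
    fix P assume "P \<in> prime_filters A - stone (arrow A a b)"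
    then have P: "P \<in> prime_filters A" "arrow A a b \<notin> P" by auto
    have "\<exists>Q\<in>prime_filters A. nabla A ` P \<subseteq> Q \<and> {a} \<subseteq> Q \<and> Q \<inter> {b} = {}"
      using P assms by (intro exists_nabla_successor) auto
    then show "P \<in> rel_diamond (S_obj A) (stone a - stone b)"
      using P by (auto simp: rel_diamond_def points_S_obj Rel_S_obj)
  qed
qed

lemma rel_arrow_stone:
  assumes "a \<in> carrier A" "b \<in> carrier A"
  shows "rel_arrow (S_obj A) (stone a) (stone b) = stone (arrow A a b)"
proof -
  have "rel_arrow (S_obj A) (stone a) (stone b) =
      prime_filters A - rel_diamond (S_obj A) (stone a - stone b)"
    by (auto simp: rel_arrow_def rel_diamond_def points_S_obj)
  then show ?thesis using rel_diamond_stone_diff[OF assms] by blast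
qed

lemma nabla_space_S_obj: "nabla_space (S_obj A)"
  unfolding nabla_space_def
proof (intro conjI allI ballI impI)
  show "priestley_space (Topo (S_obj A)) (Leq (S_obj A))" by (rule priestley_S_obj)
  show "Rel (S_obj A) \<subseteq> points (S_obj A) \<times> points (S_obj A)"
    by (auto simp: points_S_obj Rel_S_obj)
  show "(P', Q') \<in> Rel (S_obj A)"
    if "(P', P) \<in> Leq (S_obj A) \<and> (P, Q) \<in> Rel (S_obj A) \<and> (Q, Q') \<in> Leq (S_obj A)" for P' P Q Q'
    using that by (auto simp: Leq_S_obj Rel_S_obj)
  show "closedin (Topo (S_obj A)) (Rel (S_obj A) `` {P})" if "P \<in> points (S_obj A)" for P
  proof -
    have P: "P \<in> prime_filters A" using that points_S_obj by simp
    \<comment> \<open>Closedness comes from writing the successors as an intersection of closed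
      sets. That \<open>\<top>\<close> is in \<open>P\<close> keeps the index set nonempty, as
      \<open>closedin_INT\<close> requires.\<close>
    have "Rel (S_obj A) `` {P} = (\<Inter>p\<in>P. stone (nabla A p))"
      using P prime_filterD(2)[OF P] by (auto simp: Rel_S_obj image_subset_iff)
    moreover have "closedin (Topo (S_obj A)) (\<Inter>p\<in>P. stone (nabla A p))"
    proof (rule closedin_INT)
      show "P \<noteq> {}" using prime_filterD(2)[OF P] by blast
      show "closedin (Topo (S_obj A)) (stone (nabla A p))" if "p \<in> P" for p
        using that prime_filterD(1)[OF P] clopenin_stone nabla_closed
        unfolding clopenin_def by blast
    qed
    ultimately show ?thesis by simp
  qed
  show "clopenin (Topo (S_obj A)) (rel_diamond (S_obj A) U)"
    if U: "clopenin (Topo (S_obj A)) U" for U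
  proof -
    \<comment> \<open>A clopen set is a finite union of basic sets and diamonds commute with unions.
      The clause \<open>W \<subseteq> U\<close> makes the open set that is found equal to
      \<open>U\<close>.\<close>
    have "\<exists>W. openin (Topo (S_obj A)) W \<and> U \<subseteq> W \<and>
      (W \<subseteq> U \<and> clopenin (Topo (S_obj A)) (rel_diamond (S_obj A) W))"
    proof (rule compactin_Un_induct)
      show "compactin (Topo (S_obj A)) U"
        using U compact_S_obj by (auto simp: clopenin_def intro: closedin_compact_space)
      show "{} \<subseteq> U \<and> clopenin (Topo (S_obj A)) (rel_diamond (S_obj A) {})"
        by (simp add: rel_diamond_def clopenin_empty)
    next
      fix V W
      have "rel_diamond (S_obj A) (V \<union> W) = rel_diamond (S_obj A) V \<union> rel_diamond (S_obj A) W"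
        by (auto simp: rel_diamond_def)
      then show "V \<union> W \<subseteq> U \<and> clopenin (Topo (S_obj A)) (rel_diamond (S_obj A) (V \<union> W))"
        if "V \<subseteq> U \<and> clopenin (Topo (S_obj A)) (rel_diamond (S_obj A) V)"
          "W \<subseteq> U \<and> clopenin (Topo (S_obj A)) (rel_diamond (S_obj A) W)"
        using that by (simp add: clopenin_Un)
    next
      fix P assume "P \<in> U"
      then obtain a b where ab: "a \<in> carrier A" "b \<in> carrier A" "P \<in> stone a - stone b"
          "stone a - stone b \<subseteq> U"
        using S_obj_basis U unfolding clopenin_def by blast
      have "clopenin (Topo (S_obj A)) (prime_filters A - stone (arrow A a b))"
        using clopenin_Diff[OF clopenin_topspace clopenin_stone] ab arrow_closed points_S_obj by simp
      then show "\<exists>W. openin (Topo (S_obj A)) W \<and> P \<in> W \<and>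
          W \<subseteq> U \<and> clopenin (Topo (S_obj A)) (rel_diamond (S_obj A) W)"
        using ab openin_stone_diff rel_diamond_stone_diff by (intro exI[of _ "stone a - stone b"]) auto
    qed
    then show ?thesis by (metis (no_types, lifting) subset_antisym)
  qed
  show "rel_nabla (S_obj A) V \<in> clopen_upsets (S_obj A)" if "V \<in> clopen_upsets (S_obj A)" for V
    using that by (auto simp: clopen_upsets_S_obj rel_nabla_stone nabla_closed)
qed

end

section \<open>Heyting implications and Esakia spaces as \<open>\<nabla>\<close>-structures\<close>

lemma bounded_lattice_cong:
  assumes "carrier L = carrier M" "eq L = eq M" "le L = le M"
  shows "bounded_lattice L \<longleftrightarrow> bounded_lattice M"
  unfolding bounded_lattice_def lattice_def upper_semilattice_def upper_semilattice_axioms_def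
      lower_semilattice_def lower_semilattice_axioms_def partial_order_def partial_order_axioms_def
      weak_partial_order_def weak_partial_order_axioms_def equivalence_def
      weak_partial_order_bottom_def weak_partial_order_bottom_axioms_def
      weak_partial_order_top_def weak_partial_order_top_axioms_def
      least_def greatest_def Lower_def Upper_def assms ..

text \<open>The implication is an argument rather than a field of \<open>A\<close> because property
  (H) merely asserts that one exists, whereas an explicitly Heyting algebra supplies
  \<open>himp A\<close>.\<close>

definition implication_reduct :: "('a, 'm) gorder_scheme \<Rightarrow> ('a \<Rightarrow> 'a \<Rightarrow> 'a) \<Rightarrow> 'a nabla_algebra" where
  "implication_reduct A i =
     \<lparr>carrier = carrier A, eq = eq A, le = le A, nabla = (\<lambda>a. a), arrow = i\<rparr>"

definition order_space :: "'x nabla_space \<Rightarrow> 'x nabla_space" where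
  "order_space X = X\<lparr>Rel := Leq X\<rparr>"

lemma implication_reduct_simps [simp]:
  "carrier (implication_reduct A i) = carrier A" "eq (implication_reduct A i) = eq A"
  "le (implication_reduct A i) = le A" "nabla (implication_reduct A i) = (\<lambda>a. a)"
  "arrow (implication_reduct A i) = i"
  "meet (implication_reduct A i) = meet A" "join (implication_reduct A i) = join A"
  "top (implication_reduct A i) = top A" "bottom (implication_reduct A i) = bottom A"
  using gorder_operations_cong[of "implication_reduct A i" A] by (simp_all add: implication_reduct_def)

lemma order_space_simps [simp]:
  "Topo (order_space X) = Topo X" "Leq (order_space X) = Leq X" "Rel (order_space X) = Leq X"
  "clopen_upsets (order_space X) = clopen_upsets X"
  by (simp_all add: order_space_def clopen_upsets_def)

lemma prime_filters_reduct [simp]: "prime_filters (implication_reduct A i) = prime_filters A"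
  by (simp add: prime_filters_def lattice_filter_def)

text \<open>When \<open>nabla\<close> is the identity, the image of \<open>P\<close> under it is
  \<open>P\<close>, and the dual relation becomes inclusion. Through this equation a fact about dual
  spaces yields one about their orders.\<close>

lemma S_obj_reduct: "S_obj (implication_reduct A i) = order_space (S_obj A)"
  by (simp add: S_obj_def order_space_def)

lemma distributive_nabla_algebra_reduct:
  assumes "bounded_lattice A" "distributive A" "is_heyting_implication A i"
  shows "distributive_nabla_algebra (implication_reduct A i)"
proof -
  have "bounded_lattice (implication_reduct A i)"
    using assms(1) bounded_lattice_cong[of "implication_reduct A i" A] by simp
  then show ?thesis
    using assms(2,3)
    by (auto simp: distributive_nabla_algebra_def nabla_algebra_def nabla_algebra_axioms_def
        distributive_nabla_algebra_axioms_def distributive_def is_heyting_implication_def)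
qed

lemma priestley_spaceD:
  assumes "priestley_space T r"
  shows "compact_space T" "r \<subseteq> topspace T \<times> topspace T" "\<And>x. x \<in> topspace T \<Longrightarrow> (x, x) \<in> r"
    "\<And>x y z. \<lbrakk>(x, y) \<in> r; (y, z) \<in> r\<rbrakk> \<Longrightarrow> (x, z) \<in> r" "\<And>x y. \<lbrakk>(x, y) \<in> r; (y, x) \<in> r\<rbrakk> \<Longrightarrow> x = y"
    "\<And>x y. \<lbrakk>x \<in> topspace T; y \<in> topspace T; (x, y) \<notin> r\<rbrakk>
      \<Longrightarrow> \<exists>U. clopenin T U \<and> upset r U \<and> x \<in> U \<and> y \<notin> U"
proof -
  have po: "partial_order_on (topspace T) r" using assms by (simp add: priestley_space_def)
  note D = partial_order_onD[OF po]
  show "r \<subseteq> topspace T \<times> topspace T" by (rule D)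
  show "\<And>x. x \<in> topspace T \<Longrightarrow> (x, x) \<in> r" using D(1) by (simp add: refl_on_def)
  show "\<And>x y z. \<lbrakk>(x, y) \<in> r; (y, z) \<in> r\<rbrakk> \<Longrightarrow> (x, z) \<in> r" using D(2) by (rule transD)
  show "\<And>x y. \<lbrakk>(x, y) \<in> r; (y, x) \<in> r\<rbrakk> \<Longrightarrow> x = y" using D(3) by (rule antisymD)
qed (use assms in \<open>auto simp: priestley_space_def\<close>)

lemma closedin_principal_upset:
  assumes "priestley_space T r" "x \<in> topspace T"
  shows "closedin T (r `` {x})"
proof -
  note D = priestley_spaceD[OF assms(1)]
  have "\<exists>V. openin T V \<and> y \<in> V \<and> V \<subseteq> topspace T - r `` {x}" if y: "y \<in> topspace T - r `` {x}" for y
  proof -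
    obtain U where U: "clopenin T U" "upset r U" "x \<in> U" "y \<notin> U"
      using D(6)[of x y] assms(2) y by blast
    then have "openin T (topspace T - U)" "r `` {x} \<subseteq> U"
      by (auto simp: clopenin_def upset_def)
    then show ?thesis using U y by blast
  qed
  then have "openin T (topspace T - r `` {x})" by (subst openin_subopen) blast
  moreover have "r `` {x} \<subseteq> topspace T" using D(2) by blast
  ultimately show ?thesis by (simp add: closedin_def)
qed

lemma rel_nabla_order_space:
  assumes "priestley_space (Topo X) (Leq X)" "U \<in> clopen_upsets X"
  shows "rel_nabla (order_space X) U = U"
proof -
  have "U \<subseteq> points X" using assms(2) clopenin_subset by (auto simp: clopen_upsets_def)
  then show ?thesis
    using priestley_spaceD(3)[OF assms(1)] assms(2)
    by (auto simp: rel_nabla_def clopen_upsets_def upset_def)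
qed

lemma rel_diamond_order_space:
  assumes "priestley_space (Topo X) (Leq X)"
  shows "rel_diamond (order_space X) U = {x. \<exists>y\<in>U. (x, y) \<in> Leq X}"
  using priestley_spaceD(2)[OF assms] by (auto simp: rel_diamond_def)

text \<open>For the relation \<open>Leq X\<close> all axioms but one hold in every Priestley space:
  principal upsets are closed and \<open>rel_nabla\<close> fixes clopen upsets. The remaining axiom,
  on diamonds, is the Esakia condition.\<close>

lemma nabla_space_order_space:
  assumes "priestley_space (Topo X) (Leq X)"
  shows "nabla_space (order_space X) \<longleftrightarrow> esakia_space (Topo X) (Leq X)"
proof
  assume "nabla_space (order_space X)"
  then have "\<forall>U. clopenin (Topo X) U \<longrightarrow> clopenin (Topo X) (rel_diamond (order_space X) U)"
    by (simp add: nabla_space_def)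
  then show "esakia_space (Topo X) (Leq X)"
    using assms by (simp add: esakia_space_def rel_diamond_order_space)
next
  assume es: "esakia_space (Topo X) (Leq X)"
  show "nabla_space (order_space X)"
    unfolding nabla_space_def
  proof (intro conjI allI ballI impI)
    show "(x', y') \<in> Rel (order_space X)"
      if "(x', x) \<in> Leq (order_space X) \<and> (x, y) \<in> Rel (order_space X) \<and> (y, y') \<in> Leq (order_space X)"
      for x' x y y'
      using that priestley_spaceD(4)[OF assms] by (metis order_space_simps(2,3))
    show "Rel (order_space X) \<subseteq> points (order_space X) \<times> points (order_space X)"
      using priestley_spaceD(2)[OF assms] by simp
  qed (use assms es in \<open>simp_all add: closedin_principal_upset rel_diamond_order_space
        esakia_space_def rel_nabla_order_space\<close>)
qed

context distributive_nabla_algebra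
begin

section \<open>Properties of algebras and conditions on their dual spaces\<close>

lemma box_mono:
  assumes "a \<sqsubseteq> b" "a \<in> carrier A" "b \<in> carrier A"
  shows "box A a \<sqsubseteq> box A b"
proof -
  have "nabla A (box A a) \<sqsubseteq> a" using assms by (simp add: nabla_le_iff_le_box box_closed)
  then have "nabla A (box A a) \<sqsubseteq> b"
    using assms le_trans[of "nabla A (box A a)" a b] by (simp add: nabla_closed box_closed)
  then show ?thesis using assms by (simp add: nabla_le_iff_le_box box_closed)
qed

text \<open>A triangle identity of the adjunction, \<open>box_nabla_box\<close> being the other.
  They turn surjectivity of \<open>nabla\<close> or \<open>box\<close> into the equations
  \<open>nabla A (box A q) = q\<close> or \<open>box A (nabla A q) = q\<close> for all
  \<open>q\<close>.\<close>

lemma nabla_box_nabla: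
  assumes "a \<in> carrier A"
  shows "nabla A (box A (nabla A a)) = nabla A a"
proof (rule le_antisym)
  have "a \<sqsubseteq> box A (nabla A a)" using assms by (simp add: nabla_closed flip: nabla_le_iff_le_box)
  then show "nabla A a \<sqsubseteq> nabla A (box A (nabla A a))"
    using assms by (simp add: nabla_mono nabla_closed box_closed)
qed (use assms in \<open>simp_all add: nabla_closed box_closed nabla_le_iff_le_box\<close>)

lemma box_nabla_box:
  assumes "a \<in> carrier A"
  shows "box A (nabla A (box A a)) = box A a"
proof (rule le_antisym)
  have "nabla A (box A a) \<sqsubseteq> a" using assms by (simp add: box_closed nabla_le_iff_le_box)
  then show "box A (nabla A (box A a)) \<sqsubseteq> box A a"
    using assms by (simp add: box_mono nabla_closed box_closed)
qed (use assms in \<open>simp_all add: nabla_closed box_closed flip: nabla_le_iff_le_box\<close>)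

text \<open>The map \<open>\<pi>\<close> is the preimage under \<open>nabla\<close>. Preservation of
  \<open>\<bottom>\<close> and joins is automatic and keeps preimages proper and prime; normality
  adds \<open>\<top>\<close> and meets, so preimages of prime filters are prime filters.\<close>

lemma normal_S_obj:
  assumes "algebra_has A Normal"
  shows "space_has (S_obj A) Normal"
proof -
  let ?\<pi> = "\<lambda>Q. {x \<in> carrier A. nabla A x \<in> Q}"
  have top: "nabla A \<top> = \<top>"
    and meet: "\<And>a b. \<lbrakk>a \<in> carrier A; b \<in> carrier A\<rbrakk> \<Longrightarrow> nabla A (a \<sqinter> b) = nabla A a \<sqinter> nabla A b"
    using assms by auto
  have prime: "?\<pi> Q \<in> prime_filters A" if Q: "Q \<in> prime_filters A" for Q
  proof (rule prime_filterI)
    note QD = prime_filterD[OF Q]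
    show "\<top> \<in> ?\<pi> Q" using QD(2) top by simp
    show "\<bottom> \<notin> ?\<pi> Q" using QD(3) nabla_bottom by simp
    show "b \<in> ?\<pi> Q" if "a \<in> ?\<pi> Q" "b \<in> carrier A" "a \<sqsubseteq> b" for a b
      using that QD(4)[of "nabla A a" "nabla A b"] by (simp add: nabla_closed nabla_mono)
    show "a \<sqinter> b \<in> ?\<pi> Q" if "a \<in> ?\<pi> Q" "b \<in> ?\<pi> Q" for a b
      using that QD(5)[of "nabla A a" "nabla A b"] by (simp add: meet nabla_closed)
    show "a \<in> ?\<pi> Q \<or> b \<in> ?\<pi> Q" if "a \<in> carrier A" "b \<in> carrier A" "a \<squnion> b \<in> ?\<pi> Q" for a b
      using that QD(6)[of "nabla A a" "nabla A b"] by (simp add: nabla_join nabla_closed)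
  qed auto
  have "(P, Q) \<in> Rel (S_obj A) \<longleftrightarrow> (P, ?\<pi> Q) \<in> Leq (S_obj A)"
    if "P \<in> points (S_obj A)" "Q \<in> points (S_obj A)" for P Q
    using that prime[of Q] prime_filterD(1)[of P] by (auto simp: points_S_obj Rel_S_obj Leq_S_obj)
  moreover have "(?\<pi> P, ?\<pi> Q) \<in> Leq (S_obj A)" if "(P, Q) \<in> Leq (S_obj A)" for P Q
    using that prime by (auto simp: Leq_S_obj)
  moreover have "?\<pi> \<in> points (S_obj A) \<rightarrow> points (S_obj A)"
    using prime by (auto simp: points_S_obj)
  ultimately show ?thesis
    unfolding space_has.simps by (intro bexI[of _ ?\<pi>] conjI allI ballI impI)
qed

text \<open>The witness for \<open>Q\<close> is a predecessor \<open>P\<close> containing all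
  \<open>box A q\<close> with \<open>q\<close> in \<open>Q\<close>. Any successor \<open>Z\<close>
  of \<open>P\<close> then contains \<open>nabla A (box A q) = q\<close>, hence
  \<open>Q \<subseteq> Z\<close>.\<close>

lemma faithful_S_obj:
  assumes "algebra_has A Faithful"
  shows "space_has (S_obj A) Faithful"
proof -
  have nb: "nabla A (box A q) = q" if q: "q \<in> carrier A" for q
  proof -
    have "q \<in> nabla A ` carrier A" using assms q by simp
    then obtain a where "a \<in> carrier A" "q = nabla A a" by blast
    then show ?thesis using nabla_box_nabla by simp
  qed
  have "\<exists>P\<in>prime_filters A. nabla A ` P \<subseteq> Q \<and> box A ` Q \<subseteq> P" if Q: "Q \<in> prime_filters A" for Q
  proof (rule exists_nabla_predecessor[OF Q])
    note QD = prime_filterD[OF Q]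
    show "box A ` Q \<subseteq> carrier A" using QD(1) box_closed by blast
    show "box A ` Q \<noteq> {}" using QD(2) by blast
    show "nabla A ` box A ` Q \<subseteq> Q"
    proof
      fix y assume "y \<in> nabla A ` box A ` Q"
      then obtain q where "q \<in> Q" "y = nabla A (box A q)" by blast
      then show "y \<in> Q" using nb[of q] QD(1) by auto
    qed
    fix x y assume "x \<in> box A ` Q" "y \<in> box A ` Q"
    then obtain p q where pq: "p \<in> Q" "q \<in> Q" "x = box A p" "y = box A q" by blast
    then have c: "p \<in> carrier A" "q \<in> carrier A" using QD(1) by auto
    then have "box A (p \<sqinter> q) \<sqsubseteq> x" "box A (p \<sqinter> q) \<sqsubseteq> y"
      unfolding pq by (simp_all add: box_mono meet_left meet_right)
    moreover have "p \<sqinter> q \<in> Q" using pq c QD(5) by simp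
    ultimately show "\<exists>z\<in>box A ` Q. z \<sqsubseteq> x \<and> z \<sqsubseteq> y" by blast
  qed
  moreover have "Q \<subseteq> Z" if "Q \<in> prime_filters A" "box A ` Q \<subseteq> P" "nabla A ` P \<subseteq> Z" for P Q Z
  proof
    fix q assume q: "q \<in> Q"
    then have "q \<in> carrier A" using prime_filterD(1)[OF that(1)] by blast
    moreover have "nabla A (box A q) \<in> Z" using that(2,3) q by blast
    ultimately show "q \<in> Z" using nb by simp
  qed
  ultimately show ?thesis
    unfolding space_has.simps points_S_obj Rel_S_obj Leq_S_obj by meson
qed

text \<open>The witness for \<open>P\<close> is a successor \<open>Q\<close> that avoids
  \<open>nabla A x\<close> for every \<open>x\<close> outside \<open>P\<close>; whatever prime
  filter \<open>nabla\<close> maps into \<open>Q\<close> then lies in \<open>P\<close>. It exists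
  because \<open>box A (nabla A x) = x\<close>.\<close>

lemma full_S_obj:
  assumes "algebra_has A Full"
  shows "space_has (S_obj A) Full"
proof -
  have bn: "box A (nabla A q) = q" if q: "q \<in> carrier A" for q
  proof -
    have "q \<in> box A ` carrier A" using assms q by simp
    then obtain a where "a \<in> carrier A" "q = box A a" by blast
    then show ?thesis using box_nabla_box by simp
  qed
  have "\<exists>Q\<in>prime_filters A. nabla A ` P \<subseteq> Q \<and> {\<top>} \<subseteq> Q \<and> Q \<inter> nabla A ` (carrier A - P) = {}"
    if P: "P \<in> prime_filters A" for P
  proof (rule exists_nabla_successor[OF P])
    note PD = prime_filterD[OF P]
    show "nabla A ` (carrier A - P) \<subseteq> carrier A" using nabla_closed by blast
    show "nabla A ` (carrier A - P) \<noteq> {}" using PD(3) bottom_closed by blast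
    show "arrow A a b \<notin> P" if "a \<in> {\<top>}" and b: "b \<in> nabla A ` (carrier A - P)" for a b
    proof -
      obtain x where "x \<in> carrier A" "x \<notin> P" "b = nabla A x" using b by blast
      then show ?thesis using bn[of x] \<open>a \<in> {\<top>}\<close> by (simp add: box_def)
    qed
    fix x y assume "x \<in> nabla A ` (carrier A - P)" "y \<in> nabla A ` (carrier A - P)"
    then obtain p q where pq: "p \<in> carrier A" "p \<notin> P" "q \<in> carrier A" "q \<notin> P" "x = nabla A p" "y = nabla A q"
      by blast
    then have "p \<squnion> q \<in> carrier A - P" using PD(6) by simp
    moreover have "x \<sqsubseteq> nabla A (p \<squnion> q)" "y \<sqsubseteq> nabla A (p \<squnion> q)"
      using pq by (simp_all add: nabla_mono join_left join_right)
    ultimately show "\<exists>z\<in>nabla A ` (carrier A - P). x \<sqsubseteq> z \<and> y \<sqsubseteq> z" by blast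
  qed auto
  moreover have "Z \<subseteq> P"
    if "Z \<in> prime_filters A" "Q \<inter> nabla A ` (carrier A - P) = {}" "nabla A ` Z \<subseteq> Q" for P Q Z
    using that prime_filterD(1)[OF that(1)] by blast
  ultimately show ?thesis
    unfolding space_has.simps points_S_obj Rel_S_obj Leq_S_obj by meson
qed

lemma space_has_S_obj:
  assumes "algebra_has A p"
  shows "space_has (S_obj A) p"
proof (cases p)
  case Heyting
  then obtain i where "is_heyting_implication A i" using assms by auto
  then interpret R: distributive_nabla_algebra "implication_reduct A i"
    using bounded_lattice_axioms distributive by (intro distributive_nabla_algebra_reduct)
  show ?thesis
    using R.nabla_space_S_obj nabla_space_order_space[OF priestley_S_obj] Heyting
    by (simp add: S_obj_reduct)
next
  case Right
  have "a \<in> Q \<Longrightarrow> nabla A a \<in> Q" if "Q \<in> prime_filters A" for a Q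
    using prime_filterD(4)[OF that, of a "nabla A a"] prime_filterD(1)[OF that] assms Right nabla_closed
    by auto
  then have "nabla A ` P \<subseteq> Q" if "Q \<in> prime_filters A" "P \<subseteq> Q" for P Q
    using that by blast
  then show ?thesis using Right by (auto simp only: space_has.simps Rel_S_obj Leq_S_obj)
next
  case Left
  have "a \<in> carrier A \<Longrightarrow> nabla A a \<in> Q \<Longrightarrow> a \<in> Q" if "Q \<in> prime_filters A" for a Q
    using prime_filterD(4)[OF that, of "nabla A a" a] assms Left by auto
  then have "P \<subseteq> Q" if "P \<in> prime_filters A" "Q \<in> prime_filters A" "nabla A ` P \<subseteq> Q" for P Q
    using that prime_filterD(1)[OF that(1)] by blast
  then show ?thesis using Left by (auto simp only: space_has.simps Rel_S_obj Leq_S_obj)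
qed (use assms normal_S_obj faithful_S_obj full_S_obj in simp_all)

end

section \<open>Dual maps of algebra morphisms\<close>

lemma Hom_AlgD:
  assumes "f \<in> Hom_Alg A B"
  shows "f \<in> carrier A \<rightarrow>\<^sub>E carrier B" "\<And>a. a \<in> carrier A \<Longrightarrow> f a \<in> carrier B"
    "f \<top>\<^bsub>A\<^esub> = \<top>\<^bsub>B\<^esub>" "f \<bottom>\<^bsub>A\<^esub> = \<bottom>\<^bsub>B\<^esub>"
    "\<And>a b. \<lbrakk>a \<in> carrier A; b \<in> carrier A\<rbrakk> \<Longrightarrow> f (a \<sqinter>\<^bsub>A\<^esub> b) = f a \<sqinter>\<^bsub>B\<^esub> f b"
    "\<And>a b. \<lbrakk>a \<in> carrier A; b \<in> carrier A\<rbrakk> \<Longrightarrow> f (a \<squnion>\<^bsub>A\<^esub> b) = f a \<squnion>\<^bsub>B\<^esub> f b"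
    "\<And>a. a \<in> carrier A \<Longrightarrow> f (nabla A a) = nabla B (f a)"
    "\<And>a b. \<lbrakk>a \<in> carrier A; b \<in> carrier A\<rbrakk> \<Longrightarrow> f (arrow A a b) = arrow B (f a) (f b)"
  using assms by (auto simp: Hom_Alg_def)

lemma Hom_Alg_mono:
  assumes A: "bounded_lattice A" and B: "bounded_lattice B" and f: "f \<in> Hom_Alg A B"
    and ab: "a \<in> carrier A" "b \<in> carrier A" "a \<sqsubseteq>\<^bsub>A\<^esub> b"
  shows "f a \<sqsubseteq>\<^bsub>B\<^esub> f b"
proof -
  interpret A: bounded_lattice A by fact
  interpret B: bounded_lattice B by fact
  have "a = a \<sqinter>\<^bsub>A\<^esub> b" using ab A.le_iff_join by simp
  then have "f a = f a \<sqinter>\<^bsub>B\<^esub> f b" using Hom_AlgD(5)[OF f ab(1,2)] by simp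
  then show ?thesis using B.le_iff_join Hom_AlgD(2)[OF f] ab by simp
qed

text \<open>The preimage of the basic set for \<open>a, b\<close> is the basic set for
  \<open>f a, f b\<close>, which gives continuity. The two back conditions are the successor and
  predecessor lemmas of \<open>B\<close>, fed with images under \<open>f\<close>.\<close>

lemma S_map_Hom_Space:
  assumes A: "distributive_nabla_algebra A" and B: "distributive_nabla_algebra B"
    and f: "f \<in> Hom_Alg A B"
  shows "S_map A B f \<in> Hom_Space (S_obj B) (S_obj A)"
proof -
  interpret A: distributive_nabla_algebra A by fact
  interpret B: distributive_nabla_algebra B by fact
  note h = Hom_AlgD[OF f]
  note mono = Hom_Alg_mono[OF A.bounded_lattice_axioms B.bounded_lattice_axioms f]
  let ?g = "\<lambda>P. {a \<in> carrier A. f a \<in> P}"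
  have Sm: "S_map A B f P = ?g P" if "P \<in> prime_filters B" for P
    using that by (simp add: S_map_def)
  have prime: "?g P \<in> prime_filters A" if P: "P \<in> prime_filters B" for P
  proof (rule A.prime_filterI)
    note PD = B.prime_filterD[OF P]
    show "\<top>\<^bsub>A\<^esub> \<in> ?g P" using PD(2) h(3) by simp
    show "\<bottom>\<^bsub>A\<^esub> \<notin> ?g P" using PD(3) h(4) by simp
    show "b \<in> ?g P" if "a \<in> ?g P" "b \<in> carrier A" "a \<sqsubseteq>\<^bsub>A\<^esub> b" for a b
      using that PD(4)[of "f a" "f b"] mono[of a b] h(2) by simp
    show "a \<sqinter>\<^bsub>A\<^esub> b \<in> ?g P" if "a \<in> ?g P" "b \<in> ?g P" for a b
      using that PD(5)[of "f a" "f b"] h(2,5) by simp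
    show "a \<in> ?g P \<or> b \<in> ?g P" if "a \<in> carrier A" "b \<in> carrier A" "a \<squnion>\<^bsub>A\<^esub> b \<in> ?g P" for a b
      using that PD(6)[of "f a" "f b"] h(2,6) by simp
  qed auto
  have cont: "continuous_map (Topo (S_obj B)) (Topo (S_obj A)) (S_map A B f)"
    unfolding continuous_map_def
  proof (intro conjI allI impI)
    show "S_map A B f \<in> points (S_obj B) \<rightarrow> points (S_obj A)"
      using prime by (auto simp: A.points_S_obj B.points_S_obj Sm)
    fix U assume U: "openin (Topo (S_obj A)) U"
    let ?V = "{P \<in> points (S_obj B). S_map A B f P \<in> U}"
    have "\<exists>W. openin (Topo (S_obj B)) W \<and> P \<in> W \<and> W \<subseteq> ?V" if P: "P \<in> ?V" for P
    proof -
      have "P \<in> prime_filters B" "?g P \<in> U" using P by (auto simp: B.points_S_obj Sm)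
      then obtain a b where ab: "a \<in> carrier A" "b \<in> carrier A" "?g P \<in> A.stone a - A.stone b"
          "A.stone a - A.stone b \<subseteq> U"
        using A.S_obj_basis[OF U] by blast
      have "openin (Topo (S_obj B)) (B.stone (f a) - B.stone (f b))"
        using ab h(2) B.openin_stone_diff by simp
      moreover have "P \<in> B.stone (f a) - B.stone (f b)"
        using ab \<open>P \<in> prime_filters B\<close> by simp
      moreover have "B.stone (f a) - B.stone (f b) \<subseteq> ?V"
      proof
        fix Q assume Q: "Q \<in> B.stone (f a) - B.stone (f b)"
        then have "?g Q \<in> A.stone a - A.stone b" using ab prime[of Q] by simp
        then show "Q \<in> ?V" using Q ab(4) by (auto simp: B.points_S_obj Sm)
      qed
      ultimately show ?thesis by blast
    qed
    then show "openin (Topo (S_obj B)) ?V" by (subst openin_subopen) blast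
  qed
  show ?thesis
    unfolding Hom_Space_def mem_Collect_eq
  proof (intro conjI allI ballI impI)
    show "S_map A B f \<in> points (S_obj B) \<rightarrow>\<^sub>E points (S_obj A)"
      using prime by (auto simp: S_map_def A.points_S_obj B.points_S_obj)
    show "(S_map A B f P, S_map A B f Q) \<in> Leq (S_obj A)" if "(P, Q) \<in> Leq (S_obj B)" for P Q
      using that prime by (auto simp: A.Leq_S_obj B.Leq_S_obj Sm)
    show "(S_map A B f P, S_map A B f Q) \<in> Rel (S_obj A)" if "(P, Q) \<in> Rel (S_obj B)" for P Q
    proof -
      have PQ: "P \<in> prime_filters B" "Q \<in> prime_filters B" "nabla B ` P \<subseteq> Q"
        using that by (auto simp: B.Rel_S_obj)
      have "nabla A a \<in> ?g Q" if "a \<in> ?g P" for a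
        using that PQ(3) by (auto simp: h(7) A.nabla_closed)
      then show ?thesis using PQ prime by (auto simp: A.Rel_S_obj Sm)
    qed
    show "\<exists>L\<in>points (S_obj B). (K, L) \<in> Rel (S_obj B) \<and> S_map A B f L = L'"
      if "K \<in> points (S_obj B)" "L' \<in> points (S_obj A)" "(S_map A B f K, L') \<in> Rel (S_obj A)" for K L'
    proof -
      have K: "K \<in> prime_filters B" and L': "L' \<in> prime_filters A" and R: "nabla A ` ?g K \<subseteq> L'"
        using that by (auto simp: A.points_S_obj B.points_S_obj A.Rel_S_obj Sm)
      note LD = A.prime_filterD[OF L']
      \<comment> \<open>Containing the image of \<open>L'\<close> and avoiding the image of its
        complement makes the preimage of \<open>L\<close> equal to \<open>L'\<close>, not just
        larger.\<close>
      have "\<exists>L\<in>prime_filters B. nabla B ` K \<subseteq> L \<and> f ` L' \<subseteq> L \<and> L \<inter> f ` (carrier A - L') = {}"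
      proof (rule B.exists_nabla_successor[OF K])
        show "f ` L' \<subseteq> carrier B" "f ` (carrier A - L') \<subseteq> carrier B" using LD(1) h(2) by blast+
        show "f ` L' \<noteq> {}" "f ` (carrier A - L') \<noteq> {}" using LD(2,3) A.bottom_closed by blast+
        fix x y
        show "\<exists>z\<in>f ` L'. z \<sqsubseteq>\<^bsub>B\<^esub> x \<and> z \<sqsubseteq>\<^bsub>B\<^esub> y" if xy: "x \<in> f ` L'" "y \<in> f ` L'"
        proof -
          obtain a b where ab: "a \<in> L'" "b \<in> L'" "x = f a" "y = f b" using xy by blast
          then have c: "a \<in> carrier A" "b \<in> carrier A" using LD(1) by auto
          then have "a \<sqinter>\<^bsub>A\<^esub> b \<in> L'" using ab LD(5) by simp
          moreover have "f (a \<sqinter>\<^bsub>A\<^esub> b) \<sqsubseteq>\<^bsub>B\<^esub> x" "f (a \<sqinter>\<^bsub>A\<^esub> b) \<sqsubseteq>\<^bsub>B\<^esub> y"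
            using c ab by (simp_all add: mono A.meet_left A.meet_right)
          ultimately show ?thesis by blast
        qed
        show "\<exists>z\<in>f ` (carrier A - L'). x \<sqsubseteq>\<^bsub>B\<^esub> z \<and> y \<sqsubseteq>\<^bsub>B\<^esub> z"
          if xy: "x \<in> f ` (carrier A - L')" "y \<in> f ` (carrier A - L')"
        proof -
          obtain a b where ab: "a \<in> carrier A" "a \<notin> L'" "b \<in> carrier A" "b \<notin> L'" "x = f a" "y = f b"
            using xy by blast
          then have "a \<squnion>\<^bsub>A\<^esub> b \<in> carrier A - L'" using LD(6) by simp
          moreover have "x \<sqsubseteq>\<^bsub>B\<^esub> f (a \<squnion>\<^bsub>A\<^esub> b)" "y \<sqsubseteq>\<^bsub>B\<^esub> f (a \<squnion>\<^bsub>A\<^esub> b)"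
            using ab by (simp_all add: mono A.join_left A.join_right)
          ultimately show ?thesis by blast
        qed
        show "arrow B x y \<notin> K" if xy: "x \<in> f ` L'" "y \<in> f ` (carrier A - L')"
        proof
          assume K': "arrow B x y \<in> K"
          obtain a b where ab: "a \<in> L'" "b \<in> carrier A" "b \<notin> L'" "x = f a" "y = f b"
            using xy by blast
          then have "a \<in> carrier A" using LD(1) by blast
          \<comment> \<open>Preservation of \<open>arrow\<close> enters here: the arrow pulls back
            to the preimage of \<open>K\<close>, and then \<open>a\<close> in \<open>L'\<close>
            forces \<open>b\<close> into \<open>L'\<close>.\<close>
          then have "arrow A a b \<in> ?g K" using K' ab by (simp add: h(8) A.arrow_closed)
          then have "b \<in> L'"
            using A.prime_filter_nabla_arrow[OF prime[OF K] L' R] ab \<open>a \<in> carrier A\<close> by simp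
          then show False using ab by simp
        qed
      qed
      then obtain L where L: "L \<in> prime_filters B" "nabla B ` K \<subseteq> L" "f ` L' \<subseteq> L"
          "L \<inter> f ` (carrier A - L') = {}" by blast
      then have "?g L = L'" using LD(1) by blast
      then show ?thesis using L K by (auto simp: B.points_S_obj B.Rel_S_obj Sm)
    qed
    show "\<exists>L\<in>points (S_obj B). (L, K) \<in> Rel (S_obj B) \<and> (L', S_map A B f L) \<in> Leq (S_obj A)"
      if "K \<in> points (S_obj B)" "L' \<in> points (S_obj A)" "(L', S_map A B f K) \<in> Rel (S_obj A)" for K L'
    proof -
      have K: "K \<in> prime_filters B" and L': "L' \<in> prime_filters A" and R: "nabla A ` L' \<subseteq> ?g K"
        using that by (auto simp: A.points_S_obj B.points_S_obj A.Rel_S_obj Sm)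
      note LD = A.prime_filterD[OF L']
      \<comment> \<open>An inclusion is all that is wanted, so it is enough to prescribe the image
        of \<open>L'\<close>, which \<open>nabla B\<close> sends into \<open>K\<close> since
        \<open>f\<close> commutes with \<open>nabla\<close>.\<close>
      have "\<exists>L\<in>prime_filters B. nabla B ` L \<subseteq> K \<and> f ` L' \<subseteq> L"
      proof (rule B.exists_nabla_predecessor[OF K])
        show "f ` L' \<subseteq> carrier B" using LD(1) h(2) by blast
        show "f ` L' \<noteq> {}" using LD(2) by blast
        show "nabla B ` f ` L' \<subseteq> K"
          using R LD(1) by (auto simp: image_subset_iff subset_iff simp flip: h(7))
        fix x y assume "x \<in> f ` L'" "y \<in> f ` L'"
        then obtain a b where ab: "a \<in> L'" "b \<in> L'" "x = f a" "y = f b" by blast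
        then have c: "a \<in> carrier A" "b \<in> carrier A" using LD(1) by auto
        then have "a \<sqinter>\<^bsub>A\<^esub> b \<in> L'" using ab LD(5) by simp
        moreover have "f (a \<sqinter>\<^bsub>A\<^esub> b) \<sqsubseteq>\<^bsub>B\<^esub> x" "f (a \<sqinter>\<^bsub>A\<^esub> b) \<sqsubseteq>\<^bsub>B\<^esub> y"
          using c ab by (simp_all add: mono A.meet_left A.meet_right)
        ultimately show "\<exists>z\<in>f ` L'. z \<sqsubseteq>\<^bsub>B\<^esub> x \<and> z \<sqsubseteq>\<^bsub>B\<^esub> y" by blast
      qed
      then obtain L where L: "L \<in> prime_filters B" "nabla B ` L \<subseteq> K" "f ` L' \<subseteq> L" by blast
      then have "L' \<subseteq> ?g L" using LD(1) by blast
      then show ?thesis using L K L' prime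
        by (auto simp: B.points_S_obj B.Rel_S_obj A.Leq_S_obj Sm)
    qed
  qed (rule cont)
qed

section \<open>The dual algebra of a space\<close>

lemma nabla_spaceD:
  assumes "nabla_space X"
  shows "priestley_space (Topo X) (Leq X)" "Rel X \<subseteq> points X \<times> points X"
    "\<And>x' x y y'. \<lbrakk>(x', x) \<in> Leq X; (x, y) \<in> Rel X; (y, y') \<in> Leq X\<rbrakk> \<Longrightarrow> (x', y') \<in> Rel X"
    "\<And>x. x \<in> points X \<Longrightarrow> closedin (Topo X) (Rel X `` {x})"
    "\<And>U. clopenin (Topo X) U \<Longrightarrow> clopenin (Topo X) (rel_diamond X U)"
    "\<And>V. V \<in> clopen_upsets X \<Longrightarrow> rel_nabla X V \<in> clopen_upsets X"
  using assms unfolding nabla_space_def by blast+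

lemma clopen_upsets_subset: "U \<in> clopen_upsets X \<Longrightarrow> U \<subseteq> points X"
  by (auto simp: clopen_upsets_def dest: clopenin_subset)

lemma clopen_upsets_lattice:
  "{} \<in> clopen_upsets X"
  "\<lbrakk>U \<in> clopen_upsets X; V \<in> clopen_upsets X\<rbrakk> \<Longrightarrow> U \<inter> V \<in> clopen_upsets X"
  "\<lbrakk>U \<in> clopen_upsets X; V \<in> clopen_upsets X\<rbrakk> \<Longrightarrow> U \<union> V \<in> clopen_upsets X"
  by (auto simp: clopen_upsets_def clopenin_empty clopenin_Int clopenin_Un) (auto simp: upset_def)

text \<open>An arbitrary record type is allowed so that the results apply to \<open>A_obj X\<close>, to
  \<open>AH_obj X\<close> and to the Heyting reduct of \<open>AH_obj X\<close>, whose \<open>nabla\<close> agrees with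
  \<open>rel_nabla (order_space X)\<close> only on clopen upsets.\<close>

locale clopen_upset_algebra =
  fixes X :: "'x nabla_space" and L :: "('x set, 'm) nabla_algebra_scheme"
  assumes space: "nabla_space X"
    and carrier_eq: "carrier L = clopen_upsets X" and le_eq: "le L = (\<subseteq>)" and eq_eq: "eq L = (=)"
    and nabla_eq: "U \<in> clopen_upsets X \<Longrightarrow> nabla L U = rel_nabla X U"
    and arrow_eq: "\<lbrakk>U \<in> clopen_upsets X; V \<in> clopen_upsets X\<rbrakk> \<Longrightarrow> arrow L U V = rel_arrow X U V"
begin

lemmas priestley = priestley_spaceD[OF nabla_spaceD(1)[OF space]]

lemma points_clopen_upset: "points X \<in> clopen_upsets X"
  using priestley(2) by (auto simp: clopen_upsets_def clopenin_topspace upset_def)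

lemma bounded_lattice: "bounded_lattice L"
proof unfold_locales
  fix U V assume UV: "U \<in> carrier L" "V \<in> carrier L"
  show "\<exists>s. least L s (Upper L {U, V})"
    using UV clopen_upsets_lattice(3)
    by (intro exI[of _ "U \<union> V"]) (auto simp: least_def Upper_def carrier_eq le_eq)
  show "\<exists>s. greatest L s (Lower L {U, V})"
    using UV clopen_upsets_lattice(2)
    by (intro exI[of _ "U \<inter> V"]) (auto simp: greatest_def Lower_def carrier_eq le_eq)
next
  show "\<exists>U. least L U (carrier L)"
    using clopen_upsets_lattice(1) by (intro exI[of _ "{}"]) (auto simp: least_def carrier_eq le_eq)
  show "\<exists>U. greatest L U (carrier L)"
    using points_clopen_upset
    by (intro exI[of _ "points X"]) (auto simp: greatest_def carrier_eq le_eq dest: clopen_upsets_subset)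
qed (auto simp: eq_eq le_eq)

lemma operations:
  shows "\<lbrakk>U \<in> clopen_upsets X; V \<in> clopen_upsets X\<rbrakk> \<Longrightarrow> meet L U V = U \<inter> V"
    and "\<lbrakk>U \<in> clopen_upsets X; V \<in> clopen_upsets X\<rbrakk> \<Longrightarrow> join L U V = U \<union> V"
    and "top L = points X" and "bottom L = {}"
proof -
  interpret bounded_lattice L by (rule bounded_lattice)
  show "meet L U V = U \<inter> V" if "U \<in> clopen_upsets X" "V \<in> clopen_upsets X" for U V
    using that meet_left[of U V] meet_right[of U V] meet_le[of "U \<inter> V" U V] clopen_upsets_lattice(2)[of U X V]
    unfolding carrier_eq le_eq by blast
  show "join L U V = U \<union> V" if "U \<in> clopen_upsets X" "V \<in> clopen_upsets X" for U V
    using that join_left[of U V] join_right[of U V] join_le[of U "U \<union> V" V] clopen_upsets_lattice(3)[of U X V]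
    unfolding carrier_eq le_eq by blast
  show "top L = points X"
    using top_eq[of "points X"] points_clopen_upset clopen_upsets_subset unfolding carrier_eq le_eq by blast
  show "bottom L = {}"
    using bottom_eq[of "{}"] clopen_upsets_lattice(1) unfolding carrier_eq le_eq by blast
qed

text \<open>It is the complement of the diamond of the clopen set \<open>U - V\<close>, hence
  clopen. It is an upset since passing to a larger point shrinks the set of successors.\<close>

lemma rel_arrow_clopen_upset:
  assumes "U \<in> clopen_upsets X" "V \<in> clopen_upsets X"
  shows "rel_arrow X U V \<in> clopen_upsets X"
proof -
  have "rel_arrow X U V = points X - rel_diamond X (U - V)"
    by (auto simp: rel_arrow_def rel_diamond_def)
  then have "clopenin (Topo X) (rel_arrow X U V)"
    using assms nabla_spaceD(5)[OF space, of "U - V"]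
    by (simp add: clopen_upsets_def clopenin_Diff clopenin_topspace)
  moreover have "upset (Leq X) (rel_arrow X U V)"
    unfolding upset_def
  proof (intro allI impI)
    fix x y assume xy: "x \<in> rel_arrow X U V \<and> (x, y) \<in> Leq X"
    then have "y \<in> points X" using priestley(2) by blast
    moreover have "(x, z) \<in> Rel X" if "(y, z) \<in> Rel X" for z
      using nabla_spaceD(3)[OF space, of x y z z] xy that nabla_spaceD(2)[OF space] priestley(3) by blast
    ultimately show "y \<in> rel_arrow X U V" using xy unfolding rel_arrow_def by blast
  qed
  ultimately show ?thesis by (simp add: clopen_upsets_def)
qed

lemma rel_residuation:
  assumes "W \<subseteq> points X"
  shows "rel_nabla X W \<inter> U \<subseteq> V \<longleftrightarrow> W \<subseteq> rel_arrow X U V"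
  using assms nabla_spaceD(2)[OF space] unfolding rel_nabla_def rel_arrow_def by blast

text \<open>All results on prime filters and dual spaces now apply to \<open>L\<close>; in
  particular \<open>S_obj L\<close> is a space into which \<open>beta X\<close> can map.\<close>

sublocale distributive_nabla_algebra L
proof -
  have "nabla_algebra_axioms L"
    unfolding nabla_algebra_axioms_def carrier_eq le_eq
    by (simp add: nabla_eq arrow_eq operations nabla_spaceD(6)[OF space] rel_arrow_clopen_upset
        rel_residuation[OF clopen_upsets_subset])
  moreover have "distributive L"
    unfolding distributive_def carrier_eq
    by (auto simp: operations clopen_upsets_lattice)
  ultimately show "distributive_nabla_algebra L"
    using bounded_lattice
    by (simp add: distributive_nabla_algebra_def nabla_algebra_def distributive_nabla_algebra_axioms_def)
qed

lemma box_eq: "V \<in> clopen_upsets X \<Longrightarrow> box L V = {x \<in> points X. Rel X `` {x} \<subseteq> V}"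
  using nabla_spaceD(2)[OF space] points_clopen_upset
  by (auto simp: box_def operations arrow_eq rel_arrow_def)

section \<open>Conditions on spaces and properties of their dual algebras\<close>

text \<open>Because \<open>U\<close> is an upset, \<open>rel_nabla X U\<close> is the preimage of
  \<open>U\<close> under \<open>\<pi>\<close>; preimages commute with intersections and keep the
  whole space.\<close>

lemma normal_algebra:
  assumes "space_has X Normal"
  shows "algebra_has L Normal"
proof -
  obtain \<pi> where \<pi>: "\<pi> \<in> points X \<rightarrow> points X"
    "\<And>x y. \<lbrakk>x \<in> points X; y \<in> points X\<rbrakk> \<Longrightarrow> (x, y) \<in> Rel X \<longleftrightarrow> (x, \<pi> y) \<in> Leq X"
    using assms by auto
  have eq: "rel_nabla X U = {x \<in> points X. \<pi> x \<in> U}" if U: "U \<in> clopen_upsets X" for U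
  proof -
    have "(\<exists>y\<in>U. (y, x) \<in> Rel X) \<longleftrightarrow> \<pi> x \<in> U" if x: "x \<in> points X" for x
    proof
      assume "\<exists>y\<in>U. (y, x) \<in> Rel X"
      then obtain y where y: "y \<in> U" "(y, x) \<in> Rel X" by blast
      then have "(y, \<pi> x) \<in> Leq X" using \<pi>(2) x clopen_upsets_subset[OF U] by blast
      then show "\<pi> x \<in> U" using U y(1) unfolding clopen_upsets_def upset_def by blast
    next
      assume "\<pi> x \<in> U"
      moreover have "(\<pi> x, x) \<in> Rel X" using \<pi> x priestley(3)[of "\<pi> x"] by auto
      ultimately show "\<exists>y\<in>U. (y, x) \<in> Rel X" by blast
    qed
    then show ?thesis unfolding rel_nabla_def by blast
  qed
  have "nabla L (top L) = top L"
    using \<pi>(1) points_clopen_upset by (auto simp: operations nabla_eq eq)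
  moreover have "nabla L (meet L U V) = meet L (nabla L U) (nabla L V)"
    if "U \<in> clopen_upsets X" "V \<in> clopen_upsets X" for U V
  proof -
    have "rel_nabla X (U \<inter> V) = rel_nabla X U \<inter> rel_nabla X V"
      using that by (auto simp: eq clopen_upsets_lattice)
    then show ?thesis
      using that by (simp add: operations nabla_eq clopen_upsets_lattice nabla_spaceD(6)[OF space])
  qed
  ultimately show ?thesis by (simp add: carrier_eq)
qed

text \<open>For \<open>x\<close> in \<open>V\<close> the witness \<open>y\<close> of (Fa) has all
  its successors above \<open>x\<close>, hence in the upset \<open>V\<close>. So \<open>y\<close>
  lies in \<open>box L V\<close> and reaches \<open>x\<close>, which gives
  \<open>V \<subseteq> nabla L (box L V)\<close>.\<close>

lemma faithful_algebra:
  assumes "space_has X Faithful"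
  shows "algebra_has L Faithful"
proof -
  have "nabla L (box L V) = V" if V: "V \<in> clopen_upsets X" for V
  proof -
    have bV: "box L V \<in> clopen_upsets X" using box_closed V carrier_eq by simp
    have "rel_nabla X (box L V) = V"
    proof
      show "rel_nabla X (box L V) \<subseteq> V"
        unfolding box_eq[OF V] rel_nabla_def by blast
      show "V \<subseteq> rel_nabla X (box L V)"
      proof
        fix x assume x: "x \<in> V"
        then have xX: "x \<in> points X" using clopen_upsets_subset[OF V] by blast
        then obtain y where y: "y \<in> points X" "(y, x) \<in> Rel X"
          "\<And>z. \<lbrakk>z \<in> points X; (y, z) \<in> Rel X\<rbrakk> \<Longrightarrow> (x, z) \<in> Leq X"
          using assms by auto
        have "Rel X `` {y} \<subseteq> V"
        proof
          fix z assume "z \<in> Rel X `` {y}"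
          then have "(x, z) \<in> Leq X" using y(3)[of z] nabla_spaceD(2)[OF space] by blast
          then show "z \<in> V" using V x unfolding clopen_upsets_def upset_def by blast
        qed
        then show "x \<in> rel_nabla X (box L V)"
          unfolding box_eq[OF V] rel_nabla_def using y xX by blast
      qed
    qed
    then show ?thesis using nabla_eq[OF bV] by simp
  qed
  then have "carrier L \<subseteq> nabla L ` carrier L"
    using box_closed by (metis (no_types, lifting) carrier_eq imageI subsetI)
  moreover have "nabla L ` carrier L \<subseteq> carrier L" using nabla_closed by blast
  ultimately show ?thesis by simp
qed

text \<open>If all successors of \<open>x\<close> lie in \<open>rel_nabla X U\<close>, so does the
  witness \<open>y\<close> of (Fu). A point of \<open>U\<close> related to \<open>y\<close> is below
  \<open>x\<close>, and \<open>x\<close> is in \<open>U\<close> because \<open>U\<close> is an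
  upset.\<close>

lemma full_algebra:
  assumes "space_has X Full"
  shows "algebra_has L Full"
proof -
  have "box L (nabla L U) = U" if U: "U \<in> clopen_upsets X" for U
  proof -
    have nU: "rel_nabla X U \<in> clopen_upsets X" using nabla_spaceD(6)[OF space] U .
    have "{x \<in> points X. Rel X `` {x} \<subseteq> rel_nabla X U} = U"
    proof
      show "U \<subseteq> {x \<in> points X. Rel X `` {x} \<subseteq> rel_nabla X U}"
        using clopen_upsets_subset[OF U] nabla_spaceD(2)[OF space] unfolding rel_nabla_def by blast
      show "{x \<in> points X. Rel X `` {x} \<subseteq> rel_nabla X U} \<subseteq> U"
      proof
        fix x assume "x \<in> {x \<in> points X. Rel X `` {x} \<subseteq> rel_nabla X U}"
        then have x: "x \<in> points X" "Rel X `` {x} \<subseteq> rel_nabla X U" by auto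
        then obtain y where y: "y \<in> points X" "(x, y) \<in> Rel X"
          "\<And>z. \<lbrakk>z \<in> points X; (z, y) \<in> Rel X\<rbrakk> \<Longrightarrow> (z, x) \<in> Leq X"
          using assms by auto
        then have "y \<in> rel_nabla X U" using x by blast
        then obtain z where z: "z \<in> U" "(z, y) \<in> Rel X" unfolding rel_nabla_def by blast
        then have "(z, x) \<in> Leq X" using y(3)[of z] clopen_upsets_subset[OF U] by blast
        then show "x \<in> U" using U z unfolding clopen_upsets_def upset_def by blast
      qed
    qed
    then show ?thesis using box_eq[OF nU] nabla_eq[OF U] by simp
  qed
  then have "carrier L \<subseteq> box L ` carrier L"
    using nabla_closed by (metis (no_types, lifting) carrier_eq imageI subsetI)
  moreover have "box L ` carrier L \<subseteq> carrier L" using box_closed by blast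
  ultimately show ?thesis by simp
qed

lemma clopen_upset_algebra_reduct:
  assumes "esakia_space (Topo X) (Leq X)"
  shows "clopen_upset_algebra (order_space X) (implication_reduct L (rel_arrow (order_space X)))"
  using nabla_space_order_space[OF nabla_spaceD(1)[OF space]] assms
  by (simp add: clopen_upset_algebra_def carrier_eq le_eq eq_eq
      rel_nabla_order_space[OF nabla_spaceD(1)[OF space]])

lemma is_heyting_implication:
  assumes "esakia_space (Topo X) (Leq X)"
  shows "is_heyting_implication L (rel_arrow (order_space X))"
proof -
  interpret R: clopen_upset_algebra "order_space X" "implication_reduct L (rel_arrow (order_space X))"
    using assms by (rule clopen_upset_algebra_reduct)
  show ?thesis
    unfolding is_heyting_implication_def
    using R.residuation R.arrow_closed by simp
qed

lemma algebra_has: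
  assumes "space_has X p"
  shows "algebra_has L p"
proof (cases p)
  case Heyting
  then show ?thesis using assms is_heyting_implication by auto
next
  case Right
  have "U \<subseteq> rel_nabla X U" if "U \<in> clopen_upsets X" for U
    using clopen_upsets_subset[OF that] priestley(3) assms Right by (auto simp: rel_nabla_def)
  then show ?thesis using Right by (simp add: carrier_eq le_eq nabla_eq)
next
  case Left
  have "rel_nabla X U \<subseteq> U" if "U \<in> clopen_upsets X" for U
    using that assms Left by (auto simp: rel_nabla_def clopen_upsets_def upset_def)
  then show ?thesis using Left by (simp add: carrier_eq le_eq nabla_eq)
qed (use assms normal_algebra faithful_algebra full_algebra in simp_all)

section \<open>The unit map \<open>beta\<close>\<close>

lemma beta_eq: "x \<in> points X \<Longrightarrow> beta X x = {U \<in> clopen_upsets X. x \<in> U}"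
  by (simp add: beta_def)

lemma beta_prime:
  assumes "x \<in> points X"
  shows "beta X x \<in> prime_filters L"
  unfolding beta_eq[OF assms] using assms points_clopen_upset
  by (intro prime_filterI) (auto simp: carrier_eq le_eq operations clopen_upsets_lattice)

lemma beta_subset_iff:
  assumes "x \<in> points X" "y \<in> points X"
  shows "beta X x \<subseteq> beta X y \<longleftrightarrow> (x, y) \<in> Leq X"
proof
  assume sub: "beta X x \<subseteq> beta X y"
  show "(x, y) \<in> Leq X"
  proof (rule ccontr)
    assume "(x, y) \<notin> Leq X"
    then obtain U where "U \<in> clopen_upsets X" "x \<in> U" "y \<notin> U"
      using priestley(6)[of x y] assms unfolding clopen_upsets_def by blast
    then show False using sub assms by (auto simp: beta_eq)
  qed
next
  assume "(x, y) \<in> Leq X"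
  then show "beta X x \<subseteq> beta X y"
    using assms by (auto simp: beta_eq clopen_upsets_def upset_def)
qed

text \<open>Suppose \<open>y\<close> is not a successor of \<open>x\<close>. The successors of
  \<open>x\<close> form a compact upset, so some clopen upset \<open>V\<close> contains them and
  misses \<open>y\<close>. Then \<open>box L V\<close> is in \<open>beta X x\<close>, while
  \<open>nabla L (box L V) \<subseteq> V\<close> does not contain \<open>y\<close>.\<close>

lemma beta_Rel_iff:
  assumes "x \<in> points X" "y \<in> points X"
  shows "nabla L ` beta X x \<subseteq> beta X y \<longleftrightarrow> (x, y) \<in> Rel X"
proof
  assume "(x, y) \<in> Rel X"
  then show "nabla L ` beta X x \<subseteq> beta X y"
    using assms by (auto simp: beta_eq nabla_eq nabla_spaceD(6)[OF space]) (auto simp: rel_nabla_def)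
next
  assume sub: "nabla L ` beta X x \<subseteq> beta X y"
  show "(x, y) \<in> Rel X"
  proof (rule ccontr)
    assume nR: "(x, y) \<notin> Rel X"
    have "\<exists>V\<in>clopen_upsets X. Rel X `` {x} \<subseteq> V \<and> V \<inter> {y} = {}"
    proof (rule compactin_separation)
      show "compactin (Topo X) (Rel X `` {x})"
        using closedin_compact_space[OF priestley(1) nabla_spaceD(4)[OF space assms(1)]] .
      show "compactin (Topo X) {y}" using assms by (simp add: finite_imp_compactin)
      show "\<exists>U\<in>clopen_upsets X. z \<in> U \<and> w \<notin> U" if "z \<in> Rel X `` {x}" "w \<in> {y}" for z w
      proof -
        have z: "(x, z) \<in> Rel X" "z \<in> points X" using that nabla_spaceD(2)[OF space] by auto
        then have "(z, y) \<notin> Leq X"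
          using nR nabla_spaceD(3)[OF space, of x x z y] priestley(3)[OF assms(1)] by blast
        then show ?thesis using priestley(6)[of z y] z assms that unfolding clopen_upsets_def by blast
      qed
    qed (use points_clopen_upset in \<open>auto simp: clopen_upsets_lattice\<close>, simp add: clopen_upsets_def)
    then obtain V where V: "V \<in> clopen_upsets X" "Rel X `` {x} \<subseteq> V" "y \<notin> V" by blast
    have bV: "box L V \<in> clopen_upsets X" using V(1) box_closed carrier_eq by simp
    have "x \<in> box L V" using V assms by (simp add: box_eq)
    then have "box L V \<in> beta X x" using bV assms by (simp add: beta_eq)
    then have "nabla L (box L V) \<in> beta X y" using sub by blast
    then have "y \<in> nabla L (box L V)" using assms by (simp add: beta_eq)
    moreover have "nabla L (box L V) \<subseteq> V"
      using nabla_le_iff_le_box[of "box L V" V] V(1) bV by (simp add: carrier_eq le_eq)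
    ultimately show False using V by blast
  qed
qed

text \<open>If no point represents \<open>Q\<close>, each point has a neighbourhood \<open>W\<close>
  with \<open>W \<inter> U \<subseteq> V\<close> for some \<open>U\<close> in \<open>Q\<close> and
  some clopen upset \<open>V\<close> outside \<open>Q\<close>. Meets in \<open>Q\<close> and
  primeness carry this over to unions, so compactness yields \<open>U \<subseteq> V\<close> for one
  such pair, although \<open>Q\<close> is closed upwards.\<close>

lemma beta_surj:
  assumes Q: "Q \<in> prime_filters L"
  shows "\<exists>x\<in>points X. beta X x = Q"
proof (rule ccontr)
  assume no: "\<not> ?thesis"
  note QD = prime_filterD[OF Q]
  have "\<exists>W. openin (Topo X) W \<and> points X \<subseteq> W \<and> (\<exists>U\<in>Q. \<exists>V\<in>clopen_upsets X - Q. W \<inter> U \<subseteq> V)"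
  proof (rule compactin_Un_induct)
    show "compactin (Topo X) (points X)" using priestley(1) by (simp add: compact_space_def)
    show "\<exists>U\<in>Q. \<exists>V\<in>clopen_upsets X - Q. {} \<inter> U \<subseteq> V"
      using QD(2,3) clopen_upsets_lattice(1)[of X] by (auto simp: operations)
  next
    fix W W'
    assume "\<exists>U\<in>Q. \<exists>V\<in>clopen_upsets X - Q. W \<inter> U \<subseteq> V" "\<exists>U\<in>Q. \<exists>V\<in>clopen_upsets X - Q. W' \<inter> U \<subseteq> V"
    then obtain U V U' V' where UV: "U \<in> Q" "V \<in> clopen_upsets X" "V \<notin> Q" "W \<inter> U \<subseteq> V"
      "U' \<in> Q" "V' \<in> clopen_upsets X" "V' \<notin> Q" "W' \<inter> U' \<subseteq> V'" by blast
    then have c: "U \<in> clopen_upsets X" "U' \<in> clopen_upsets X" using QD(1) carrier_eq by auto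
    have "U \<inter> U' \<in> Q" using QD(5)[of U U'] UV c by (simp add: carrier_eq operations)
    moreover have "V \<union> V' \<in> clopen_upsets X - Q"
      using QD(6)[of V V'] UV by (simp add: carrier_eq operations clopen_upsets_lattice)
    moreover have "(W \<union> W') \<inter> (U \<inter> U') \<subseteq> V \<union> V'" using UV by blast
    ultimately show "\<exists>U\<in>Q. \<exists>V\<in>clopen_upsets X - Q. (W \<union> W') \<inter> U \<subseteq> V" by blast
  next
    fix x assume x: "x \<in> points X"
    then have "beta X x \<noteq> Q" using no by blast
    moreover have "beta X x \<subseteq> clopen_upsets X" "Q \<subseteq> clopen_upsets X"
      using x QD(1) carrier_eq by (auto simp: beta_eq)
    ultimately consider U where "U \<in> Q" "x \<notin> U" "U \<in> clopen_upsets X"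
      | V where "V \<notin> Q" "x \<in> V" "V \<in> clopen_upsets X"
      using x by (auto simp: beta_eq)
    then show "\<exists>W. openin (Topo X) W \<and> x \<in> W \<and> (\<exists>U\<in>Q. \<exists>V\<in>clopen_upsets X - Q. W \<inter> U \<subseteq> V)"
    proof cases
      case 1
      then have "openin (Topo X) (points X - U)" by (auto simp: clopen_upsets_def clopenin_def)
      moreover have "{} \<in> clopen_upsets X - Q"
        using QD(3) clopen_upsets_lattice(1)[of X] by (simp add: operations)
      moreover have "(points X - U) \<inter> U \<subseteq> {}" by blast
      ultimately show ?thesis using 1 x by blast
    next
      case 2
      then have "openin (Topo X) V" by (auto simp: clopen_upsets_def clopenin_def)
      moreover have "points X \<in> Q" using QD(2) by (simp add: operations)
      ultimately show ?thesis using 2 by blast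
    qed
  qed
  then obtain U V where UV: "U \<in> Q" "V \<in> clopen_upsets X" "V \<notin> Q" "points X \<inter> U \<subseteq> V" by blast
  have "U \<in> clopen_upsets X" using UV QD(1) carrier_eq by auto
  then have "U \<subseteq> V" using UV clopen_upsets_subset by blast
  then have "V \<in> Q" using QD(4)[of U V] UV by (simp add: le_eq carrier_eq)
  then show False using UV by simp
qed

lemma beta_bij: "bij_betw (beta X) (points X) (points (S_obj L))"
proof -
  have "inj_on (beta X) (points X)"
  proof (rule inj_onI)
    fix x y assume "x \<in> points X" "y \<in> points X" "beta X x = beta X y"
    then show "x = y" using beta_subset_iff[of x y] beta_subset_iff[of y x] priestley(5)[of x y] by simp
  qed
  moreover have "beta X ` points X = points (S_obj L)"
    unfolding points_S_obj using beta_prime beta_surj by blast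
  ultimately show ?thesis by (simp add: bij_betw_def)
qed

text \<open>The preimage of a basic set of the dual space is a difference of two clopen upsets.
  Continuity of the inverse comes from compactness and the Hausdorff property.\<close>

lemma beta_homeomorphic: "homeomorphic_map (Topo X) (Topo (S_obj L)) (beta X)"
proof (rule continuous_imp_homeomorphic_map)
  show "beta X ` points X = points (S_obj L)" "inj_on (beta X) (points X)"
    using beta_bij by (auto simp: bij_betw_def)
  show "continuous_map (Topo X) (Topo (S_obj L)) (beta X)"
    unfolding continuous_map_def
  proof (intro conjI allI impI)
    show "beta X \<in> points X \<rightarrow> points (S_obj L)" using beta_prime points_S_obj by auto
    fix W assume W: "openin (Topo (S_obj L)) W"
    let ?W = "{x \<in> points X. beta X x \<in> W}"
    have "\<exists>O'. openin (Topo X) O' \<and> x \<in> O' \<and> O' \<subseteq> ?W" if x: "x \<in> ?W" for x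
    proof -
      obtain U V where UV: "U \<in> carrier L" "V \<in> carrier L" "beta X x \<in> stone U - stone V"
          "stone U - stone V \<subseteq> W"
        using S_obj_basis[OF W, of "beta X x"] x by blast
      then have c: "U \<in> clopen_upsets X" "V \<in> clopen_upsets X" using carrier_eq by auto
      then have "openin (Topo X) (U - V)"
        by (auto simp: clopen_upsets_def clopenin_def openin_diff)
      moreover have "x \<in> U - V" using UV(3) x c by (auto simp: beta_eq)
      moreover have "U - V \<subseteq> ?W"
      proof
        fix y assume y: "y \<in> U - V"
        then have yX: "y \<in> points X" using clopen_upsets_subset[OF c(1)] by blast
        then have "beta X y \<in> stone U - stone V" using y c beta_prime by (simp add: beta_eq)
        then show "y \<in> ?W" using UV(4) yX by blast
      qed
      ultimately show ?thesis by blast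
    qed
    then show "openin (Topo X) ?W" by (subst openin_subopen) blast
  qed
qed (rule priestley Hausdorff_S_obj)+

end

section \<open>Morphisms and natural isomorphisms\<close>

lemma Hom_SpaceD:
  assumes "f \<in> Hom_Space X Y"
  shows "f \<in> points X \<rightarrow>\<^sub>E points Y" "\<And>x. x \<in> points X \<Longrightarrow> f x \<in> points Y"
    "continuous_map (Topo X) (Topo Y) f"
    "\<And>x y. (x, y) \<in> Leq X \<Longrightarrow> (f x, f y) \<in> Leq Y"
    "\<And>k l. (k, l) \<in> Rel X \<Longrightarrow> (f k, f l) \<in> Rel Y"
    "\<And>k l'. \<lbrakk>k \<in> points X; l' \<in> points Y; (f k, l') \<in> Rel Y\<rbrakk> \<Longrightarrow> \<exists>l\<in>points X. (k, l) \<in> Rel X \<and> f l = l'"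
    "\<And>k l'. \<lbrakk>k \<in> points X; l' \<in> points Y; (l', f k) \<in> Rel Y\<rbrakk>
      \<Longrightarrow> \<exists>l\<in>points X. (l, k) \<in> Rel X \<and> (l', f l) \<in> Leq Y"
  using assms unfolding Hom_Space_def by (auto dest: PiE_mem)

text \<open>Preservation of \<open>Rel\<close> gives one inclusion each for \<open>nabla\<close> and
  \<open>arrow\<close>. The converse for \<open>arrow\<close> is the second condition on maps; the
  converse for \<open>nabla\<close> is the third, where the inequality suffices as \<open>U\<close>
  is an upset.\<close>

lemma A_map_Hom_Alg:
  assumes "clopen_upset_algebra X L" "clopen_upset_algebra Y M" and f: "f \<in> Hom_Space X Y"
  shows "A_map X Y f \<in> Hom_Alg M L"
proof -
  interpret X: clopen_upset_algebra X L by fact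
  interpret Y: clopen_upset_algebra Y M by fact
  note h = Hom_SpaceD[OF f]
  let ?g = "\<lambda>U. {x \<in> points X. f x \<in> U}"
  have Am: "A_map X Y f U = ?g U" if "U \<in> clopen_upsets Y" for U
    using that by (simp add: A_map_def)
  have clo: "?g U \<in> clopen_upsets X" if U: "U \<in> clopen_upsets Y" for U
  proof -
    have "clopenin (Topo X) (?g U)"
      using U h(3) unfolding clopenin_def clopen_upsets_def
      by (auto intro: openin_continuous_map_preimage closedin_continuous_map_preimage)
    moreover have "upset (Leq X) (?g U)"
      unfolding upset_def
    proof (intro allI impI)
      fix x y assume xy: "x \<in> ?g U \<and> (x, y) \<in> Leq X"
      then have "y \<in> points X" "(f x, f y) \<in> Leq Y" using X.priestley(2) h(4) by auto
      then show "y \<in> ?g U" using xy U unfolding clopen_upsets_def upset_def by blast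
    qed
    ultimately show ?thesis by (simp add: clopen_upsets_def)
  qed
  have nab: "?g (rel_nabla Y U) = rel_nabla X (?g U)" if U: "U \<in> clopen_upsets Y" for U
  proof
    show "?g (rel_nabla Y U) \<subseteq> rel_nabla X (?g U)"
    proof
      fix k assume "k \<in> ?g (rel_nabla Y U)"
      then obtain l' where l': "k \<in> points X" "l' \<in> U" "(l', f k) \<in> Rel Y"
        by (auto simp: rel_nabla_def)
      then obtain l where l: "l \<in> points X" "(l, k) \<in> Rel X" "(l', f l) \<in> Leq Y"
        using h(7)[of k l'] clopen_upsets_subset[OF U] by blast
      then have "f l \<in> U" using l' U unfolding clopen_upsets_def upset_def by blast
      then show "k \<in> rel_nabla X (?g U)" using l l'(1) unfolding rel_nabla_def by blast
    qed
    show "rel_nabla X (?g U) \<subseteq> ?g (rel_nabla Y U)"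
      using h(2,5) by (auto simp: rel_nabla_def)
  qed
  have arr: "?g (rel_arrow Y U V) = rel_arrow X (?g U) (?g V)"
    if U: "U \<in> clopen_upsets Y" and V: "V \<in> clopen_upsets Y" for U V
  proof
    show "?g (rel_arrow Y U V) \<subseteq> rel_arrow X (?g U) (?g V)"
      using h(2,5) by (auto simp: rel_arrow_def)
    show "rel_arrow X (?g U) (?g V) \<subseteq> ?g (rel_arrow Y U V)"
    proof
      fix k assume k: "k \<in> rel_arrow X (?g U) (?g V)"
      then have kX: "k \<in> points X" by (simp add: rel_arrow_def)
      have "l' \<in> V" if l': "(f k, l') \<in> Rel Y" "l' \<in> U" for l'
      proof -
        obtain l where "l \<in> points X" "(k, l) \<in> Rel X" "f l = l'"
          using h(6)[of k l'] l' kX clopen_upsets_subset[OF U] by blast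
        then show ?thesis using k l' unfolding rel_arrow_def by blast
      qed
      then show "k \<in> ?g (rel_arrow Y U V)" using kX h(2) unfolding rel_arrow_def by blast
    qed
  qed
  note ops = X.carrier_eq Y.carrier_eq X.operations Y.operations X.nabla_eq Y.nabla_eq X.arrow_eq
    Y.arrow_eq Am clo clopen_upsets_lattice nabla_spaceD(6)[OF Y.space] Y.rel_arrow_clopen_upset
    Y.points_clopen_upset nab arr
  have "A_map X Y f \<in> clopen_upsets Y \<rightarrow>\<^sub>E clopen_upsets X"
    using clo by (auto simp: A_map_def)
  moreover have "?g (points Y) = points X" using h(2) by blast
  ultimately show ?thesis
    unfolding Hom_Alg_def by (auto simp: ops)
qed

lemma Hom_Alg_inverse:
  assumes "nabla_algebra A" and f: "f \<in> Hom_Alg A B" and bij: "bij_betw f (carrier A) (carrier B)"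
  shows "(\<lambda>b\<in>carrier B. inv_into (carrier A) f b) \<in> Hom_Alg B A"
proof -
  interpret A: nabla_algebra A by fact
  note h = Hom_AlgD[OF f]
  let ?g = "inv_into (carrier A) f"
  have gf: "?g (f a) = a" if "a \<in> carrier A" for a
    using bij that by (simp add: bij_betw_def)
  have surj: "\<exists>a\<in>carrier A. b = f a" if "b \<in> carrier B" for b
    using bij that by (auto simp: bij_betw_def)
  have top: "\<top>\<^bsub>B\<^esub> \<in> carrier B" "?g \<top>\<^bsub>B\<^esub> = \<top>\<^bsub>A\<^esub>" and bot: "\<bottom>\<^bsub>B\<^esub> \<in> carrier B" "?g \<bottom>\<^bsub>B\<^esub> = \<bottom>\<^bsub>A\<^esub>"
    using gf[of "\<top>\<^bsub>A\<^esub>"] gf[of "\<bottom>\<^bsub>A\<^esub>"] h(2)[of "\<top>\<^bsub>A\<^esub>"] h(2)[of "\<bottom>\<^bsub>A\<^esub>"] h(3,4) by simp_all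
  have un: "nabla B b \<in> carrier B \<and> ?g (nabla B b) = nabla A (?g b)" if b: "b \<in> carrier B" for b
  proof -
    obtain a where "a \<in> carrier A" "b = f a" using surj[OF b] by blast
    then show ?thesis using gf h(2)[of "nabla A a"] by (simp add: A.nabla_closed flip: h(7))
  qed
  have bin: "b \<sqinter>\<^bsub>B\<^esub> b' \<in> carrier B \<and> ?g (b \<sqinter>\<^bsub>B\<^esub> b') = ?g b \<sqinter>\<^bsub>A\<^esub> ?g b' \<and>
      b \<squnion>\<^bsub>B\<^esub> b' \<in> carrier B \<and> ?g (b \<squnion>\<^bsub>B\<^esub> b') = ?g b \<squnion>\<^bsub>A\<^esub> ?g b' \<and>
      arrow B b b' \<in> carrier B \<and> ?g (arrow B b b') = arrow A (?g b) (?g b')"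
    if b: "b \<in> carrier B" "b' \<in> carrier B" for b b'
  proof -
    obtain a a' where "a \<in> carrier A" "b = f a" "a' \<in> carrier A" "b' = f a'"
      using surj[OF b(1)] surj[OF b(2)] by blast
    then show ?thesis
      using gf h(2)[of "a \<sqinter>\<^bsub>A\<^esub> a'"] h(2)[of "a \<squnion>\<^bsub>A\<^esub> a'"] h(2)[of "arrow A a a'"]
      by (simp add: A.arrow_closed flip: h(5,6,8))
  qed
  have "?g b \<in> carrier A" if "b \<in> carrier B" for b
    using surj[OF that] gf by auto
  then show ?thesis
    unfolding Hom_Alg_def using top bot un bin by simp
qed

text \<open>The back conditions are met by preimages under the bijection. Continuity is asked of one
  direction only, so the lemma can be applied to \<open>f\<close> and then to its inverse.\<close>

lemma Hom_Space_bijection: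
  assumes X: "nabla_space X" and Y: "nabla_space Y" and f: "f \<in> extensional (points X)"
    and bij: "bij_betw f (points X) (points Y)" and cont: "continuous_map (Topo X) (Topo Y) f"
    and Leq: "\<And>x y. \<lbrakk>x \<in> points X; y \<in> points X\<rbrakk> \<Longrightarrow> (f x, f y) \<in> Leq Y \<longleftrightarrow> (x, y) \<in> Leq X"
    and Rel: "\<And>x y. \<lbrakk>x \<in> points X; y \<in> points X\<rbrakk> \<Longrightarrow> (f x, f y) \<in> Rel Y \<longleftrightarrow> (x, y) \<in> Rel X"
  shows "f \<in> Hom_Space X Y"
proof -
  note sub = priestley_spaceD(2)[OF nabla_spaceD(1)[OF X]] nabla_spaceD(2)[OF X]
  have fY: "f ` points X = points Y" using bij by (simp add: bij_betw_def)
  show ?thesis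
    unfolding Hom_Space_def mem_Collect_eq
  proof (intro conjI allI ballI impI)
    show "f \<in> points X \<rightarrow>\<^sub>E points Y" using f fY by (auto simp: PiE_iff)
    show "(f x, f y) \<in> Leq Y" if "(x, y) \<in> Leq X" for x y using that sub(1) Leq by blast
    show "(f x, f y) \<in> Rel Y" if "(x, y) \<in> Rel X" for x y using that sub(2) Rel by blast
    fix k l' assume k: "k \<in> points X" and l': "l' \<in> points Y"
    then obtain l where l: "l \<in> points X" "l' = f l" using fY by blast
    show "\<exists>l\<in>points X. (k, l) \<in> Rel X \<and> f l = l'" if "(f k, l') \<in> Rel Y"
      using that l k Rel by blast
    show "\<exists>l\<in>points X. (l, k) \<in> Rel X \<and> (l', f l) \<in> Leq Y" if "(l', f k) \<in> Rel Y"
      using that l k Rel priestley_spaceD(3)[OF nabla_spaceD(1)[OF Y] l'] by blast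
  qed (rule cont)
qed

lemma Hom_Space_homeomorphism:
  assumes X: "nabla_space X" and Y: "nabla_space Y" and f: "f \<in> extensional (points X)"
    and homeo: "homeomorphic_map (Topo X) (Topo Y) f"
    and Leq: "\<And>x y. \<lbrakk>x \<in> points X; y \<in> points X\<rbrakk> \<Longrightarrow> (f x, f y) \<in> Leq Y \<longleftrightarrow> (x, y) \<in> Leq X"
    and Rel: "\<And>x y. \<lbrakk>x \<in> points X; y \<in> points X\<rbrakk> \<Longrightarrow> (f x, f y) \<in> Rel Y \<longleftrightarrow> (x, y) \<in> Rel X"
  shows "f \<in> Hom_Space X Y" "(\<lambda>y\<in>points Y. inv_into (points X) f y) \<in> Hom_Space Y X"
proof -
  let ?g = "\<lambda>y\<in>points Y. inv_into (points X) f y"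
  have bij: "bij_betw f (points X) (points Y)"
    using homeo by (simp add: homeomorphic_eq_everything_map bij_betw_def)
  show "f \<in> Hom_Space X Y"
    using X Y f bij homeomorphic_imp_continuous_map[OF homeo] Leq Rel by (rule Hom_Space_bijection)
  have bij': "bij_betw ?g (points Y) (points X)"
    using bij_betw_inv_into[OF bij] by (simp add: bij_betw_cong[of "points Y" ?g])
  have fg: "f (?g y) = y" "?g y \<in> points X" if "y \<in> points Y" for y
    using that bij bij_betw_inv_into_right[OF bij that] bij' by (auto simp: bij_betw_def)
  obtain h where h: "homeomorphic_maps (Topo X) (Topo Y) f h"
    using homeo homeomorphic_map_maps by blast
  \<comment> \<open>The inverse \<open>h\<close> supplied by the homeomorphism agrees with
    \<open>inv_into\<close> on \<open>points Y\<close>, so continuity carries over to the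
    extensional version.\<close>
  have "h y = ?g y" if "y \<in> points Y" for y
  proof -
    have "h y \<in> points X" "f (h y) = y" "h (f (?g y)) = ?g y"
      using h that fg(2)[OF that] unfolding homeomorphic_maps_def continuous_map_def by auto
    then show ?thesis using fg(1)[OF that] by simp
  qed
  then have cont: "continuous_map (Topo Y) (Topo X) ?g"
    using h continuous_map_eq[of "Topo Y" "Topo X" h ?g] unfolding homeomorphic_maps_def by blast
  show "?g \<in> Hom_Space Y X"
  proof (rule Hom_Space_bijection[OF Y X _ bij' cont])
    fix x y assume xy: "x \<in> points Y" "y \<in> points Y"
    show "(?g x, ?g y) \<in> Leq X \<longleftrightarrow> (x, y) \<in> Leq Y" "(?g x, ?g y) \<in> Rel X \<longleftrightarrow> (x, y) \<in> Rel Y"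
      using Leq[OF fg(2)[OF xy(1)] fg(2)[OF xy(2)]] Rel[OF fg(2)[OF xy(1)] fg(2)[OF xy(2)]]
        fg(1)[OF xy(1)] fg(1)[OF xy(2)] by simp_all
  qed simp
qed

lemma isomorphism_inv_into:
  assumes "f \<in> HXY" "(\<lambda>y\<in>Y. inv_into X f y) \<in> HYX" "f \<in> extensional X" and bij: "bij_betw f X Y"
  shows "isomorphism HXY HYX X Y f"
proof -
  let ?g = "\<lambda>y\<in>Y. inv_into X f y"
  have "compose X ?g f = (\<lambda>x\<in>X. x)"
    using bij by (auto simp: compose_def bij_betw_def fun_eq_iff)
  moreover have "compose Y f ?g = (\<lambda>y\<in>Y. y)"
    using bij by (auto simp: compose_def bij_betw_inv_into_right fun_eq_iff)
  ultimately show ?thesis using assms by (auto simp: isomorphism_def)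
qed

lemma (in clopen_upset_algebra) beta_Hom_Space:
  "beta X \<in> Hom_Space X (S_obj L)"
  "(\<lambda>P\<in>points (S_obj L). inv_into (points X) (beta X) P) \<in> Hom_Space (S_obj L) X"
  using Hom_Space_homeomorphism[OF space nabla_space_S_obj _ beta_homeomorphic]
  \<comment> \<open>\<open>beta\<close> is unfolded solely inside the extensionality goal; elsewhere
    it stays folded, so that the lemmas on order and relation match.\<close>
  by (simp_all add: beta_def[THEN arg_cong[where f = "\<lambda>g. g \<in> extensional (points X)"]]
      Leq_S_obj Rel_S_obj beta_prime beta_subset_iff beta_Rel_iff)

context distributive_nabla_algebra
begin

lemma alpha_bij:
  shows "bij_betw (alpha A) (carrier A) (clopen_upsets (S_obj A))"
proof -
  have al: "alpha A a = stone a" if "a \<in> carrier A" for a using that by (simp add: alpha_def)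
  have "inj_on (alpha A) (carrier A)"
  proof (rule inj_onI)
    fix a b assume ab: "a \<in> carrier A" "b \<in> carrier A" "alpha A a = alpha A b"
    then have "\<forall>P\<in>prime_filters A. a \<in> P \<longleftrightarrow> b \<in> P" by (auto simp: al)
    then show "a = b"
      using prime_filter_le_iff[OF ab(1,2)] prime_filter_le_iff[OF ab(2,1)] ab le_antisym by simp
  qed
  moreover have "alpha A ` carrier A = stone ` carrier A" using al by (rule image_cong[OF HOL.refl])
  ultimately show ?thesis by (simp add: bij_betw_def clopen_upsets_S_obj)
qed

lemma alpha_Hom_Alg:
  assumes "clopen_upset_algebra (S_obj A) L"
  shows "alpha A \<in> Hom_Alg A L"
    and "(\<lambda>U\<in>carrier L. inv_into (carrier A) (alpha A) U) \<in> Hom_Alg L A"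
proof -
  interpret L: clopen_upset_algebra "S_obj A" L by fact
  have al: "alpha A a = stone a" if "a \<in> carrier A" for a using that by (simp add: alpha_def)
  have clo: "stone a \<in> clopen_upsets (S_obj A)" if "a \<in> carrier A" for a
    using that by (simp add: clopen_upsets_S_obj)
  have top: "stone \<top> = points (S_obj A)" using stone_top points_S_obj by simp
  show *: "alpha A \<in> Hom_Alg A L"
    unfolding Hom_Alg_def mem_Collect_eq
  proof (intro conjI ballI)
    show "alpha A \<in> carrier A \<rightarrow>\<^sub>E carrier L"
      using clo by (auto simp: L.carrier_eq alpha_def)
    show "alpha A \<top> = \<top>\<^bsub>L\<^esub>" "alpha A \<bottom> = \<bottom>\<^bsub>L\<^esub>"
      unfolding L.operations al[OF top_closed] al[OF bottom_closed] by (rule top stone_bottom)+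
    fix a assume a: "a \<in> carrier A"
    show "alpha A (nabla A a) = nabla L (alpha A a)"
      unfolding al[OF a] al[OF nabla_closed[OF a]] L.nabla_eq[OF clo[OF a]]
      by (rule rel_nabla_stone[OF a, symmetric])
    fix b assume b: "b \<in> carrier A"
    show "alpha A (a \<sqinter> b) = alpha A a \<sqinter>\<^bsub>L\<^esub> alpha A b"
      unfolding al[OF a] al[OF b] al[OF meet_closed[OF a b]] L.operations(1)[OF clo[OF a] clo[OF b]]
      by (rule stone_meet[OF a b])
    show "alpha A (a \<squnion> b) = alpha A a \<squnion>\<^bsub>L\<^esub> alpha A b"
      unfolding al[OF a] al[OF b] al[OF join_closed[OF a b]] L.operations(2)[OF clo[OF a] clo[OF b]]
      by (rule stone_join[OF a b])
    show "alpha A (arrow A a b) = arrow L (alpha A a) (alpha A b)"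
      unfolding al[OF a] al[OF b] al[OF arrow_closed[OF a b]] L.arrow_eq[OF clo[OF a] clo[OF b]]
      by (rule rel_arrow_stone[OF a b, symmetric])
  qed
  show "(\<lambda>U\<in>carrier L. inv_into (carrier A) (alpha A) U) \<in> Hom_Alg L A"
    using nabla_algebra_axioms * alpha_bij by (intro Hom_Alg_inverse) (simp_all add: L.carrier_eq)
qed

end

lemma clopen_upset_algebra_A_obj:
  "nabla_space X \<Longrightarrow> clopen_upset_algebra X (A_obj X)"
  by (simp add: clopen_upset_algebra_def A_obj_def)

lemma clopen_upset_algebra_AH_obj:
  "nabla_space X \<Longrightarrow> clopen_upset_algebra X (AH_obj X)"
  by (simp add: clopen_upset_algebra_def AH_obj_def)

lemma himp_AH_obj: "himp (AH_obj X) = rel_arrow (order_space X)"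
  by (simp add: AH_obj_def rel_arrow_def fun_eq_iff)

section \<open>Identities and composites\<close>

lemma Hom_Alg_identity: "nabla_algebra A \<Longrightarrow> (\<lambda>a\<in>carrier A. a) \<in> Hom_Alg A A"
proof -
  assume "nabla_algebra A"
  then interpret nabla_algebra A .
  show ?thesis by (auto simp: Hom_Alg_def nabla_closed arrow_closed)
qed

lemma Hom_Alg_compose:
  assumes "nabla_algebra A" and f: "f \<in> Hom_Alg A B" and g: "g \<in> Hom_Alg B D"
  shows "compose (carrier A) g f \<in> Hom_Alg A D"
proof -
  interpret nabla_algebra A by fact
  note h = Hom_AlgD[OF f] Hom_AlgD[OF g]
  have "compose (carrier A) g f \<in> carrier A \<rightarrow>\<^sub>E carrier D"
    using h by (auto simp: compose_def)
  then show ?thesis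
    unfolding Hom_Alg_def by (simp add: compose_def nabla_closed arrow_closed h)
qed

lemma Hom_Space_identity: "nabla_space X \<Longrightarrow> (\<lambda>x\<in>points X. x) \<in> Hom_Space X X"
proof -
  assume X: "nabla_space X"
  have "continuous_map (Topo X) (Topo X) (\<lambda>x\<in>points X. x)"
    by (rule continuous_map_eq[OF continuous_map_id]) simp
  then show ?thesis
    using X by (intro Hom_Space_bijection) (auto simp: bij_betw_def inj_on_def)
qed

lemma Hom_Space_compose:
  assumes X: "nabla_space X" and Z: "nabla_space Z" and f: "f \<in> Hom_Space X Y" and g: "g \<in> Hom_Space Y Z"
  shows "compose (points X) g f \<in> Hom_Space X Z"
proof -
  note hf = Hom_SpaceD[OF f] and hg = Hom_SpaceD[OF g]
  note sub = priestley_spaceD(2)[OF nabla_spaceD(1)[OF X]] nabla_spaceD(2)[OF X]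
  have c: "compose (points X) g f x = g (f x)" if "x \<in> points X" for x
    using that by (simp add: compose_def)
  show ?thesis
    unfolding Hom_Space_def mem_Collect_eq
  proof (intro conjI allI ballI impI)
    show "compose (points X) g f \<in> points X \<rightarrow>\<^sub>E points Z"
      using hf(2) hg(2) by (auto simp: compose_def)
    show "continuous_map (Topo X) (Topo Z) (compose (points X) g f)"
      using continuous_map_eq[OF continuous_map_compose[OF hf(3) hg(3)]] c by simp
    show "(compose (points X) g f x, compose (points X) g f y) \<in> Leq Z" if "(x, y) \<in> Leq X" for x y
    proof -
      have "x \<in> points X" "y \<in> points X" using that sub by auto
      then show ?thesis using that hf(4) hg(4) by (simp add: c)
    qed
    show "(compose (points X) g f x, compose (points X) g f y) \<in> Rel Z" if "(x, y) \<in> Rel X" for x y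
    proof -
      have "x \<in> points X" "y \<in> points X" using that sub by auto
      then show ?thesis using that hf(5) hg(5) by (simp add: c)
    qed
    fix k l' assume k: "k \<in> points X" and l': "l' \<in> points Z"
    show "\<exists>l\<in>points X. (k, l) \<in> Rel X \<and> compose (points X) g f l = l'"
      if R: "(compose (points X) g f k, l') \<in> Rel Z"
    proof -
      obtain m where m: "m \<in> points Y" "(f k, m) \<in> Rel Y" "g m = l'"
        using hg(6)[OF hf(2)[OF k] l'] R c[OF k] by auto
      obtain l where "l \<in> points X" "(k, l) \<in> Rel X" "f l = m" using hf(6)[OF k m(1,2)] by blast
      then show ?thesis using m c by blast
    qed
    show "\<exists>l\<in>points X. (l, k) \<in> Rel X \<and> (l', compose (points X) g f l) \<in> Leq Z"
      if R: "(l', compose (points X) g f k) \<in> Rel Z"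
    proof -
      obtain m where m: "m \<in> points Y" "(m, f k) \<in> Rel Y" "(l', g m) \<in> Leq Z"
        using hg(7)[OF hf(2)[OF k] l'] R c[OF k] by auto
      obtain l where l: "l \<in> points X" "(l, k) \<in> Rel X" "(m, f l) \<in> Leq Y"
        using hf(7)[OF k m(1,2)] by blast
      \<comment> \<open>The third condition yields inequalities, which are chained by monotonicity
        of \<open>g\<close> and transitivity.\<close>
      have "(l', g (f l)) \<in> Leq Z"
        using priestley_spaceD(4)[OF nabla_spaceD(1)[OF Z]] m(3) hg(4)[OF l(3)] by blast
      then show ?thesis using l c by auto
    qed
  qed
qed

text \<open>Between reducts the clause for \<open>nabla\<close> is trivial and the one for
  \<open>arrow\<close> is preservation of \<open>himp\<close>. Statements about Heyting morphisms
  thus split into two about plain ones.\<close>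

lemma Hom_AlgH_iff:
  "f \<in> Hom_AlgH A B \<longleftrightarrow> f \<in> Hom_Alg A B \<and>
     f \<in> Hom_Alg (implication_reduct A (himp A)) (implication_reduct B (himp B))"
  by (auto simp: Hom_AlgH_def Hom_Alg_def)

text \<open>For the order as relation, the second condition on maps is the Esakia condition, and the
  third is satisfied by \<open>l = k\<close> through reflexivity.\<close>

lemma Hom_SpaceH_iff:
  assumes X: "nabla_space X" and Y: "nabla_space Y"
  shows "f \<in> Hom_SpaceH X Y \<longleftrightarrow> f \<in> Hom_Space X Y \<and> f \<in> Hom_Space (order_space X) (order_space Y)"
proof -
  note pX = priestley_spaceD[OF nabla_spaceD(1)[OF X]] and pY = priestley_spaceD[OF nabla_spaceD(1)[OF Y]]
  have "(\<forall>x\<in>points X. f ` (Leq X `` {x}) = Leq Y `` {f x}) \<longleftrightarrow> f \<in> Hom_Space (order_space X) (order_space Y)"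
    if f: "f \<in> Hom_Space X Y"
  proof
    assume E: "\<forall>x\<in>points X. f ` (Leq X `` {x}) = Leq Y `` {f x}"
    have "\<exists>l\<in>points X. (k, l) \<in> Leq X \<and> f l = l'" if "k \<in> points X" "(f k, l') \<in> Leq Y" for k l'
    proof -
      have "l' \<in> f ` (Leq X `` {k})" using E that by blast
      then show ?thesis using pX(2) by blast
    qed
    moreover have "\<exists>l\<in>points X. (l, k) \<in> Leq X \<and> (l', f l) \<in> Leq Y"
      if "k \<in> points X" "(l', f k) \<in> Leq Y" for k l'
      using that pX(3) by blast
    ultimately show "f \<in> Hom_Space (order_space X) (order_space Y)"
      using Hom_SpaceD(1,3,4)[OF f] unfolding Hom_Space_def by simp
  next
    assume "f \<in> Hom_Space (order_space X) (order_space Y)"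
    note h = Hom_SpaceD[OF this, simplified]
    show "\<forall>x\<in>points X. f ` (Leq X `` {x}) = Leq Y `` {f x}"
    proof
      fix x assume x: "x \<in> points X"
      have "f ` (Leq X `` {x}) \<subseteq> Leq Y `` {f x}" using h(4) by blast
      moreover have "Leq Y `` {f x} \<subseteq> f ` (Leq X `` {x})" using h(6)[OF x] pY(2) by blast
      ultimately show "f ` (Leq X `` {x}) = Leq Y `` {f x}" by blast
    qed
  qed
  then show ?thesis by (auto simp: Hom_SpaceH_def)
qed

section \<open>Functoriality and naturality\<close>

lemma S_map_identity:
  assumes "distributive_nabla_algebra A"
  shows "S_map A A (\<lambda>a\<in>carrier A. a) = (\<lambda>P\<in>points (S_obj A). P)"
proof -
  interpret distributive_nabla_algebra A by fact
  have "{a \<in> carrier A. (\<lambda>a\<in>carrier A. a) a \<in> P} = P" if "P \<in> prime_filters A" for P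
    using prime_filterD(1)[OF that] by auto
  then show ?thesis unfolding S_map_def points_S_obj by (rule restrict_ext)
qed

lemma S_map_compose:
  assumes "distributive_nabla_algebra B" "distributive_nabla_algebra D"
    and f: "f \<in> Hom_Alg A B" and g: "g \<in> Hom_Alg B D"
  shows "S_map A D (compose (carrier A) g f) = compose (points (S_obj D)) (S_map A B f) (S_map B D g)"
proof -
  interpret B: distributive_nabla_algebra B by fact
  interpret D: distributive_nabla_algebra D by fact
  \<comment> \<open>\<open>S_map A B f\<close> takes its defining value only on prime filters of
    \<open>B\<close>, so membership has to be known before the composite can be unfolded. The same
    happens in \<open>A_map_compose\<close> and in the naturality squares.\<close>
  have pt: "S_map B D g P \<in> prime_filters B" if "P \<in> prime_filters D" for P
    using Hom_SpaceD(2)[OF S_map_Hom_Space[OF assms(1,2) g]] that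
    by (simp add: B.points_S_obj D.points_S_obj)
  have "{a \<in> carrier A. compose (carrier A) g f a \<in> P} = S_map A B f (S_map B D g P)"
    if P: "P \<in> prime_filters D" for P
    using pt[OF P] P Hom_AlgD(2)[OF f] by (auto simp: S_map_def compose_eq)
  then show ?thesis
    unfolding S_map_def[of A D] compose_def[of "prime_filters D"] D.points_S_obj
    by (rule restrict_ext)
qed

lemma A_map_identity:
  assumes "clopen_upset_algebra X L"
  shows "A_map X X (\<lambda>x\<in>points X. x) = (\<lambda>U\<in>carrier L. U)"
proof -
  interpret clopen_upset_algebra X L by fact
  have "{x \<in> points X. (\<lambda>x\<in>points X. x) x \<in> U} = U" if "U \<in> clopen_upsets X" for U
    using clopen_upsets_subset[OF that] by auto
  then show ?thesis unfolding A_map_def carrier_eq by (rule restrict_ext)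
qed

lemma A_map_compose:
  assumes "clopen_upset_algebra Y L" "clopen_upset_algebra Z M"
    and f: "f \<in> Hom_Space X Y" and g: "g \<in> Hom_Space Y Z"
  shows "A_map X Z (compose (points X) g f) = compose (carrier M) (A_map X Y f) (A_map Y Z g)"
proof -
  interpret Y: clopen_upset_algebra Y L by fact
  interpret Z: clopen_upset_algebra Z M by fact
  have clo: "A_map Y Z g U \<in> clopen_upsets Y" if "U \<in> clopen_upsets Z" for U
    using Hom_AlgD(2)[OF A_map_Hom_Alg[OF assms(1,2) g]] that by (simp add: Y.carrier_eq Z.carrier_eq)
  have "{x \<in> points X. compose (points X) g f x \<in> U} = A_map X Y f (A_map Y Z g U)"
    if U: "U \<in> clopen_upsets Z" for U
    using clo[OF U] U Hom_SpaceD(2)[OF f] by (auto simp: A_map_def compose_eq)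
  then show ?thesis
    unfolding A_map_def[of X Z] compose_def[of "clopen_upsets Z"] Z.carrier_eq by (rule restrict_ext)
qed

lemma alpha_natural:
  assumes "distributive_nabla_algebra A" "distributive_nabla_algebra B" and f: "f \<in> Hom_Alg A B"
  shows "compose (carrier A) (alpha B) f =
    compose (carrier A) (A_map (S_obj B) (S_obj A) (S_map A B f)) (alpha A)"
proof -
  interpret A: distributive_nabla_algebra A by fact
  interpret B: distributive_nabla_algebra B by fact
  have "alpha B (f a) = A_map (S_obj B) (S_obj A) (S_map A B f) (alpha A a)" if a: "a \<in> carrier A" for a
  proof -
    have "S_map A B f P \<in> prime_filters A" if "P \<in> prime_filters B" for P
      using Hom_SpaceD(2)[OF S_map_Hom_Space[OF assms]] that
      by (simp add: A.points_S_obj B.points_S_obj)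
    moreover have "A.stone a \<in> clopen_upsets (S_obj A)" using a A.clopen_upsets_S_obj by blast
    ultimately show ?thesis
      using a Hom_AlgD(2)[OF f a]
      by (auto simp: alpha_def A_map_def B.points_S_obj S_map_def)
  qed
  then show ?thesis unfolding compose_def by (rule restrict_ext)
qed

lemma beta_natural:
  assumes "clopen_upset_algebra X L" "clopen_upset_algebra Y M" and f: "f \<in> Hom_Space X Y"
  shows "compose (points X) (beta Y) f = compose (points X) (S_map M L (A_map X Y f)) (beta X)"
proof -
  interpret X: clopen_upset_algebra X L by fact
  interpret Y: clopen_upset_algebra Y M by fact
  have "beta Y (f x) = S_map M L (A_map X Y f) (beta X x)" if x: "x \<in> points X" for x
  proof -
    have "A_map X Y f V \<in> clopen_upsets X" if "V \<in> clopen_upsets Y" for V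
      using Hom_AlgD(2)[OF A_map_Hom_Alg[OF assms]] that by (simp add: X.carrier_eq Y.carrier_eq)
    then show ?thesis
      using x Hom_SpaceD(2)[OF f x] X.beta_prime[OF x]
      by (auto simp: S_map_def Y.carrier_eq beta_def A_map_def)
  qed
  then show ?thesis unfolding compose_def by (rule restrict_ext)
qed

lemma alpha_isomorphism:
  assumes "distributive_nabla_algebra A" "clopen_upset_algebra (S_obj A) L"
  shows "isomorphism (Hom_Alg A L) (Hom_Alg L A) (carrier A) (carrier L) (alpha A)"
proof -
  interpret distributive_nabla_algebra A by fact
  interpret L: clopen_upset_algebra "S_obj A" L by fact
  show ?thesis
    using alpha_Hom_Alg[OF assms(2)] alpha_bij
    by (intro isomorphism_inv_into) (simp_all add: L.carrier_eq alpha_def)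
qed

lemma beta_isomorphism:
  assumes "clopen_upset_algebra X L"
  shows "isomorphism (Hom_Space X (S_obj L)) (Hom_Space (S_obj L) X) (points X) (points (S_obj L)) (beta X)"
proof -
  interpret clopen_upset_algebra X L by fact
  show ?thesis
    using beta_Hom_Space beta_bij by (intro isomorphism_inv_into) (simp_all add: beta_def)
qed

abbreviation heyting_reduct :: "('a, 'm) heyting_nabla_algebra_scheme \<Rightarrow> 'a nabla_algebra" where
  "heyting_reduct A \<equiv> implication_reduct A (himp A)"

text \<open>None of these maps looks at \<open>nabla\<close>, \<open>arrow\<close> or
  \<open>Rel\<close>. Dual maps and units of the reducts are therefore the very same functions, and
  two plain results can be joined into one Heyting result.\<close>

lemma reduct_maps [simp]:
  "S_map (implication_reduct A i) (implication_reduct B j) = S_map A B"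
  "A_map (order_space X) (order_space Y) = A_map X Y"
  "alpha (implication_reduct A i) = alpha A"
  "beta (order_space X) = beta X"
  by (simp_all add: fun_eq_iff S_map_def A_map_def alpha_def beta_def)

lemma clopen_upset_algebra_heyting_reduct:
  assumes "nabla_space X" "esakia_space (Topo X) (Leq X)"
  shows "clopen_upset_algebra (order_space X) (heyting_reduct (AH_obj X))"
  using clopen_upset_algebra.clopen_upset_algebra_reduct[OF clopen_upset_algebra_AH_obj] assms
  by (simp add: himp_AH_obj)

section \<open>The duality\<close>

lemma AlgD:
  assumes "A \<in> Alg C"
  shows "distributive_nabla_algebra A" "nabla_algebra A" "clopen_upset_algebra (S_obj A) (A_obj (S_obj A))"
    "S_obj A \<in> Space C"
proof -
  show *: "distributive_nabla_algebra A" "nabla_algebra A"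
    using assms by (auto simp: Alg_def distributive_nabla_algebra_def distributive_nabla_algebra_axioms_def)
  then interpret distributive_nabla_algebra A by simp
  show "clopen_upset_algebra (S_obj A) (A_obj (S_obj A))"
    by (rule clopen_upset_algebra_A_obj[OF nabla_space_S_obj])
  show "S_obj A \<in> Space C"
    using assms nabla_space_S_obj space_has_S_obj by (auto simp: Alg_def Space_def)
qed

lemma SpaceD:
  assumes "X \<in> Space C"
  shows "nabla_space X" "clopen_upset_algebra X (A_obj X)" "A_obj X \<in> Alg C"
proof -
  show "nabla_space X" using assms by (simp add: Space_def)
  then show "clopen_upset_algebra X (A_obj X)" by (rule clopen_upset_algebra_A_obj)
  then interpret clopen_upset_algebra X "A_obj X" .
  show "A_obj X \<in> Alg C"
    using assms nabla_algebra_axioms distributive algebra_has by (auto simp: Alg_def Space_def)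
qed

lemma SpaceHD:
  assumes "X \<in> SpaceH C"
  shows "nabla_space X" "nabla_space (order_space X)" "clopen_upset_algebra X (AH_obj X)"
    "clopen_upset_algebra (order_space X) (heyting_reduct (AH_obj X))" "AH_obj X \<in> AlgH C"
proof -
  have es: "esakia_space (Topo X) (Leq X)" using assms by (simp add: SpaceH_def)
  show X: "nabla_space X" using assms by (simp add: SpaceH_def)
  show "nabla_space (order_space X)" using nabla_space_order_space[OF nabla_spaceD(1)[OF X]] es by simp
  show "clopen_upset_algebra X (AH_obj X)" using X by (rule clopen_upset_algebra_AH_obj)
  then interpret clopen_upset_algebra X "AH_obj X" .
  show "clopen_upset_algebra (order_space X) (heyting_reduct (AH_obj X))"
    using X es by (rule clopen_upset_algebra_heyting_reduct)
  show "AH_obj X \<in> AlgH C"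
    using assms nabla_algebra_axioms distributive algebra_has is_heyting_implication[OF es]
    by (auto simp: AlgH_def SpaceH_def himp_AH_obj)
qed

lemma AlgHD:
  assumes "A \<in> AlgH C"
  shows "distributive_nabla_algebra A" "nabla_algebra A" "distributive_nabla_algebra (heyting_reduct A)"
    "nabla_algebra (heyting_reduct A)" "S_obj A \<in> SpaceH C"
proof -
  have hi: "is_heyting_implication A (himp A)" using assms by (simp add: AlgH_def)
  show *: "distributive_nabla_algebra A" "nabla_algebra A"
    using assms by (auto simp: AlgH_def distributive_nabla_algebra_def distributive_nabla_algebra_axioms_def)
  then interpret distributive_nabla_algebra A by simp
  show R: "distributive_nabla_algebra (heyting_reduct A)"
    using bounded_lattice_axioms distributive hi by (rule distributive_nabla_algebra_reduct)
  then show "nabla_algebra (heyting_reduct A)" by (simp add: distributive_nabla_algebra_def)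
  \<comment> \<open>\<open>SpaceH C\<close> demands the Esakia condition even when
    \<open>Heyting\<close> is not in \<open>C\<close>, so it is derived from
    \<open>himp A\<close>.\<close>
  have "algebra_has A Heyting" using hi by auto
  then show "S_obj A \<in> SpaceH C"
    using assms nabla_space_S_obj space_has_S_obj[of Heyting] space_has_S_obj
    by (auto simp: AlgH_def SpaceH_def)
qed

section \<open>The Heyting case\<close>

lemma Hom_AlgH_identity:
  assumes "A \<in> AlgH C"
  shows "(\<lambda>a\<in>carrier A. a) \<in> Hom_AlgH A A"
  using Hom_Alg_identity[OF AlgHD(2)[OF assms]] Hom_Alg_identity[OF AlgHD(4)[OF assms]]
  by (simp add: Hom_AlgH_iff)

lemma Hom_AlgH_compose:
  assumes "A \<in> AlgH C" "f \<in> Hom_AlgH A B" "g \<in> Hom_AlgH B D"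
  shows "compose (carrier A) g f \<in> Hom_AlgH A D"
  using Hom_Alg_compose[OF AlgHD(2)[OF assms(1)]] Hom_Alg_compose[OF AlgHD(4)[OF assms(1)]] assms(2,3)
  by (simp add: Hom_AlgH_iff) blast

lemma Hom_SpaceH_identity:
  assumes "X \<in> SpaceH C"
  shows "(\<lambda>x\<in>points X. x) \<in> Hom_SpaceH X X"
  using Hom_Space_identity[OF SpaceHD(1)[OF assms]] Hom_Space_identity[OF SpaceHD(2)[OF assms]]
  by (simp add: Hom_SpaceH_iff SpaceHD(1)[OF assms])

lemma Hom_SpaceH_compose:
  assumes "X \<in> SpaceH C" "Y \<in> SpaceH C" "Z \<in> SpaceH C" "f \<in> Hom_SpaceH X Y" "g \<in> Hom_SpaceH Y Z"
  shows "compose (points X) g f \<in> Hom_SpaceH X Z"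
  using Hom_Space_compose[OF SpaceHD(1)[OF assms(1)] SpaceHD(1)[OF assms(3)]]
    Hom_Space_compose[OF SpaceHD(2)[OF assms(1)] SpaceHD(2)[OF assms(3)]] assms(4,5)
  by (simp add: Hom_SpaceH_iff SpaceHD(1)[OF assms(1)] SpaceHD(1)[OF assms(2)] SpaceHD(1)[OF assms(3)]) blast

lemma S_map_Hom_SpaceH:
  assumes "A \<in> AlgH C" "B \<in> AlgH C" "f \<in> Hom_AlgH A B"
  shows "S_map A B f \<in> Hom_SpaceH (S_obj B) (S_obj A)"
  using S_map_Hom_Space[OF AlgHD(1)[OF assms(1)] AlgHD(1)[OF assms(2)]]
    S_map_Hom_Space[OF AlgHD(3)[OF assms(1)] AlgHD(3)[OF assms(2)]] assms(3)
  by (simp add: Hom_AlgH_iff Hom_SpaceH_iff SpaceHD(1)[OF AlgHD(5)[OF assms(1)]]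
      SpaceHD(1)[OF AlgHD(5)[OF assms(2)]] S_obj_reduct)

lemma A_map_Hom_AlgH:
  assumes "X \<in> SpaceH C" "Y \<in> SpaceH C" "f \<in> Hom_SpaceH X Y"
  shows "A_map X Y f \<in> Hom_AlgH (AH_obj Y) (AH_obj X)"
  using A_map_Hom_Alg[OF SpaceHD(3)[OF assms(1)] SpaceHD(3)[OF assms(2)]]
    A_map_Hom_Alg[OF SpaceHD(4)[OF assms(1)] SpaceHD(4)[OF assms(2)]] assms(3)
  by (simp add: Hom_AlgH_iff Hom_SpaceH_iff SpaceHD(1)[OF assms(1)] SpaceHD(1)[OF assms(2)])

text \<open>One map has to be the inverse in both structures. \<open>alpha_Hom_Alg\<close> therefore
  names it as a restricted \<open>inv_into\<close> instead of asserting that an inverse exists, and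
  this is the same function for \<open>A\<close> and for its reduct.\<close>

lemma alpha_isomorphism_H:
  assumes "A \<in> AlgH C"
  shows "isomorphism (Hom_AlgH A (AH_obj (S_obj A))) (Hom_AlgH (AH_obj (S_obj A)) A)
    (carrier A) (carrier (AH_obj (S_obj A))) (alpha A)"
proof -
  note X = AlgHD(5)[OF assms]
  interpret distributive_nabla_algebra A by (rule AlgHD[OF assms])
  interpret R: distributive_nabla_algebra "heyting_reduct A" by (rule AlgHD[OF assms])
  interpret L: clopen_upset_algebra "S_obj A" "AH_obj (S_obj A)" by (rule SpaceHD[OF X])
  show ?thesis
    using alpha_Hom_Alg[OF SpaceHD(3)[OF X]] R.alpha_Hom_Alg[unfolded S_obj_reduct, OF SpaceHD(4)[OF X]]
      alpha_bij
    by (intro isomorphism_inv_into) (simp_all add: Hom_AlgH_iff L.carrier_eq alpha_def)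
qed

lemma beta_isomorphism_H:
  assumes "X \<in> SpaceH C"
  shows "isomorphism (Hom_SpaceH X (S_obj (AH_obj X))) (Hom_SpaceH (S_obj (AH_obj X)) X)
    (points X) (points (S_obj (AH_obj X))) (beta X)"
proof -
  interpret clopen_upset_algebra X "AH_obj X" by (rule SpaceHD[OF assms])
  interpret R: clopen_upset_algebra "order_space X" "heyting_reduct (AH_obj X)" by (rule SpaceHD[OF assms])
  show ?thesis
    using beta_Hom_Space R.beta_Hom_Space[unfolded S_obj_reduct] beta_bij
    by (intro isomorphism_inv_into) (simp_all add: Hom_SpaceH_iff space nabla_space_S_obj beta_def)
qed

lemma Hom_AlgH_imp_Hom_Alg: "f \<in> Hom_AlgH A B \<Longrightarrow> f \<in> Hom_Alg A B"
  by (simp add: Hom_AlgH_def)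

lemma Hom_SpaceH_imp_Hom_Space: "f \<in> Hom_SpaceH X Y \<Longrightarrow> f \<in> Hom_Space X Y"
  by (simp add: Hom_SpaceH_def)

theorem theorem3p17:
  fixes C :: "nabla_property set"
  shows "
    (\<comment> \<open>Alg C and Space C are categories\<close>
    (\<forall>A \<in> (Alg C :: 'a nabla_algebra set). (\<lambda>a\<in>carrier A. a) \<in> Hom_Alg A A) \<and>
    (\<forall>A \<in> (Alg C :: 'a nabla_algebra set). \<forall>B \<in> (Alg C :: 'b nabla_algebra set). \<forall>D \<in> (Alg C :: 'c nabla_algebra set).
       \<forall>f \<in> Hom_Alg A B. \<forall>g \<in> Hom_Alg B D. compose (carrier A) g f \<in> Hom_Alg A D) \<and>
    (\<forall>X \<in> (Space C :: 'x nabla_space set). (\<lambda>x\<in>points X. x) \<in> Hom_Space X X) \<and>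
    (\<forall>X \<in> (Space C :: 'x nabla_space set). \<forall>Y \<in> (Space C :: 'y nabla_space set). \<forall>Z \<in> (Space C :: 'z nabla_space set).
       \<forall>f \<in> Hom_Space X Y. \<forall>g \<in> Hom_Space Y Z. compose (points X) g f \<in> Hom_Space X Z) \<and>
    \<comment> \<open>S is a contravariant functor from Alg C to Space C\<close>
    (\<forall>A \<in> (Alg C :: 'a nabla_algebra set). S_obj A \<in> Space C) \<and>
    (\<forall>A \<in> (Alg C :: 'a nabla_algebra set). \<forall>B \<in> (Alg C :: 'b nabla_algebra set).
       \<forall>f \<in> Hom_Alg A B. S_map A B f \<in> Hom_Space (S_obj B) (S_obj A)) \<and>
    (\<forall>A \<in> (Alg C :: 'a nabla_algebra set).
       S_map A A (\<lambda>a\<in>carrier A. a) = (\<lambda>P\<in>points (S_obj A). P)) \<and>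
    (\<forall>A \<in> (Alg C :: 'a nabla_algebra set). \<forall>B \<in> (Alg C :: 'b nabla_algebra set). \<forall>D \<in> (Alg C :: 'c nabla_algebra set).
       \<forall>f \<in> Hom_Alg A B. \<forall>g \<in> Hom_Alg B D.
         S_map A D (compose (carrier A) g f) = compose (points (S_obj D)) (S_map A B f) (S_map B D g)) \<and>
    \<comment> \<open>A is a contravariant functor from Space C to Alg C\<close>
    (\<forall>X \<in> (Space C :: 'x nabla_space set). A_obj X \<in> Alg C) \<and>
    (\<forall>X \<in> (Space C :: 'x nabla_space set). \<forall>Y \<in> (Space C :: 'y nabla_space set).
       \<forall>f \<in> Hom_Space X Y. A_map X Y f \<in> Hom_Alg (A_obj Y) (A_obj X)) \<and>
    (\<forall>X \<in> (Space C :: 'x nabla_space set).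
       A_map X X (\<lambda>x\<in>points X. x) = (\<lambda>U\<in>carrier (A_obj X). U)) \<and>
    (\<forall>X \<in> (Space C :: 'x nabla_space set). \<forall>Y \<in> (Space C :: 'y nabla_space set). \<forall>Z \<in> (Space C :: 'z nabla_space set).
       \<forall>f \<in> Hom_Space X Y. \<forall>g \<in> Hom_Space Y Z.
         A_map X Z (compose (points X) g f) = compose (carrier (A_obj Z)) (A_map X Y f) (A_map Y Z g)) \<and>
    \<comment> \<open>alpha is a natural isomorphism from the identity to A S\<close>
    (\<forall>A \<in> (Alg C :: 'a nabla_algebra set).
       isomorphism (Hom_Alg A (A_obj (S_obj A))) (Hom_Alg (A_obj (S_obj A)) A)
         (carrier A) (carrier (A_obj (S_obj A))) (alpha A)) \<and>
    (\<forall>A \<in> (Alg C :: 'a nabla_algebra set). \<forall>B \<in> (Alg C :: 'b nabla_algebra set). \<forall>f \<in> Hom_Alg A B.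
       compose (carrier A) (alpha B) f =
       compose (carrier A) (A_map (S_obj B) (S_obj A) (S_map A B f)) (alpha A)) \<and>
    \<comment> \<open>beta is a natural isomorphism from the identity to S A\<close>
    (\<forall>X \<in> (Space C :: 'x nabla_space set).
       isomorphism (Hom_Space X (S_obj (A_obj X))) (Hom_Space (S_obj (A_obj X)) X)
         (points X) (points (S_obj (A_obj X))) (beta X)) \<and>
    (\<forall>X \<in> (Space C :: 'x nabla_space set). \<forall>Y \<in> (Space C :: 'y nabla_space set). \<forall>f \<in> Hom_Space X Y.
       compose (points X) (beta Y) f =
       compose (points X) (S_map (A_obj Y) (A_obj X) (A_map X Y f)) (beta X)))
    \<and>
    (\<comment> \<open>AlgH C and SpaceH C are categories\<close>
    (\<forall>A \<in> (AlgH C :: 'a heyting_nabla_algebra set). (\<lambda>a\<in>carrier A. a) \<in> Hom_AlgH A A) \<and>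
    (\<forall>A \<in> (AlgH C :: 'a heyting_nabla_algebra set). \<forall>B \<in> (AlgH C :: 'b heyting_nabla_algebra set). \<forall>D \<in> (AlgH C :: 'c heyting_nabla_algebra set).
       \<forall>f \<in> Hom_AlgH A B. \<forall>g \<in> Hom_AlgH B D. compose (carrier A) g f \<in> Hom_AlgH A D) \<and>
    (\<forall>X \<in> (SpaceH C :: 'x nabla_space set). (\<lambda>x\<in>points X. x) \<in> Hom_SpaceH X X) \<and>
    (\<forall>X \<in> (SpaceH C :: 'x nabla_space set). \<forall>Y \<in> (SpaceH C :: 'y nabla_space set). \<forall>Z \<in> (SpaceH C :: 'z nabla_space set).
       \<forall>f \<in> Hom_SpaceH X Y. \<forall>g \<in> Hom_SpaceH Y Z. compose (points X) g f \<in> Hom_SpaceH X Z) \<and>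
    \<comment> \<open>S is a contravariant functor from AlgH C to SpaceH C\<close>
    (\<forall>A \<in> (AlgH C :: 'a heyting_nabla_algebra set). S_obj A \<in> SpaceH C) \<and>
    (\<forall>A \<in> (AlgH C :: 'a heyting_nabla_algebra set). \<forall>B \<in> (AlgH C :: 'b heyting_nabla_algebra set).
       \<forall>f \<in> Hom_AlgH A B. S_map A B f \<in> Hom_SpaceH (S_obj B) (S_obj A)) \<and>
    (\<forall>A \<in> (AlgH C :: 'a heyting_nabla_algebra set).
       S_map A A (\<lambda>a\<in>carrier A. a) = (\<lambda>P\<in>points (S_obj A). P)) \<and>
    (\<forall>A \<in> (AlgH C :: 'a heyting_nabla_algebra set). \<forall>B \<in> (AlgH C :: 'b heyting_nabla_algebra set). \<forall>D \<in> (AlgH C :: 'c heyting_nabla_algebra set).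
       \<forall>f \<in> Hom_AlgH A B. \<forall>g \<in> Hom_AlgH B D.
         S_map A D (compose (carrier A) g f) = compose (points (S_obj D)) (S_map A B f) (S_map B D g)) \<and>
    \<comment> \<open>A is a contravariant functor from SpaceH C to AlgH C\<close>
    (\<forall>X \<in> (SpaceH C :: 'x nabla_space set). AH_obj X \<in> AlgH C) \<and>
    (\<forall>X \<in> (SpaceH C :: 'x nabla_space set). \<forall>Y \<in> (SpaceH C :: 'y nabla_space set).
       \<forall>f \<in> Hom_SpaceH X Y. A_map X Y f \<in> Hom_AlgH (AH_obj Y) (AH_obj X)) \<and>
    (\<forall>X \<in> (SpaceH C :: 'x nabla_space set).
       A_map X X (\<lambda>x\<in>points X. x) = (\<lambda>U\<in>carrier (AH_obj X). U)) \<and>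
    (\<forall>X \<in> (SpaceH C :: 'x nabla_space set). \<forall>Y \<in> (SpaceH C :: 'y nabla_space set). \<forall>Z \<in> (SpaceH C :: 'z nabla_space set).
       \<forall>f \<in> Hom_SpaceH X Y. \<forall>g \<in> Hom_SpaceH Y Z.
         A_map X Z (compose (points X) g f) = compose (carrier (AH_obj Z)) (A_map X Y f) (A_map Y Z g)) \<and>
    \<comment> \<open>alpha is a natural isomorphism from the identity to A S\<close>
    (\<forall>A \<in> (AlgH C :: 'a heyting_nabla_algebra set).
       isomorphism (Hom_AlgH A (AH_obj (S_obj A))) (Hom_AlgH (AH_obj (S_obj A)) A)
         (carrier A) (carrier (AH_obj (S_obj A))) (alpha A)) \<and>
    (\<forall>A \<in> (AlgH C :: 'a heyting_nabla_algebra set). \<forall>B \<in> (AlgH C :: 'b heyting_nabla_algebra set). \<forall>f \<in> Hom_AlgH A B.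
       compose (carrier A) (alpha B) f =
       compose (carrier A) (A_map (S_obj B) (S_obj A) (S_map A B f)) (alpha A)) \<and>
    \<comment> \<open>beta is a natural isomorphism from the identity to S A\<close>
    (\<forall>X \<in> (SpaceH C :: 'x nabla_space set).
       isomorphism (Hom_SpaceH X (S_obj (AH_obj X))) (Hom_SpaceH (S_obj (AH_obj X)) X)
         (points X) (points (S_obj (AH_obj X))) (beta X)) \<and>
    (\<forall>X \<in> (SpaceH C :: 'x nabla_space set). \<forall>Y \<in> (SpaceH C :: 'y nabla_space set). \<forall>f \<in> Hom_SpaceH X Y.
       compose (points X) (beta Y) f =
       compose (points X) (S_map (AH_obj Y) (AH_obj X) (A_map X Y f)) (beta X)))"
  \<comment> \<open>Each conjunct is the conclusion of one listed rule. Its premises are class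
    memberships or facts derived from them. Where a Heyting conjunct concerns only equations between
    maps, the plain rule is reused after forgetting \<open>himp\<close> or the Esakia
    clause.\<close>
  by (intro conjI ballI;
      rule Hom_Alg_identity Hom_Alg_compose Hom_Space_identity Hom_Space_compose
        AlgD(4) SpaceD(3) AlgHD(5) SpaceHD(5) S_map_Hom_Space A_map_Hom_Alg
        S_map_identity S_map_compose A_map_identity A_map_compose
        alpha_isomorphism alpha_natural beta_isomorphism beta_natural
        Hom_AlgH_identity Hom_AlgH_compose Hom_SpaceH_identity Hom_SpaceH_compose
        S_map_Hom_SpaceH A_map_Hom_AlgH alpha_isomorphism_H beta_isomorphism_H;
      (assumption | erule AlgD(1-3) AlgHD(1,2) SpaceD(1,2) SpaceHD(1,3)
        Hom_AlgH_imp_Hom_Alg Hom_SpaceH_imp_Hom_Space)+)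

end
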